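(* Let $m\ge1$ be an integer, $a>0$, and let $q(r)=q_0+q_1r+\frac{q_3}{6}r^3+\frac{q_4}{24}r^4$ be a real polynomial with $q(a)=a^2$ and $q'(a)=(2-m)a$. Let $g$ be the $U(2)$-invariant extremal Kähler metric determined by $q$ near the zero section of $\mathcal{O}(-m)$, i.e. $g=g_{u_h}$ with $h''(r)=\frac{q(r)}{r(r^2-q(r))}$, extended to its maximal domain. Let $P(r)=r^2-q(r)$. (i) If $P$ has no zero greater than $a$, then $g$ is defined for all $r\ge a$ and is either: (i.a) incomplete, if $P$ has degree greater than $3$; or (i.b) complete, if $P$ has degree at most $3$. In this case the metric has quartic volume growth if the degree is $2$ and exponential volume growth if the degree is $3$. (ii) If instead $P$ has a zero at some point $b>a$ and no other zero in $(a,b]$, then either: (ii.a) the zero $b$ has multiplicity one, in which case $g$ compactifies as a metric on $\mathbb{H}_m$ with cone angle $2\pi\beta$, $\beta=-\frac{P'(b)}{mb}$, along the divisor at infinity $\{r=b\}$; or (ii.b) the zero $b$ has multiplicity greater than one, in which case the metric has a complete end as $r\to b$ and finite volume. Furthermore, any $U(2)$-invariant extremal Kähler metric (on a neighbourhood of the zero section in $\mathcal{O}(-m)$) is one of these.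
   Context: Coordinates. Write $r=x_1+x_2$. Let $\mathcal{P}_{\mathcal O}=\{x_1,x_2\ge0,\ x_1+x_2\ge a\}$, and for $b>a$ let $\mathcal{P}_H=\{x_1,x_2\ge0,\ a\le x_1+x_2\le b\}$. Let $\Lambda\subset\mathbb{R}^2$ be the lattice generated by $(1,0),(0,1),(1/m,1/m)$. The total space of $\mathcal{O}(-m)\to\mathbb{CP}^1$ (resp. the Hirzebruch surface $\mathbb{H}_m=\mathbb{P}(\mathcal{O}(-m)\oplus\mathcal{O})$) carries a Hamiltonian $\mathbb{T}^2$-action whose moment map, after a linear change of coordinates, has image $\mathcal{P}_{\mathcal O}$ (resp. $\mathcal{P}_H$); over the interior of this polygon the manifold is identified with (interior)$\times\mathbb{R}^2/2\pi\Lambda$ with coordinates $(x_1,x_2,\theta_1,\theta_2)$ and symplectic form $dx_1\wedge d\theta_1+dx_2\wedge d\theta_2$. The edge $r=a$ corresponds to the zero section and, for $\mathbb{H}_m$, the edge $r=b$ to the divisor at infinity $S_b\cong\mathbb{CP}^1$. A $U(2)$-invariant Kähler metric is a metric $g_{u}=\sum_{i,j}(u_{ij}\,dx_i\,dx_j+u^{ij}\,d\theta_i\,d\theta_j)$, with $(u_{ij})=\mathrm{Hess}(u)$ positive definite, $(u^{ij})$ its inverse, $u=u_h=\tfrac12\big(x_1\log x_1+x_2\log x_2+h(x_1+x_2)\big)$, and $h''(r)-\frac{1}{m(r-a)}$ smooth up to $r=a$ (for $q$ as in the claim this is equivalent to $q(a)=a^2$, $q'(a)=(2-m)a$). It is a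 metric on $\mathbb{H}_m$ with cone angle $2\pi/p$ ($p>0$) along $S_b$ if $h''(r)-\frac1m\big(\frac1{r-a}+\frac{p}{b-r}\big)$ is smooth on $[a,b]$. It is extremal if it is extremal in the sense of Calabi, equivalently if its scalar curvature is an affine function of $(x_1,x_2)$. The maximal domain of $g$ is the set of $r\in[a,b^* )$, where $(a,b^* )$ is the maximal interval starting at $a$ on which $P>0$. Let $B_R$ be the ball of radius $R$ about a fixed point: quartic volume growth means $\mathrm{Vol}(B_R)$ is bounded above and below by positive multiples of $R^4$ for large $R$; exponential volume growth means it is bounded above and below by positive multiples of exponentials $e^{cR}$ with constants $c>0$. *)

theory Defs
  imports "HOL-Analysis.Analysis"
begin

section \<open>Smooth functions of one real variable\<close>

definition smooth_fun_on :: "(real \<Rightarrow> real) \<Rightarrow> real set \<Rightarrow> bool" where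
  "smooth_fun_on f U \<longleftrightarrow> (\<forall>k. \<forall>r\<in>U. (deriv ^^ k) f differentiable (at r))"

text \<open>For an interval \<open>I\<close> and a function \<open>f\<close> that is only meaningful on the interior of \<open>I\<close>:
  ``\<open>f\<close> is smooth on \<open>I\<close>, including the endpoints of \<open>I\<close> that belong to \<open>I\<close>''.\<close>

definition smooth_up_to :: "(real \<Rightarrow> real) \<Rightarrow> real set \<Rightarrow> bool" where
  "smooth_up_to f I \<longleftrightarrow>
     (\<exists>U F. open U \<and> I \<subseteq> U \<and> smooth_fun_on F U \<and> (\<forall>r\<in>interior I. f r = F r))"

section \<open>Riemannian metrics in coordinates\<close>

definition partial_deriv :: "'n::finite \<Rightarrow> (real^'n \<Rightarrow> real) \<Rightarrow> real^'n \<Rightarrow> real" where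
  "partial_deriv i f x = deriv (\<lambda>t. f (x + t *\<^sub>R axis i 1)) 0"

definition hess :: "(real^'n \<Rightarrow> real) \<Rightarrow> real^'n \<Rightarrow> real^'n^'n::finite" where
  "hess u x = (\<chi> i j. partial_deriv i (partial_deriv j u) x)"

definition pos_def :: "real^'n^'n::finite \<Rightarrow> bool" where
  "pos_def A \<longleftrightarrow> transpose A = A \<and> (\<forall>v. v \<noteq> 0 \<longrightarrow> 0 < v \<bullet> (A *v v))"

definition christoffel ::
    "(real^'n \<Rightarrow> real^'n^'n) \<Rightarrow> 'n \<Rightarrow> 'n \<Rightarrow> 'n::finite \<Rightarrow> real^'n \<Rightarrow> real" where
  "christoffel g k i j p =
     (\<Sum>l\<in>UNIV. matrix_inv (g p) $ k $ l *
        (partial_deriv i (\<lambda>y. g y $ j $ l) p + partial_deriv j (\<lambda>y. g y $ i $ l) p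
         - partial_deriv l (\<lambda>y. g y $ i $ j) p)) / 2"

definition ricci :: "(real^'n \<Rightarrow> real^'n^'n) \<Rightarrow> 'n \<Rightarrow> 'n::finite \<Rightarrow> real^'n \<Rightarrow> real" where
  "ricci g i j p =
     (\<Sum>k\<in>UNIV. partial_deriv k (christoffel g k i j) p - partial_deriv j (christoffel g k i k) p
        + (\<Sum>l\<in>UNIV. christoffel g k k l p * christoffel g l i j p
                   - christoffel g k j l p * christoffel g l i k p))"

definition scalar_curvature :: "(real^'n \<Rightarrow> real^'n^'n::finite) \<Rightarrow> real^'n \<Rightarrow> real" where
  "scalar_curvature g p = (\<Sum>i\<in>UNIV. \<Sum>j\<in>UNIV. matrix_inv (g p) $ i $ j * ricci g i j p)"

definition riem_length :: "(real^'n \<Rightarrow> real^'n^'n::finite) \<Rightarrow> (real \<Rightarrow> real^'n) \<Rightarrow> ennreal" where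
  "riem_length g \<gamma> =
     (\<integral>\<^sup>+ t\<in>{0..1}. (let v = vector_derivative \<gamma> (at t) in
        ennreal (sqrt (v \<bullet> (g (\<gamma> t) *v v)))) \<partial>lborel)"

definition riem_volume :: "(real^'n \<Rightarrow> real^'n^'n::finite) \<Rightarrow> (real^'n) set \<Rightarrow> ennreal" where
  "riem_volume g S = (\<integral>\<^sup>+ p\<in>S. ennreal (sqrt (det (g p))) \<partial>lborel)"

section \<open>Toric Kaehler metrics\<close>

text \<open>Momentum-angle coordinates \<open>(x\<^sub>1,x\<^sub>2,\<theta>\<^sub>1,\<theta>\<^sub>2)\<close>: the index \<open>Inl i\<close> stands for \<open>x\<^sub>i\<close>
  and \<open>Inr i\<close> for \<open>\<theta>\<^sub>i\<close>.\<close>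

type_synonym coords = "real^(2 + 2)"

definition mom :: "coords \<Rightarrow> real^2" where "mom p = (\<chi> i. p $ Inl i)"
definition ang :: "coords \<Rightarrow> real^2" where "ang p = (\<chi> i. p $ Inr i)"
definition rad :: "real^2 \<Rightarrow> real" where "rad x = x $ 1 + x $ 2"

definition toric_metric :: "(real^2 \<Rightarrow> real) \<Rightarrow> coords \<Rightarrow> real^(2+2)^(2+2)" where
  "toric_metric u p = (\<chi> a b. case (a, b) of
       (Inl i, Inl j) \<Rightarrow> hess u (mom p) $ i $ j
     | (Inr i, Inr j) \<Rightarrow> matrix_inv (hess u (mom p)) $ i $ j
     | _ \<Rightarrow> 0)"

definition upot :: "(real \<Rightarrow> real) \<Rightarrow> real^2 \<Rightarrow> real" where
  "upot h x = (x $ 1 * ln (x $ 1) + x $ 2 * ln (x $ 2) + h (rad x)) / 2"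

abbreviation U2_metric :: "(real \<Rightarrow> real) \<Rightarrow> coords \<Rightarrow> real^(2+2)^(2+2)" where
  "U2_metric h \<equiv> toric_metric (upot h)"

text \<open>Throughout, \<open>D\<close> is an interval \<open>[a,c)\<close>, \<open>a < c \<le> \<infinity>\<close>, of values of \<open>r\<close>, describing the
  \<open>U(2)\<close>-invariant neighbourhood \<open>{r \<in> D}\<close> of the zero section \<open>{r = a}\<close> in \<open>O(-m)\<close>.\<close>

definition mom_int :: "real set \<Rightarrow> (real^2) set" where
  "mom_int D = {x. 0 < x $ 1 \<and> 0 < x $ 2 \<and> rad x \<in> interior D}"

definition mom_polygon :: "real set \<Rightarrow> (real^2) set" where
  "mom_polygon D = {x. 0 \<le> x $ 1 \<and> 0 \<le> x $ 2 \<and> rad x \<in> D}"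

text \<open>The last condition says that the metric extends smoothly over the zero section: it gives
  \<open>u\<close> the singularity \<open>l ln l / 2\<close> of a smooth toric metric along the edge \<open>l = 0\<close>, where
  \<open>l = (r - a)/m\<close> has as conormal the primitive lattice vector \<open>(1/m,1/m)\<close>.  Along the edges
  \<open>x\<^sub>i = 0\<close> the analogous condition is built into \<open>upot\<close>.\<close>

definition U2_kaehler :: "nat \<Rightarrow> real \<Rightarrow> real set \<Rightarrow> (real \<Rightarrow> real) \<Rightarrow> bool" where
  "U2_kaehler m a D h \<longleftrightarrow>
     smooth_fun_on h (interior D) \<and>
     (\<forall>x\<in>mom_int D. pos_def (hess (upot h) x)) \<and>
     smooth_up_to (\<lambda>r. deriv (deriv h) r - 1 / (real m * (r - a))) D"

text \<open>For toric metrics, Calabi's condition of extremality amounts to the scalar curvature being an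
  affine function of the momentum coordinates.\<close>

definition extremal :: "real set \<Rightarrow> (real \<Rightarrow> real) \<Rightarrow> bool" where
  "extremal D h \<longleftrightarrow> (\<exists>(c::real^2) k. \<forall>p. mom p \<in> mom_int D \<longrightarrow>
     scalar_curvature (U2_metric h) p = c \<bullet> mom p + k)"

text \<open>A metric on the Hirzebruch surface over \<open>{a \<le> r \<le> b}\<close>, with cone angle \<open>\<phi> = 2\<pi>/p\<close>
  along the divisor at infinity \<open>{r = b}\<close>; the case \<open>p = 1\<close> is a smooth metric.\<close>

definition cone_metric_Hirzebruch :: "nat \<Rightarrow> real \<Rightarrow> real \<Rightarrow> (real \<Rightarrow> real) \<Rightarrow> real \<Rightarrow> bool" where
  "cone_metric_Hirzebruch m a b h \<phi> \<longleftrightarrow>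
     (\<exists>p>0. \<phi> = 2 * pi / p \<and>
        smooth_fun_on h {a<..<b} \<and>
        (\<forall>x\<in>mom_int {a..b}. pos_def (hess (upot h) x)) \<and>
        smooth_up_to (\<lambda>r. deriv (deriv h) r - (1 / (r - a) + p / (b - r)) / real m) {a..b})"

section \<open>The underlying manifold, its distance and its volume\<close>

definition angle_lattice :: "nat \<Rightarrow> (real^2) set" where
  "angle_lattice m = {of_int i *\<^sub>R axis 1 1 + of_int j *\<^sub>R axis 2 1 + of_int k *\<^sub>R (\<chi> _. 1 / real m)
                      | i j k :: int. True}"

text \<open>The toric manifold over the polygon: over the interior the fibre is the torus
  \<open>\<real>\<^sup>2/2\<pi>\<Lambda>\<close>; over the edges \<open>x\<^sub>1 = 0\<close>, \<open>x\<^sub>2 = 0\<close>, \<open>r = a\<close> the circles generated by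
  their conormals \<open>(1,0)\<close>, \<open>(0,1)\<close>, \<open>(1/m,1/m)\<close> are collapsed to points.  A point of the manifold
  is the set of all its coordinate vectors.\<close>

definition point_of :: "nat \<Rightarrow> real \<Rightarrow> coords \<Rightarrow> coords set" where
  "point_of m a p = {q. mom q = mom p \<and>
     (\<exists>l\<in>angle_lattice m. \<exists>s\<^sub>1 s\<^sub>2 s\<^sub>0.
        ang q = ang p + (2 * pi) *\<^sub>R l + s\<^sub>1 *\<^sub>R axis 1 1 + s\<^sub>2 *\<^sub>R axis 2 1 + s\<^sub>0 *\<^sub>R (\<chi> _. 1 / real m) \<and>
        (s\<^sub>1 \<noteq> 0 \<longrightarrow> mom p $ 1 = 0) \<and> (s\<^sub>2 \<noteq> 0 \<longrightarrow> mom p $ 2 = 0) \<and> (s\<^sub>0 \<noteq> 0 \<longrightarrow> rad (mom p) = a))}"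

definition space_over :: "nat \<Rightarrow> real \<Rightarrow> real set \<Rightarrow> coords set set" where
  "space_over m a D = point_of m a ` {p. mom p \<in> mom_polygon D}"

text \<open>Riemannian distance: the infimum of the lengths of piecewise \<open>C\<^sup>1\<close> curves.  A curve is a list
  of segments, each of which runs, except possibly for its endpoints, in the open dense set over the
  interior of the polygon; consecutive segments meet in the manifold, and the coordinate angles
  may jump there within one class \<open>point_of\<close>.  So the curves meet the divisors over the edges only
  finitely often; as the divisors have real codimension two, this does not change the infimum.\<close>

definition segment_in :: "real set \<Rightarrow> (real \<Rightarrow> coords) \<Rightarrow> bool" where
  "segment_in D \<gamma> \<longleftrightarrow> valid_path \<gamma> \<and> (\<forall>t\<in>{0<..<1}. mom (\<gamma> t) \<in> mom_int D) \<and>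
     mom (pathstart \<gamma>) \<in> mom_polygon D \<and> mom (pathfinish \<gamma>) \<in> mom_polygon D"

fun joins :: "nat \<Rightarrow> real \<Rightarrow> real set \<Rightarrow> coords set \<Rightarrow> (real \<Rightarrow> coords) list \<Rightarrow> coords set \<Rightarrow> bool" where
  "joins m a D A [] B \<longleftrightarrow> A = B"
| "joins m a D A (\<gamma> # \<gamma>s) B \<longleftrightarrow> segment_in D \<gamma> \<and> point_of m a (pathstart \<gamma>) = A \<and>
     joins m a D (point_of m a (pathfinish \<gamma>)) \<gamma>s B"

definition riem_dist ::
    "nat \<Rightarrow> real \<Rightarrow> real set \<Rightarrow> (real \<Rightarrow> real) \<Rightarrow> coords set \<Rightarrow> coords set \<Rightarrow> real" where
  "riem_dist m a D h A B =
     enn2real (INF \<gamma>s\<in>{\<gamma>s. joins m a D A \<gamma>s B}. \<Sum>\<gamma>\<leftarrow>\<gamma>s. riem_length (U2_metric h) \<gamma>)"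

text \<open>Volume of a set \<open>S\<close> of points of the manifold.  The divisors over the edges are null sets;
  the angles range over a fundamental domain of \<open>2\<pi>\<Lambda>\<close>, since \<open>\<Lambda>\<close> has the basis
  \<open>(1/m,1/m)\<close>, \<open>(0,1)\<close>.\<close>

definition volume_of ::
    "nat \<Rightarrow> real \<Rightarrow> real set \<Rightarrow> (real \<Rightarrow> real) \<Rightarrow> coords set set \<Rightarrow> ennreal" where
  "volume_of m a D h S = riem_volume (U2_metric h)
     {p. mom p \<in> mom_int D \<and> ang p $ 1 \<in> {0..<2 * pi / real m} \<and> ang p $ 2 \<in> {0..<2 * pi} \<and>
         point_of m a p \<in> S}"

definition ball_volume ::
    "nat \<Rightarrow> real \<Rightarrow> real set \<Rightarrow> (real \<Rightarrow> real) \<Rightarrow> coords set \<Rightarrow> real \<Rightarrow> ennreal" where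
  "ball_volume m a D h A R =
     volume_of m a D h (Metric_space.mball (space_over m a D) (riem_dist m a D h) A R)"

definition complete_metric :: "nat \<Rightarrow> real \<Rightarrow> real set \<Rightarrow> (real \<Rightarrow> real) \<Rightarrow> bool" where
  "complete_metric m a D h \<longleftrightarrow>
     Metric_space.mcomplete (space_over m a D) (riem_dist m a D h)"

text \<open>Completeness of the end \<open>r \<rightarrow> b\<close> of the part over \<open>[a,b)\<close>: the closed subsets
  \<open>{c \<le> r < b}\<close>, \<open>a < c < b\<close>, are complete for the Riemannian distance.\<close>

definition complete_end :: "nat \<Rightarrow> real \<Rightarrow> real \<Rightarrow> (real \<Rightarrow> real) \<Rightarrow> bool" where
  "complete_end m a b h \<longleftrightarrow>
     (\<forall>c\<in>{a<..<b}. Metric_space.mcomplete (space_over m a {c..<b}) (riem_dist m a {a..<b} h))"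

definition quartic_volume_growth :: "nat \<Rightarrow> real \<Rightarrow> real set \<Rightarrow> (real \<Rightarrow> real) \<Rightarrow> bool" where
  "quartic_volume_growth m a D h \<longleftrightarrow>
     (\<forall>A\<in>space_over m a D. \<exists>C\<^sub>1>0. \<exists>C\<^sub>2>0. \<forall>\<^sub>F R in at_top.
        ennreal (C\<^sub>1 * R ^ 4) \<le> ball_volume m a D h A R \<and>
        ball_volume m a D h A R \<le> ennreal (C\<^sub>2 * R ^ 4))"

definition exponential_volume_growth :: "nat \<Rightarrow> real \<Rightarrow> real set \<Rightarrow> (real \<Rightarrow> real) \<Rightarrow> bool" where
  "exponential_volume_growth m a D h \<longleftrightarrow>
     (\<forall>A\<in>space_over m a D. \<exists>C\<^sub>1>0. \<exists>c\<^sub>1>0. \<exists>C\<^sub>2>0. \<exists>c\<^sub>2>0. \<forall>\<^sub>F R in at_top.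
        ennreal (C\<^sub>1 * exp (c\<^sub>1 * R)) \<le> ball_volume m a D h A R \<and>
        ball_volume m a D h A R \<le> ennreal (C\<^sub>2 * exp (c\<^sub>2 * R)))"

section \<open>Metrics determined by a polynomial\<close>

definition qpoly :: "real \<Rightarrow> real \<Rightarrow> real \<Rightarrow> real \<Rightarrow> real poly" where
  "qpoly q\<^sub>0 q\<^sub>1 q\<^sub>3 q\<^sub>4 = [:q\<^sub>0, q\<^sub>1, 0, q\<^sub>3 / 6, q\<^sub>4 / 24:]"

definition Ppoly :: "real poly \<Rightarrow> real poly" where
  "Ppoly q = monom 1 2 - q"

definition admissible :: "nat \<Rightarrow> real \<Rightarrow> real poly \<Rightarrow> bool" where
  "admissible m a q \<longleftrightarrow> poly q a = a\<^sup>2 \<and> poly (pderiv q) a = (2 - real m) * a"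

text \<open>The set \<open>[a,b\<^sup>*)\<close>, where \<open>(a,b\<^sup>*)\<close> is the maximal interval starting at \<open>a\<close> on which
  \<open>P > 0\<close>.\<close>

definition max_domain :: "real \<Rightarrow> real poly \<Rightarrow> real set" where
  "max_domain a P = {r. a \<le> r \<and> (\<forall>s\<in>{a<..r}. 0 < poly P s)}"

definition determined_by :: "real poly \<Rightarrow> real set \<Rightarrow> (real \<Rightarrow> real) \<Rightarrow> bool" where
  "determined_by q D h \<longleftrightarrow> (\<forall>r\<in>interior D. h differentiable (at r) \<and>
     (deriv h has_real_derivative poly q r / (r * (r\<^sup>2 - poly q r))) (at r))"

end

theory Submission
  imports Defs
begin

text \<open>In momentum-angle coordinates the metric is \<open>G dx dx + G\<^sup>-\<^sup>1 d\<theta> d\<theta>\<close> with \<open>G\<close> the Hessian of the potential, and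
  \<open>G\<^sup>-\<^sup>1 = 2 (x\<^sub>i \<delta>\<^sub>i\<^sub>j - x\<^sub>i x\<^sub>j q / r\<^sup>3)\<close>. A direct computation gives the scalar curvature \<open>2 q'' / r\<close>, which is affine
  exactly when \<open>q\<close> is a quartic polynomial without quadratic term. The determinant is \<open>1\<close>, so volumes are Euclidean,
  and \<open>|\<nabla>r|\<^sup>2 = 2 P / r\<close>, so an end is complete exactly when \<open>\<integral> sqrt (r / (2 P)) dr\<close> diverges; this integral grows like
  \<open>sqrt r\<close>, \<open>ln r\<close>, or converges, according to the degree of \<open>P\<close>, and diverges at a multiple zero. Lower bounds
  for the distance come from functions with bounded gradient, upper bounds from explicit paths.\<close>

text \<open>The distance is built from coordinate curves whose angles may jump within a class, and
  the metric coefficients blow up along the edges. That it is finite, that it separates points, and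
  that coordinate limits at edges and corners are limits for it all need proof. Finiteness and
  continuity hold because the blow-up is at most inverse to the distance from the edges, hence
  integrable after the square root. Separation uses characters of the torus, damped along the edges
  where they are undefined. Every gradient bound is an instance of Cauchy-Schwarz for the Hessian
  and its inverse, whose roles are exchanged between momenta and angles. The conditions on
  \<open>q\<close> at \<open>a\<close> mean \<open>P = (r - a) P1\<close> with
  \<open>P1 a = m a > 0\<close>: \<open>h''\<close> has a simple pole with coefficient
  \<open>1 / m\<close>, and all estimates near the zero section reduce to a positive function
  \<open>P1\<close>. As \<open>q\<close> has no quadratic term, that of \<open>P\<close> has
  coefficient 1, so the degree is 2, 3 or 4. For the converse the extremal equation is linear in
  \<open>q\<close> and is integrated twice; the conditions at \<open>a\<close> are then limits
  forced by the pole of \<open>h''\<close>.\<close>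

lemma sum_UNIV_Plus:
  fixes f :: "'a::finite + 'b::finite \<Rightarrow> 'c::comm_monoid_add"
  shows "sum f UNIV = (\<Sum>i\<in>UNIV. f (Inl i)) + (\<Sum>i\<in>UNIV. f (Inr i))"
proof -
  have "sum f UNIV = sum f (UNIV <+> UNIV)" by (simp add: UNIV_Plus_UNIV)
  also have "\<dots> = (\<Sum>i\<in>UNIV. f (Inl i)) + (\<Sum>i\<in>UNIV. f (Inr i))"
    by (subst sum.Plus) auto
  finally show ?thesis .
qed

lemma prod_UNIV_Plus:
  fixes f :: "'a::finite + 'b::finite \<Rightarrow> 'c::comm_monoid_mult"
  shows "prod f UNIV = (\<Prod>i\<in>UNIV. f (Inl i)) * (\<Prod>i\<in>UNIV. f (Inr i))"
proof -
  have "prod f UNIV = prod f (UNIV <+> UNIV)" by (simp add: UNIV_Plus_UNIV)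
  also have "\<dots> = (\<Prod>i\<in>UNIV. f (Inl i)) * (\<Prod>i\<in>UNIV. f (Inr i))"
    by (subst prod.Plus) auto
  finally show ?thesis .
qed

lemma det_block_diag_2:
  fixes A :: "real^(2+2)^(2+2)"
  assumes "\<And>i j. A $ Inl i $ Inr j = 0" "\<And>i j. A $ Inr i $ Inl j = 0"
  shows "det A = (A $ Inl 1 $ Inl 1 * A $ Inl 2 $ Inl 2 - A $ Inl 1 $ Inl 2 * A $ Inl 2 $ Inl 1)
    * (A $ Inr 1 $ Inr 1 * A $ Inr 2 $ Inr 2 - A $ Inr 1 $ Inr 2 * A $ Inr 2 $ Inr 1)"
proof -
  have U: "(UNIV::(2+2) set) = {Inl 1, Inl 2, Inr 1, Inr 2}"
    by (metis (no_types) UNIV_2 UNIV_Plus_UNIV Plus_def image_insert image_empty insert_is_Un Un_insert_left sup_bot_left)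
  have f1: "finite {Inl 2, Inr 1, Inr 2::2+2}" "Inl 1 \<notin> {Inl 2, Inr 1, Inr 2::2+2}" by auto
  have f2: "finite {Inr 1, Inr 2::2+2}" "Inl 2 \<notin> {Inr 1, Inr 2::2+2}" by auto
  have f3: "finite {Inr 2::2+2}" "Inr 1 \<notin> {Inr 2::2+2}" by auto
  show ?thesis
    \<comment> \<open>Permutations of the four indices are split off one index at a time; products
      that mix the two blocks vanish.\<close>
    unfolding det_def U
    unfolding sum_over_permutations_insert[OF f1]
    unfolding sum_over_permutations_insert[OF f2]
    unfolding sum_over_permutations_insert[OF f3]
    unfolding permutes_sing
    by (simp add: sign_swap_id permutation_swap_id sign_compose sign_id swap_id_eq
        permutation_compose assms algebra_simps)
qed

text \<open>Lower bounds for lengths rest on this. For the gauge integral the fundamental theorem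
  alone makes the derivative integrable, so neither measurability nor absolute integrability of
  \<open>f'\<close> has to be known beforehand, and finitely many points without derivative are
  harmless.\<close>

lemma norm_diff_le_nn_integral:
  fixes f :: "real \<Rightarrow> 'a::euclidean_space"
  assumes S: "finite S" and K: "0 < K" and cf: "continuous_on {0..1} f"
    and der: "\<And>t. t \<in> {0<..<1} - S \<Longrightarrow> (f has_vector_derivative f' t) (at t)"
    and le: "\<And>t. t \<in> {0<..<1} - S \<Longrightarrow> norm (f' t) \<le> K * s t"
    and s: "s \<in> borel_measurable borel" "\<And>t. 0 \<le> s t"
  shows "ennreal (norm (f 1 - f 0)) \<le> ennreal K * (\<integral>\<^sup>+ t. ennreal (s t) \<partial>lborel)"
proof (cases "(\<integral>\<^sup>+ t. ennreal (s t) \<partial>lborel) < \<infinity>")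
  case True
  then obtain r where r: "(\<integral>\<^sup>+ t. ennreal (s t) \<partial>lborel) = ennreal r" "0 \<le> r"
    by (cases "(\<integral>\<^sup>+ t. ennreal (s t) \<partial>lborel)") auto
  have sr: "(s has_integral r) UNIV"
    by (rule nn_integral_has_integral[OF s r])
  define h where "h = (\<lambda>t. if t \<in> {0<..<1} - S then f' t else 0)"
  have hi: "(h has_integral (f 1 - f 0)) {0..1}"
    by (rule fundamental_theorem_of_calculus_interior_strong[OF S])
       (use der cf in \<open>auto simp: h_def\<close>)
  have "(\<lambda>x. if x \<in> {0..1} then h x else 0) = h"
    by (auto simp: h_def fun_eq_iff)
  then have hi: "(h has_integral (f 1 - f 0)) UNIV"
    using hi has_integral_restrict_UNIV[of "{0..1}" h] by metis
  have "norm (integral UNIV h) \<le> integral UNIV (\<lambda>t. K * s t)"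
    by (rule Henstock_Kurzweil_Integration.integral_norm_bound_integral)
       (use hi has_integral_mult_right[OF sr, of K] le s(2) K in \<open>auto simp: h_def\<close>)
  also have "integral UNIV h = f 1 - f 0" using hi by (rule integral_unique)
  also have "integral UNIV (\<lambda>t. K * s t) = K * r"
    using has_integral_mult_right[OF sr, of K] by (rule integral_unique)
  finally show ?thesis using K r by (simp add: ennreal_mult[symmetric] ennreal_leI)
next
  \<comment> \<open>An infinite integral makes the bound trivial, since
    \<open>K > 0\<close>.\<close>
  case False
  then have "(\<integral>\<^sup>+ t. ennreal (s t) \<partial>lborel) = \<infinity>" by (simp add: less_top[symmetric])
  then show ?thesis using K by (simp add: ennreal_mult_top)
qed

text \<open>The upper counterpart, by comparison with the increment of a primitive. At the ends
  \<open>\<psi>\<close> need only be continuous, which admits speeds like \<open>1 / sqrt t\<close>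
  of a curve leaving an edge.\<close>

lemma nn_integral_le_diff:
  assumes c: "continuous_on {0..1} \<psi>"
    and der: "\<And>t. t \<in> {0<..<1} \<Longrightarrow> (\<psi> has_real_derivative \<psi>' t) (at t)"
    and le: "\<And>t. t \<in> {0<..<1} \<Longrightarrow> 0 \<le> s t \<and> s t \<le> \<psi>' t"
  shows "(\<integral>\<^sup>+ t\<in>{0..1}. ennreal (s t) \<partial>lborel) \<le> ennreal (\<psi> 1 - \<psi> (0::real))"
proof -
  define k where "k = (\<lambda>t. if t \<in> {0<..<1} then \<psi>' t else 0)"
  have k: "(k has_integral (\<psi> 1 - \<psi> 0)) {0..1}"
    by (rule fundamental_theorem_of_calculus_interior)
       (use der c in \<open>auto simp: k_def has_real_derivative_iff_has_vector_derivative\<close>)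
  have nn: "0 \<le> k t" for t using le[of t] by (auto simp: k_def)
  have "(\<integral>\<^sup>+ t\<in>{0..1}. ennreal (s t) \<partial>lborel) = (\<integral>\<^sup>+ t. ennreal (s t) * indicator {0<..<1} t \<partial>lborel)"
  proof (rule nn_integral_cong_AE)
    have "AE t in lborel. t \<noteq> 0 \<and> t \<noteq> (1::real)"
      by (simp add: AE_lborel_singleton)
    then show "AE t in lborel. ennreal (s t) * indicator {0..1} t = ennreal (s t) * indicator {0<..<1} t"
      by eventually_elim (auto simp: indicator_def)
  qed
  also have "\<dots> \<le> (\<integral>\<^sup>+ t. ennreal (k t) * indicator {0..1} t \<partial>lborel)"
    by (rule nn_integral_mono) (use le in \<open>auto simp: k_def indicator_def intro!: ennreal_leI\<close>)
  also have "\<dots> = ennreal (\<psi> 1 - \<psi> 0)"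
    by (rule nn_integral_has_integral_lebesgue'[OF _ k]) (use nn in auto)
  finally show ?thesis .
qed

section \<open>The metric in momentum-angle coordinates\<close>

lemma matrix_inv_eqI:
  fixes A B :: "real^'n^'n"
  assumes AB: "A ** B = mat 1"
  shows "matrix_inv A = B"
proof -
  have BA: "B ** A = mat 1" using AB by (simp add: matrix_left_right_inverse)
  have "A ** matrix_inv A = mat 1 \<and> matrix_inv A ** A = mat 1"
    unfolding matrix_inv_def using AB BA by (rule someI[where x=B, OF conjI])
  then have "matrix_inv A ** (A ** B) = B" by (simp add: matrix_mul_assoc)
  then show ?thesis by (simp add: AB)
qed

text \<open>The derivative is taken along a coordinate line at one point, so a closed formula valid
  on an open set around that point is enough.\<close>

lemma partial_deriv_eqI:
  fixes f :: "real^'n \<Rightarrow> real"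
  assumes X: "open X" "x \<in> X" and eq: "\<And>y. y \<in> X \<Longrightarrow> f y = g y"
    and der: "((\<lambda>t. g (x + t *\<^sub>R axis i 1)) has_real_derivative d) (at 0)"
  shows "partial_deriv i f x = d"
proof -
  have "isCont (\<lambda>t. x + t *\<^sub>R axis i 1) 0" by (intro continuous_intros)
  then have "\<forall>\<^sub>F t in nhds 0. x + t *\<^sub>R axis i 1 \<in> X"
    using X by (simp add: continuous_within eventually_nhds_conv_at tendsto_def)
  then have "((\<lambda>t. f (x + t *\<^sub>R axis i 1)) has_real_derivative d) (at 0)"
    by (subst DERIV_cong_ev[OF refl _ refl, of _ "\<lambda>t. g (x + t *\<^sub>R axis i 1)"])
       (auto elim: eventually_mono intro: eq der)
  then show ?thesis unfolding partial_deriv_def by (rule DERIV_imp_deriv)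
qed

lemma rad_add_axis: "rad (x + t *\<^sub>R axis i 1) = rad x + t"
  using exhaust_2[of i] by (auto simp: rad_def axis_def)

lemma rad_add: "rad (x + y) = rad x + rad y" and rad_diff: "rad (x - y) = rad x - rad y"
  and rad_scaleR: "rad (c *\<^sub>R x) = c * rad x"
  by (auto simp: rad_def algebra_simps)

lemma mom_add: "mom (x + y) = mom x + mom y" and mom_diff: "mom (x - y) = mom x - mom y"
  and mom_scaleR: "mom (c *\<^sub>R x) = c *\<^sub>R mom x"
  and ang_add: "ang (x + y) = ang x + ang y" and ang_diff: "ang (x - y) = ang x - ang y"
  and ang_scaleR: "ang (c *\<^sub>R x) = c *\<^sub>R ang x"
  by (auto simp: mom_def ang_def vec_eq_iff)

lemma mom_nth: "mom p $ i = p $ Inl i" and ang_nth: "ang p $ i = p $ Inr i"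
  by (auto simp: mom_def ang_def)

lemma bounded_linear_mom: "bounded_linear mom"
  unfolding mom_def
  by (intro linear_conv_bounded_linear[THEN iffD1]) (auto simp: linear_iff vec_eq_iff)

lemma bounded_linear_ang: "bounded_linear ang"
  unfolding ang_def
  by (intro linear_conv_bounded_linear[THEN iffD1]) (auto simp: linear_iff vec_eq_iff)

lemma bounded_linear_rad: "bounded_linear rad"
  unfolding rad_def
  by (intro linear_conv_bounded_linear[THEN iffD1]) (auto simp: linear_iff vec_eq_iff algebra_simps)

lemmas continuous_on_mom [continuous_intros] =
  bounded_linear.continuous_on[OF bounded_linear_mom]
lemmas continuous_on_ang [continuous_intros] =
  bounded_linear.continuous_on[OF bounded_linear_ang]
lemmas continuous_on_rad [continuous_intros] =
  bounded_linear.continuous_on[OF bounded_linear_rad]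

definition pos_over :: "real set \<Rightarrow> (real^2) set" where
  "pos_over I = {x. 0 < x $ 1 \<and> 0 < x $ 2 \<and> rad x \<in> I}"

lemma mom_int_eq_pos_over: "mom_int D = pos_over (interior D)"
  by (simp add: mom_int_def pos_over_def)

lemma open_pos_over: "open I \<Longrightarrow> open (pos_over I)"
proof -
  assume I: "open I"
  have "pos_over I = {x. 0 < x $ 1} \<inter> {x. 0 < x $ 2} \<inter> rad -` I"
    by (auto simp: pos_over_def)
  moreover have "open (rad -` I)"
    by (rule open_vimage[OF I]) (intro continuous_intros)
  moreover have "open {x::real^2. 0 < x $ 1}" "open {x::real^2. 0 < x $ 2}"
    by (intro open_Collect_less continuous_intros)+
  ultimately show ?thesis by auto
qed

lemma pos_over_nth: "x \<in> pos_over I \<Longrightarrow> 0 < x $ i"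
  using exhaust_2[of i] by (auto simp: pos_over_def)

lemma has_real_derivative_axis_nth:
  "((\<lambda>t. (x + t *\<^sub>R axis i 1) $ j) has_real_derivative (if i = j then 1 else 0)) (at t)"
  by (cases "i = j") (auto simp: axis_def intro!: derivative_eq_intros)

lemma hess_upot:
  assumes I: "open I"
    and hd: "\<And>r. r \<in> I \<Longrightarrow> h differentiable (at r)"
    and F: "\<And>r. r \<in> I \<Longrightarrow> (deriv h has_real_derivative F r) (at r)"
    and x: "x \<in> pos_over I"
  shows "hess (upot h) x $ i $ j = ((if i = j then 1 / x $ i else 0) + F (rad x)) / 2"
proof -
  have 1: "partial_deriv j (upot h) y = (ln (y $ j) + 1 + deriv h (rad y)) / 2"
    if y: "y \<in> pos_over I" for y
  proof (rule partial_deriv_eqI[OF open_pos_over[OF I] y refl])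
    have p: "0 < y $ 1" "0 < y $ 2" "rad y \<in> I" using y by (auto simp: pos_over_def)
    have "(h has_real_derivative deriv h (rad y)) (at (0 + rad y))"
      using hd[OF p(3)] by (simp add: DERIV_deriv_iff_real_differentiable)
    then have D: "((\<lambda>t. h (rad y + t)) has_real_derivative deriv h (rad y)) (at 0)"
      by (subst (asm) DERIV_shift) (simp add: add.commute)
    have "((\<lambda>t. (let a = (y + t *\<^sub>R axis j 1) $ 1; b = (y + t *\<^sub>R axis j 1) $ 2
          in (a * ln a + b * ln b + h (rad y + t)) / 2))
        has_real_derivative (ln (y $ j) + 1 + deriv h (rad y)) / 2) (at 0)"
      using p exhaust_2[of j]
      by (auto simp: axis_def Let_def intro!: derivative_eq_intros D)
    then show "((\<lambda>t. upot h (y + t *\<^sub>R axis j 1)) has_real_derivative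
          (ln (y $ j) + 1 + deriv h (rad y)) / 2) (at 0)"
      by (simp add: upot_def Let_def rad_add_axis)
  qed
  have "partial_deriv i (partial_deriv j (upot h)) x = ((if i = j then 1 / x $ i else 0) + F (rad x)) / 2"
  proof (rule partial_deriv_eqI[OF open_pos_over[OF I] x, where g = "\<lambda>y. (ln (y $ j) + 1 + deriv h (rad y)) / 2"])
    have p: "0 < x $ j" "rad x \<in> I" using pos_over_nth[OF x] x by (auto simp: pos_over_def)
    have "(deriv h has_real_derivative F (rad x)) (at (0 + rad x))"
      using F[OF p(2)] by simp
    then have D: "((\<lambda>t. deriv h (rad x + t)) has_real_derivative F (rad x)) (at 0)"
      by (subst (asm) DERIV_shift) (simp add: add.commute)
    show "((\<lambda>t. (ln ((x + t *\<^sub>R axis i 1) $ j) + 1 + deriv h (rad (x + t *\<^sub>R axis i 1))) / 2)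
      has_real_derivative ((if i = j then 1 / x $ i else 0) + F (rad x)) / 2) (at 0)"
      unfolding rad_add_axis
      using p by (cases "i = j") (auto simp: axis_def intro!: derivative_eq_intros D)
  qed (rule 1)
  then show ?thesis by (simp add: hess_def)
qed

text \<open>Lagrange's identity for the Hessian \<open>G\<close> and its inverse \<open>H\<close>:
  the defect in Cauchy-Schwarz for the pairing of \<open>k\<close> and \<open>v\<close> is
  \<open>det H\<close> times the squared cross product of \<open>k\<close> with \<open>G v\<close>.
  The square makes the sign visible.\<close>

lemma pairing_identity: 
  fixes s t fr w k1 k2 v1 v2 :: real
  assumes "w = 1 - (s + t) * fr" "s \<noteq> 0" "t \<noteq> 0" "w \<noteq> 0"
  shows "2 * (s * k1\<^sup>2 + t * k2\<^sup>2 - fr * (s * k1 + t * k2)\<^sup>2) * ((v1\<^sup>2 / s + v2\<^sup>2 / t + fr / w * (v1 + v2)\<^sup>2) / 2) - (k1 * v1 + k2 * v2)\<^sup>2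
     = s * t / w * (k1 * (w * v2 / t + fr * (v1 + v2)) - k2 * (w * v1 / s + fr * (v1 + v2)))\<^sup>2"
proof -
  have "w * s * t * ((s * k1\<^sup>2 + t * k2\<^sup>2 - fr * (s * k1 + t * k2)\<^sup>2) * (v1\<^sup>2 / s + v2\<^sup>2 / t + fr / w * (v1 + v2)\<^sup>2) - (k1 * v1 + k2 * v2)\<^sup>2)
   = (s * k1\<^sup>2 + t * k2\<^sup>2 - fr * (s * k1 + t * k2)\<^sup>2) * (w * t * v1\<^sup>2  + w * s * v2\<^sup>2 + fr * s * t * (v1 + v2)\<^sup>2) - w * s * t * (k1 * v1 + k2 * v2)\<^sup>2"
   using assms(2-) by (simp add: field_simps)
  also have "\<dots> = (k1 * (w * v2 * s + fr * s * t * (v1 + v2)) - k2 * (w * v1 * t + fr * s * t * (v1 + v2)))\<^sup>2"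
   unfolding assms(1) by algebra
  also have "\<dots> = w * s * t * (s * t / w * (k1 * (w * v2 / t + fr * (v1 + v2)) - k2 * (w * v1 / s + fr * (v1 + v2)))\<^sup>2)"
   using assms(2-) by (simp add: field_simps power2_eq_square)
  finally have "(s * k1\<^sup>2 + t * k2\<^sup>2 - fr * (s * k1 + t * k2)\<^sup>2) * (v1\<^sup>2 / s + v2\<^sup>2 / t + fr / w * (v1 + v2)\<^sup>2) - (k1 * v1 + k2 * v2)\<^sup>2
     = s * t / w * (k1 * (w * v2 / t + fr * (v1 + v2)) - k2 * (w * v1 / s + fr * (v1 + v2)))\<^sup>2"
    by (subst (asm) mult_left_cancel) (use assms(2-) in auto)
  moreover have "2 * K * (G / 2) = K * G" for K G :: real by simp
  ultimately show ?thesis by (simp only:)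
qed

text \<open>Splits a momentum vector into its part along a level line of \<open>r\<close> and its
  radial part: two squares, with positive coefficients for positive \<open>s\<close>,
  \<open>t\<close>, \<open>w\<close>.\<close>

lemma quadG_identity: 
  fixes s t fr w k1 k2 v1 v2 :: real
  assumes "w = 1 - (s + t) * fr" "s \<noteq> 0" "t \<noteq> 0" "w \<noteq> 0" "s + t \<noteq> 0"
  shows "(v1\<^sup>2 / s + v2\<^sup>2 / t + fr / w * (v1 + v2)\<^sup>2) / 2 = ((v1 * t - v2 * s)\<^sup>2 / (s * t) + (v1 + v2)\<^sup>2 / w) / (2 * (s + t))"
proof -
  have *: "(s + t) * ((v1\<^sup>2 * t * w + v2\<^sup>2 * s * w) + fr * s * t * (v1 + v2)\<^sup>2) = (v1 * t - v2 * s)\<^sup>2 * w + (v1 + v2)\<^sup>2 * (s * t)"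
   unfolding assms(1) by algebra
  have "v1\<^sup>2 / s + v2\<^sup>2 / t + fr / w * (v1 + v2)\<^sup>2 = ((v1\<^sup>2 * t * w + v2\<^sup>2 * s * w) + fr * s * t * (v1 + v2)\<^sup>2) / (s * t * w)"
   using assms(2-) by (simp add: field_simps)
  also have "\<dots> = ((v1 * t - v2 * s)\<^sup>2 * w + (v1 + v2)\<^sup>2 * (s * t)) / ((s + t) * (s * t * w))"
   unfolding *[symmetric] using assms(2-) by simp
  also have "\<dots> = ((v1 * t - v2 * s)\<^sup>2 / (s * t) + (v1 + v2)\<^sup>2 / w) / (s + t)"
   using assms(2-4) by (simp add: add_divide_distrib ac_simps)
  finally show ?thesis by simp
qed

text \<open>The analogous sum of two squares for the inverse block.\<close>

lemma quadH_identity: 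
  fixes s t fr w k1 k2 v1 v2 :: real
  assumes "w = 1 - (s + t) * fr" "s + t \<noteq> 0"
  shows "2 * (s * k1\<^sup>2 + t * k2\<^sup>2 - fr * (s * k1 + t * k2)\<^sup>2) = 2 * (s * t * (k1 - k2)\<^sup>2 + w * (s * k1 + t * k2)\<^sup>2) / (s + t)"
proof -
  have "(s * k1\<^sup>2 + t * k2\<^sup>2 - fr * (s * k1 + t * k2)\<^sup>2) * (s + t) = s * t * (k1 - k2)\<^sup>2 + w * (s * k1 + t * k2)\<^sup>2"
    unfolding assms(1) by algebra
  then show ?thesis using assms(2) by (simp add: field_simps)
qed

text \<open>\<open>F\<close> is the second derivative of \<open>h\<close>. The inverse Hessian is affine in \<open>f = q / r\<^sup>3\<close>, so
  \<open>f\<close>, rather than \<open>F\<close> or \<open>q\<close>, is the convenient parameter; \<open>1 - r f = P / r\<^sup>2\<close>.\<close>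

locale momentum_profile =
  fixes I :: "real set" and h F f :: "real \<Rightarrow> real"
  assumes open_I: "open I" and I_pos: "\<And>r. r \<in> I \<Longrightarrow> 0 < r"
    and h_diff: "\<And>r. r \<in> I \<Longrightarrow> h differentiable (at r)"
    and h_F: "\<And>r. r \<in> I \<Longrightarrow> (deriv h has_real_derivative F r) (at r)"
    and w_pos: "\<And>r. r \<in> I \<Longrightarrow> 0 < 1 - r * f r"
    and F_f: "\<And>r. r \<in> I \<Longrightarrow> F r = f r / (1 - r * f r)"
    and f_cont: "continuous_on I f"
begin

text \<open>The Hessian is a diagonal matrix plus a multiple of the all-ones matrix, so its inverse
  is a rank-one correction of a diagonal matrix (Sherman-Morrison), with coefficient
  \<open>F / (1 + r F) = f\<close>.\<close>

definition invh :: "real^2 \<Rightarrow> real^2^2" where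
  "invh x = (\<chi> i j. 2 * ((if i = j then x $ i else 0) - x $ i * x $ j * f (rad x)))"

lemma hess_nth:
  "x \<in> pos_over I \<Longrightarrow> hess (upot h) x $ i $ j = ((if i = j then 1 / x $ i else 0) + F (rad x)) / 2"
  by (rule hess_upot[OF open_I h_diff h_F])

lemma hess_invh: assumes x: "x \<in> pos_over I" shows "hess (upot h) x ** invh x = mat 1"
proof -
  define s t fr w where "s = x $ 1" "t = x $ 2" "fr = f (rad x)" "w = 1 - (s + t) * fr"
  note d = this
  have p: "0 < s" "0 < t" "rad x \<in> I" using x by (auto simp: pos_over_def d)
  have w: "w > 0" using w_pos[OF p(3)] by (simp add: rad_def d)
  have F: "F (rad x) = fr / w" using F_f[OF p(3)] by (simp add: rad_def d)
  have nz: "s \<noteq> 0" "t \<noteq> 0" "w \<noteq> 0" using p w by auto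
  have "(1 / s + fr / w) / 2 * (2 * (s - s * s * fr)) + fr / w / 2 * (2 * - (t * s * fr)) = 1"
    "(1 / t + fr / w) / 2 * (2 * (t - t * t * fr)) + fr / w / 2 * (2 * - (s * t * fr)) = 1"
    "(1 / s + fr / w) / 2 * (2 * - (s * t * fr)) + fr / w / 2 * (2 * (t - t * t * fr)) = 0"
    "(1 / t + fr / w) / 2 * (2 * - (t * s * fr)) + fr / w / 2 * (2 * (s - s * s * fr)) = 0"
    using nz by (simp_all add: divide_simps) (use d(4) in algebra)+
  then show ?thesis
    unfolding vec_eq_iff forall_2 matrix_matrix_mult_def invh_def
    by (simp add: sum_2 hess_nth[OF x] mat_def F del: times_divide_eq_left times_divide_eq_right
       flip: d(1-3))
qed

lemma matrix_inv_hess: "x \<in> pos_over I \<Longrightarrow> matrix_inv (hess (upot h) x) = invh x"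
  by (rule matrix_inv_eqI[OF hess_invh])

lemma metric_nth:
  assumes "mom p \<in> pos_over I"
  shows "U2_metric h p $ Inl i $ Inl j = ((if i = j then 1 / p $ Inl i else 0) + F (rad (mom p))) / 2"
    "U2_metric h p $ Inr i $ Inr j = 2 * ((if i = j then p $ Inl i else 0) - p $ Inl i * p $ Inl j * f (rad (mom p)))"
    "U2_metric h p $ Inl i $ Inr j = 0" "U2_metric h p $ Inr i $ Inl j = 0"
  using assms by (simp_all add: toric_metric_def hess_nth matrix_inv_hess invh_def mom_nth)

lemma matrix_inv_metric_nth:
  assumes p: "mom p \<in> pos_over I"
  shows "matrix_inv (U2_metric h p) $ Inr i $ Inr j = ((if i = j then 1 / p $ Inl i else 0) + F (rad (mom p))) / 2"
    "matrix_inv (U2_metric h p) $ Inl i $ Inl j = 2 * ((if i = j then p $ Inl i else 0) - p $ Inl i * p $ Inl j * f (rad (mom p)))"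
    "matrix_inv (U2_metric h p) $ Inl i $ Inr j = 0" "matrix_inv (U2_metric h p) $ Inr i $ Inl j = 0"
proof -
  define B :: "real^(2+2)^(2+2)" where "B = (\<chi> a b. case (a, b) of
       (Inl i, Inl j) \<Rightarrow> invh (mom p) $ i $ j
     | (Inr i, Inr j) \<Rightarrow> hess (upot h) (mom p) $ i $ j
     | _ \<Rightarrow> 0)"
  have 1: "hess (upot h) (mom p) ** invh (mom p) = mat 1" by (rule hess_invh[OF p])
  then have 2: "invh (mom p) ** hess (upot h) (mom p) = mat 1" by (simp add: matrix_left_right_inverse)
  have "(U2_metric h p ** B) $ a $ b = mat 1 $ a $ b" for a b
    using 1[THEN arg_cong, where f="\<lambda>A. A $ projl a $ projl b"]
      2[THEN arg_cong, where f="\<lambda>A. A $ projr a $ projr b"]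
    by (cases a; cases b)
       (auto simp: matrix_matrix_mult_def sum_UNIV_Plus toric_metric_def B_def matrix_inv_hess[OF p] mat_def)
  then have "matrix_inv (U2_metric h p) = B"
    by (intro matrix_inv_eqI) (simp add: vec_eq_iff)
  then show "matrix_inv (U2_metric h p) $ Inr i $ Inr j = ((if i = j then 1 / p $ Inl i else 0) + F (rad (mom p))) / 2"
    "matrix_inv (U2_metric h p) $ Inl i $ Inl j = 2 * ((if i = j then p $ Inl i else 0) - p $ Inl i * p $ Inl j * f (rad (mom p)))"
    "matrix_inv (U2_metric h p) $ Inl i $ Inr j = 0" "matrix_inv (U2_metric h p) $ Inr i $ Inl j = 0"
    using p by (simp_all add: B_def invh_def hess_nth mom_nth)
qed

lemma det_metric: assumes p: "mom p \<in> pos_over I" shows "det (U2_metric h p) = 1"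
proof -
  define s t fr w where "s = p $ Inl 1" "t = p $ Inl 2" "fr = f (rad (mom p))" "w = 1 - (s + t) * fr"
  note d = this
  have p': "0 < s" "0 < t" "rad (mom p) \<in> I" using p by (auto simp: pos_over_def mom_nth d)
  have w: "w > 0" using w_pos[OF p'(3)] by (simp add: rad_def d mom_nth)
  have F: "F (rad (mom p)) = fr / w" using F_f[OF p'(3)] by (simp add: rad_def d mom_nth)
  have nz: "s \<noteq> 0" "t \<noteq> 0" "w \<noteq> 0" using p' w by auto
  have 1: "(1/s + fr/w)/2 * ((1/t + fr/w)/2) - (fr/w/2)^2 = 1 / (4 * s * t * w)"
    using nz d(4) by (simp add: field_simps power2_eq_square) algebra
  have 2: "2 * (s - s * s * fr) * (2 * (t - t * t * fr)) - (2 * s * t * fr)^2 = 4 * s * t * w"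
    using d(4) by algebra
  have "det (U2_metric h p) = ((1/s + fr/w)/2 * ((1/t + fr/w)/2) - (fr/w/2)^2) *
    (2 * (s - s * s * fr) * (2 * (t - t * t * fr)) - (2 * s * t * fr)^2)"
    unfolding F[symmetric]
    by (subst det_block_diag_2) (simp_all add: metric_nth[OF p] d(1-3) power2_eq_square)
  also have "\<dots> = 1" unfolding 1 2 using nz by simp
  finally show ?thesis .
qed

text \<open>The quadratic forms of the Hessian and of its inverse. Dually, \<open>quadH x k\<close>
  is the squared norm of \<open>k\<close> as a covector on momenta, and \<open>quadG x k\<close>
  that of \<open>k\<close> as a covector on angles; the gradient estimates use them in this second
  role.\<close>

definition quadG :: "real^2 \<Rightarrow> real^2 \<Rightarrow> real" where
  "quadG x v = ((v $ 1)\<^sup>2 / x $ 1 + (v $ 2)\<^sup>2 / x $ 2 + F (rad x) * (v $ 1 + v $ 2)\<^sup>2) / 2"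

definition quadH :: "real^2 \<Rightarrow> real^2 \<Rightarrow> real" where
  "quadH x v = 2 * (x $ 1 * (v $ 1)\<^sup>2 + x $ 2 * (v $ 2)\<^sup>2 - f (rad x) * (x $ 1 * v $ 1 + x $ 2 * v $ 2)\<^sup>2)"


end

context momentum_profile
begin

lemma metric_quad:
  assumes p: "mom p \<in> pos_over I"
  shows "v \<bullet> (U2_metric h p *v v) = quadG (mom p) (mom v) + quadH (mom p) (ang v)"
proof -
  define A where "A = U2_metric h p"
  define x y k l where "x = p $ Inl 1" "y = p $ Inl 2" "k = F (rad (mom p))" "l = f (rad (mom p))"
  note d1 = this
  define a b c d where "a = v $ Inl 1" "b = v $ Inl 2" "c = v $ Inr 1" "d = v $ Inr 2"
  note d2 = this
  have z: "A $ Inl i $ Inr j = 0" "A $ Inr i $ Inl j = 0" for i j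
    unfolding A_def by (rule metric_nth[OF p])+
  have e: "A $ Inl 1 $ Inl 1 = (1 / x + k) / 2" "A $ Inl 2 $ Inl 2 = (1 / y + k) / 2"
    "A $ Inl 1 $ Inl 2 = k / 2" "A $ Inl 2 $ Inl 1 = k / 2"
    "A $ Inr 1 $ Inr 1 = 2 * (x - x * x * l)" "A $ Inr 2 $ Inr 2 = 2 * (y - y * y * l)"
    "A $ Inr 1 $ Inr 2 = - 2 * x * y * l" "A $ Inr 2 $ Inr 1 = - 2 * x * y * l"
    unfolding A_def d1 metric_nth(1,2)[OF p] by simp_all
  have "v \<bullet> (A *v v) = a * (A $ Inl 1 $ Inl 1 * a + A $ Inl 1 $ Inl 2 * b)
      + b * (A $ Inl 2 $ Inl 1 * a + A $ Inl 2 $ Inl 2 * b)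
      + (c * (A $ Inr 1 $ Inr 1 * c + A $ Inr 1 $ Inr 2 * d)
      + d * (A $ Inr 2 $ Inr 1 * c + A $ Inr 2 $ Inr 2 * d))"
    unfolding inner_vec_def matrix_vector_mult_def sum_UNIV_Plus sum_2 d2 by (simp add: z)
  also have "\<dots> = ((a\<^sup>2 / x + b\<^sup>2 / y + k * (a + b)\<^sup>2) / 2) +
      2 * (x * c\<^sup>2 + y * d\<^sup>2 - l * (x * c + y * d)\<^sup>2)"
    unfolding e by (simp add: power2_eq_square algebra_simps add_divide_distrib)
  finally show ?thesis
    unfolding A_def quadG_def quadH_def mom_nth ang_nth d1 d2 .
qed

lemma pairing_le:
  assumes x: "x \<in> pos_over I"
  shows "(k $ 1 * v $ 1 + k $ 2 * v $ 2)\<^sup>2 \<le> quadH x k * quadG x v"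
proof -
  define s t fr w where "s = x $ 1" "t = x $ 2" "fr = f (rad x)" "w = 1 - (s + t) * fr"
  note d = this
  have p: "0 < s" "0 < t" "rad x \<in> I" using x by (auto simp: pos_over_def d)
  have w: "w > 0" using w_pos[OF p(3)] by (simp add: rad_def d)
  have nz: "s \<noteq> 0" "t \<noteq> 0" "w \<noteq> 0" "s + t \<noteq> 0" using p w by auto
  have F: "F (rad x) = fr / w" using F_f[OF p(3)] by (simp add: rad_def d)
  have "quadH x k * quadG x v - (k $ 1 * v $ 1 + k $ 2 * v $ 2)\<^sup>2
     = s * t / w * (k $ 1 * (w * v $ 2 / t + fr * (v $ 1 + v $ 2)) - k $ 2 * (w * v $ 1 / s + fr * (v $ 1 + v $ 2)))\<^sup>2"
    unfolding quadH_def quadG_def F d(1-3)[symmetric] by (rule pairing_identity[OF d(4) nz(1-3)])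
  also have "\<dots> \<ge> 0" using p w by simp
  finally show ?thesis by simp
qed

lemma quadG_nonneg: assumes x: "x \<in> pos_over I" shows "0 \<le> quadG x v"
proof -
  define s t fr w where "s = x $ 1" "t = x $ 2" "fr = f (rad x)" "w = 1 - (s + t) * fr"
  note d = this
  have p: "0 < s" "0 < t" "rad x \<in> I" using x by (auto simp: pos_over_def d)
  have w: "w > 0" using w_pos[OF p(3)] by (simp add: rad_def d)
  have nz: "s \<noteq> 0" "t \<noteq> 0" "w \<noteq> 0" "s + t \<noteq> 0" using p w by auto
  have F: "F (rad x) = fr / w" using F_f[OF p(3)] by (simp add: rad_def d)
  have "quadG x v = ((v $ 1 * t - v $ 2 * s)\<^sup>2 / (s * t) + (v $ 1 + v $ 2)\<^sup>2 / w) / (2 * (s + t))"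
    unfolding quadG_def F d(1-3)[symmetric] by (rule quadG_identity[OF d(4) nz])
  also have "\<dots> \<ge> 0" using p w by simp
  finally show ?thesis .
qed

lemma quadH_nonneg: assumes x: "x \<in> pos_over I" shows "0 \<le> quadH x k"
proof -
  define s t fr w where "s = x $ 1" "t = x $ 2" "fr = f (rad x)" "w = 1 - (s + t) * fr"
  note d = this
  have p: "0 < s" "0 < t" "rad x \<in> I" using x by (auto simp: pos_over_def d)
  have w: "w > 0" using w_pos[OF p(3)] by (simp add: rad_def d)
  have nz: "s \<noteq> 0" "t \<noteq> 0" "w \<noteq> 0" "s + t \<noteq> 0" using p w by auto
  have "quadH x k = 2 * (s * t * (k $ 1 - k $ 2)\<^sup>2 + w * (s * k $ 1 + t * k $ 2)\<^sup>2) / (s + t)"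
    unfolding quadH_def d(1-3)[symmetric] by (rule quadH_identity[OF d(4) nz(4)])
  also have "\<dots> \<ge> 0" using p w by simp
  finally show ?thesis .
qed

text \<open>Definiteness is read off from \<open>pairing_le\<close> with unit covectors: a vector of
  zero length would have vanishing components.\<close>

lemma quadG_pos: assumes x: "x \<in> pos_over I" and v: "v \<noteq> 0" shows "0 < quadG x v"
proof (rule ccontr)
  assume "\<not> 0 < quadG x v"
  then have z: "quadG x v = 0" using quadG_nonneg[OF x, of v] by simp
  have "(v $ 1)\<^sup>2 \<le> 0" using pairing_le[OF x, of "axis 1 1" v] z by (simp add: axis_def)
  moreover have "(v $ 2)\<^sup>2 \<le> 0" using pairing_le[OF x, of "axis 2 1" v] z by (simp add: axis_def)
  ultimately show False using v by (simp add: vec_eq_iff forall_2)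
qed

lemma pos_def_hess: assumes x: "x \<in> pos_over I" shows "pos_def (hess (upot h) x)"
proof -
  have "v \<bullet> (hess (upot h) x *v v) = quadG x v" for v
    by (simp add: inner_vec_def matrix_vector_mult_def sum_2 hess_nth[OF x] quadG_def field_simps power2_eq_square)
  then show ?thesis unfolding pos_def_def using quadG_pos[OF x]
    by (auto simp: vec_eq_iff transpose_def hess_nth[OF x])
qed

end

section \<open>Curvature\<close>

lemma mom_add_axis_Inl: "mom (p + t *\<^sub>R axis (Inl l) 1) = mom p + t *\<^sub>R axis l 1"
  by (simp add: mom_def vec_eq_iff axis_def)

lemma mom_add_axis_Inr: "mom (p + t *\<^sub>R axis (Inr l) 1) = mom p"
  by (simp add: mom_def vec_eq_iff axis_def)

lemma open_mom_vimage: "open X \<Longrightarrow> open {p. mom p \<in> X}"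
  using open_vimage[of X mom] continuous_on_mom[OF continuous_on_id] by (simp add: vimage_def)

lemma partial_deriv_Inl:
  assumes X: "open X" "mom p \<in> X" and eq: "\<And>q. mom q \<in> X \<Longrightarrow> \<phi> q = G (mom q)"
    and der: "((\<lambda>t. G (mom p + t *\<^sub>R axis l 1)) has_real_derivative d) (at 0)"
  shows "partial_deriv (Inl l) \<phi> p = d"
  by (rule partial_deriv_eqI[OF open_mom_vimage[OF X(1)], where g = "\<lambda>q. G (mom q)"])
     (use X(2) eq der in \<open>auto simp: mom_add_axis_Inl\<close>)

lemma partial_deriv_Inr:
  assumes X: "open X" "mom p \<in> X" and eq: "\<And>q. mom q \<in> X \<Longrightarrow> \<phi> q = G (mom q)"
  shows "partial_deriv (Inr l) \<phi> p = 0"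
  by (rule partial_deriv_eqI[OF open_mom_vimage[OF X(1)], where g = "\<lambda>q. G (mom q)"])
     (use X(2) eq in \<open>auto simp: mom_add_axis_Inr\<close>)

lemma partial_deriv_zero:
  assumes X: "open X" "mom p \<in> X" and eq: "\<And>q. mom q \<in> X \<Longrightarrow> \<phi> q = 0"
  shows "partial_deriv l \<phi> p = 0"
  by (rule partial_deriv_eqI[OF open_mom_vimage[OF X(1)], where g = "\<lambda>q. 0"])
     (use X(2) eq in auto)

locale curvature_profile = momentum_profile +
  fixes f1 f2 :: "real \<Rightarrow> real"
  assumes f_deriv: "\<And>r. r \<in> I \<Longrightarrow> (f has_real_derivative f1 r) (at r)"
    and f1_deriv: "\<And>r. r \<in> I \<Longrightarrow> (f1 has_real_derivative f2 r) (at r)"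
begin

definition wfun :: "real \<Rightarrow> real" where "wfun r = 1 - r * f r"
text \<open>\<open>efun\<close> and \<open>nfun\<close> are the radial coefficients of those terms
  of \<open>chrX\<close> and \<open>chrT\<close> that are pure products of momenta. Moreover
  \<open>F' = efun / wfun\<close>. A final 1 in a name marks the derivative.\<close>

definition efun :: "real \<Rightarrow> real" where "efun r = (f1 r + (f r)\<^sup>2) / wfun r"
definition efun1 :: "real \<Rightarrow> real" where "efun1 r = (f2 r + 2 * f r * f1 r + efun r * (f r + r * f1 r)) / wfun r"
definition nfun :: "real \<Rightarrow> real" where "nfun r = 2 * (f r)\<^sup>2 - f1 r * wfun r"
definition nfun1 :: "real \<Rightarrow> real" where
  "nfun1 r = 4 * f r * f1 r - f2 r * wfun r + f1 r * (f r + r * f1 r)"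

lemma wfun_pos: "r \<in> I \<Longrightarrow> 0 < wfun r"
  using w_pos by (simp add: wfun_def)

lemma wfun_deriv: "r \<in> I \<Longrightarrow> (wfun has_real_derivative - (f r + r * f1 r)) (at r)"
  unfolding wfun_def[abs_def] by (auto intro!: derivative_eq_intros f_deriv)

lemma efun_deriv: assumes "r \<in> I" shows "(efun has_real_derivative efun1 r) (at r)"
  unfolding efun_def[abs_def] efun1_def using wfun_pos[OF assms]
  by (auto intro!: derivative_eq_intros f_deriv f1_deriv wfun_deriv assms) (simp add: field_simps power2_eq_square)

lemma nfun_deriv: assumes "r \<in> I" shows "(nfun has_real_derivative nfun1 r) (at r)"
  unfolding nfun_def[abs_def] nfun1_def
  by (auto intro!: derivative_eq_intros f_deriv f1_deriv wfun_deriv assms simp: algebra_simps)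

lemma F_deriv_efun: assumes "r \<in> I" shows "(F has_real_derivative efun r / wfun r) (at r)"
proof -
  have "((\<lambda>r. f r / wfun r) has_real_derivative efun r / wfun r) (at r)"
    using wfun_pos[OF assms] f_deriv[OF assms] wfun_deriv[OF assms]
    by (auto intro!: derivative_eq_intros simp: efun_def) (simp add: field_simps wfun_def power2_eq_square)
  then show ?thesis
    by (rule has_field_derivative_transform_within_open[OF _ open_I assms]) (simp add: F_f wfun_def)
qed

lemma deriv_along_rad:
  assumes "(\<phi> has_real_derivative d) (at (rad z))"
  shows "((\<lambda>t. \<phi> (rad (z + t *\<^sub>R axis l 1))) has_real_derivative d) (at 0)"
proof -
  have "(\<phi> has_real_derivative d) (at (0 + rad z))" using assms by simp
  then show ?thesis unfolding rad_add_axis by (subst (asm) DERIV_shift) (simp add: add.commute)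
qed

text \<open>The Christoffel symbols with indices \<open>(x\<^sub>k; x\<^sub>i, x\<^sub>j)\<close> and \<open>(x\<^sub>k; \<theta>\<^sub>a, \<theta>\<^sub>b)\<close>. The one other type, \<open>(\<theta>\<^sub>c; x\<^sub>i, \<theta>\<^sub>b)\<close>, is
  \<open>- chrX z b i c\<close>.\<close>

definition chrX :: "real^2 \<Rightarrow> 2 \<Rightarrow> 2 \<Rightarrow> 2 \<Rightarrow> real" where
  "chrX z k i j = ((if i = j then z $ k * f (rad z) / z $ i - (if k = i then 1 / z $ k else 0) else 0)
     + z $ k * efun (rad z)) / 2"

definition chrT :: "real^2 \<Rightarrow> 2 \<Rightarrow> 2 \<Rightarrow> 2 \<Rightarrow> real" where
  "chrT z k a b = - 2 * ((if k = a \<and> a = b then z $ k else 0)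
     - f (rad z) * z $ k * ((if k = a then z $ b else 0) + (if k = b then z $ a else 0) + (if a = b then z $ a else 0))
     + z $ k * z $ a * z $ b * nfun (rad z))"

definition dchrX :: "real^2 \<Rightarrow> 2 \<Rightarrow> 2 \<Rightarrow> 2 \<Rightarrow> 2 \<Rightarrow> real" where
  "dchrX z l k i j = ((if i = j then
      ((if l = k then f (rad z) else 0) + z $ k * f1 (rad z)) / z $ i
      - (if l = i then z $ k * f (rad z) / (z $ i)\<^sup>2 else 0)
      + (if k = i \<and> l = k then 1 / (z $ k)\<^sup>2 else 0) else 0)
     + (if l = k then efun (rad z) else 0) + z $ k * efun1 (rad z)) / 2"

definition dchrT :: "real^2 \<Rightarrow> 2 \<Rightarrow> 2 \<Rightarrow> 2 \<Rightarrow> real" where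
  "dchrT z k a b = - 2 * ((if k = a \<and> a = b then 1 else 0)
     - (f1 (rad z) * z $ k + f (rad z)) * ((if k = a then z $ b else 0) + (if k = b then z $ a else 0) + (if a = b then z $ a else 0))
     - (if k = a \<and> a = b then 3 * f (rad z) * z $ k else 0)
     + (z $ a * z $ b + (if k = a then z $ k * z $ b else 0) + (if k = b then z $ k * z $ a else 0)) * nfun (rad z)
     + z $ k * z $ a * z $ b * nfun1 (rad z))"

context
  fixes z :: "real^2"
  assumes z: "z \<in> pos_over I"
begin

lemma rad_in_I: "rad z \<in> I" and nth_pos: "0 < z $ i"
  using z pos_over_nth[OF z] by (auto simp: pos_over_def)

lemma deriv_along_nth: "((\<lambda>t. (z + t *\<^sub>R axis l 1) $ i) has_real_derivative (if l = i then 1 else 0)) (at 0)"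
  by (rule has_real_derivative_axis_nth)

lemmas deriv_along = deriv_along_nth deriv_along_rad[OF f_deriv[OF rad_in_I]] deriv_along_rad[OF f1_deriv[OF rad_in_I]] deriv_along_rad[OF efun_deriv[OF rad_in_I]] deriv_along_rad[OF nfun_deriv[OF rad_in_I]] deriv_along_rad[OF F_deriv_efun[OF rad_in_I]]

lemma deriv_along_inverse: "((\<lambda>t. inverse ((z + t *\<^sub>R axis l 1) $ i)) has_real_derivative
    - (if l = i then inverse (z $ i) * inverse (z $ i) else 0)) (at 0)"
  by (rule DERIV_cong[OF DERIV_inverse'[OF deriv_along_nth]]) (use nth_pos[of i] in auto)

lemma chrX_deriv:
  "((\<lambda>t. chrX (z + t *\<^sub>R axis l 1) k i j) has_real_derivative dchrX z l k i j) (at 0)"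
proof -
  \<comment> \<open>Kronecker deltas become constant real factors, so the product rule applies
    before any case distinction on indices.\<close>
  define ij ijk :: real where "ij = (if i = j then 1 else 0)" "ijk = (if i = j \<and> k = i then 1 else 0)"
  note d = this
  have *: "chrX y k i j = (1/2) * (ij * (y $ k * f (rad y) * inverse (y $ i)) - ijk * inverse (y $ k) + y $ k * efun (rad y))" for y
    by (auto simp: chrX_def d inverse_eq_divide)
  show ?thesis unfolding *
    by (rule DERIV_cong, (rule deriv_along_inverse deriv_along DERIV_const DERIV_add DERIV_diff DERIV_mult)+)
       (cases "i = j"; cases "k = i"; cases "l = k"; simp add: dchrX_def d inverse_eq_divide add_divide_distrib diff_divide_distrib power2_eq_square algebra_simps)
qed

lemma chrT_deriv:
  "((\<lambda>t. chrT (z + t *\<^sub>R axis k 1) k a b) has_real_derivative dchrT z k a b) (at 0)"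
proof -
  define ka kb ab :: real where "ka = (if k = a then 1 else 0)" "kb = (if k = b then 1 else 0)" "ab = (if a = b then 1 else 0)"
  note d = this
  have *: "chrT y k a b = - 2 * (ka * ab * y $ k - f (rad y) * y $ k * (ka * y $ b + kb * y $ a + ab * y $ a)
     + y $ k * y $ a * y $ b * nfun (rad y))" for y
    by (auto simp: chrT_def d)
  show ?thesis unfolding *
    by (rule DERIV_cong, (rule deriv_along_nth[where l=k] deriv_along_rad[OF f_deriv[OF rad_in_I]] deriv_along_rad[OF nfun_deriv[OF rad_in_I]] DERIV_const DERIV_add DERIV_diff DERIV_mult)+)
       (cases "k = a"; cases "k = b"; cases "a = b"; simp add: dchrT_def d algebra_simps)
qed

end

abbreviation "g \<equiv> U2_metric h"

context
  fixes p :: coords and z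
  assumes p: "mom p \<in> pos_over I"
  defines "z \<equiv> mom p"
begin

lemma z_in: "z \<in> pos_over I" using p by (simp add: z_def)

lemma pd_metric_xx:
  "partial_deriv (Inl l) (\<lambda>q. g q $ Inl i $ Inl j) p
    = ((if i = j \<and> l = i then - 1 / (z $ i)\<^sup>2 else 0) + efun (rad z) / wfun (rad z)) / 2"
proof (rule partial_deriv_Inl[OF open_pos_over[OF open_I] p,
      where G = "\<lambda>z. ((if i = j then inverse (z $ i) else 0) + F (rad z)) * (1/2)"])
  show "g q $ Inl i $ Inl j = ((if i = j then inverse (mom q $ i) else 0) + F (rad (mom q))) * (1/2)"
    if "mom q \<in> pos_over I" for q
    using metric_nth(1)[OF that] by (simp add: mom_nth inverse_eq_divide)
  define ij :: real where "ij = (if i = j then 1 else 0)"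
  have *: "(if i = j then inverse (y $ i) else 0) = ij * inverse (y $ i)" for y :: "real^2"
    by (simp add: ij_def)
  show "((\<lambda>t. ((if i = j then inverse ((mom p + t *\<^sub>R axis l 1) $ i) else 0) + F (rad (mom p + t *\<^sub>R axis l 1))) * (1/2))
    has_real_derivative ((if i = j \<and> l = i then - 1 / (z $ i)\<^sup>2 else 0) + efun (rad z) / wfun (rad z)) / 2) (at 0)"
    unfolding * z_def
    by (rule DERIV_cong, (rule deriv_along_inverse[OF p] deriv_along[OF p] DERIV_const DERIV_add DERIV_mult)+)
       (cases "i = j"; cases "l = i"; simp add: ij_def inverse_eq_divide power2_eq_square)
qed

lemma pd_metric_tt:
  "partial_deriv (Inl l) (\<lambda>q. g q $ Inr i $ Inr j) p
    = 2 * ((if i = j \<and> l = i then 1 else 0)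
       - ((if l = i then z $ j else 0) + (if l = j then z $ i else 0)) * f (rad z) - z $ i * z $ j * f1 (rad z))"
proof (rule partial_deriv_Inl[OF open_pos_over[OF open_I] p,
      where G = "\<lambda>z. 2 * ((if i = j then z $ i else 0) - z $ i * z $ j * f (rad z))"])
  show "g q $ Inr i $ Inr j = 2 * ((if i = j then mom q $ i else 0) - mom q $ i * mom q $ j * f (rad (mom q)))"
    if "mom q \<in> pos_over I" for q
    using metric_nth(2)[OF that] by (simp add: mom_nth)
  define ij :: real where "ij = (if i = j then 1 else 0)"
  have *: "(if i = j then y $ i else 0) = ij * y $ i" for y :: "real^2"
    by (simp add: ij_def)
  show "((\<lambda>t. 2 * ((if i = j then (mom p + t *\<^sub>R axis l 1) $ i else 0)
      - (mom p + t *\<^sub>R axis l 1) $ i * (mom p + t *\<^sub>R axis l 1) $ j * f (rad (mom p + t *\<^sub>R axis l 1))))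
    has_real_derivative 2 * ((if i = j \<and> l = i then 1 else 0)
       - ((if l = i then z $ j else 0) + (if l = j then z $ i else 0)) * f (rad z) - z $ i * z $ j * f1 (rad z))) (at 0)"
    unfolding * z_def
    by (rule DERIV_cong, (rule deriv_along[OF p] DERIV_const DERIV_diff DERIV_mult)+)
       (cases "i = j"; cases "l = i"; cases "l = j"; simp add: ij_def algebra_simps)
qed

lemma pd_metric_zero:
  "partial_deriv l (\<lambda>q. g q $ Inl i $ Inr j) p = 0"
  "partial_deriv l (\<lambda>q. g q $ Inr i $ Inl j) p = 0"
  by (rule partial_deriv_zero[OF open_pos_over[OF open_I] p], rule metric_nth, assumption)+

lemma pd_metric_Inr: "partial_deriv (Inr l) (\<lambda>q. g q $ a $ b) p = 0"
proof (cases a; cases b)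
  fix i j assume ab: "a = Inl i" "b = Inl j"
  show ?thesis unfolding ab
    by (rule partial_deriv_Inr[OF open_pos_over[OF open_I] p,
      where G = "\<lambda>z. ((if i = j then 1 / z $ i else 0) + F (rad z)) / 2"])
      (use metric_nth(1) in \<open>simp add: mom_nth\<close>)
next
  fix i j assume ab: "a = Inr i" "b = Inr j"
  show ?thesis unfolding ab
    by (rule partial_deriv_Inr[OF open_pos_over[OF open_I] p,
      where G = "\<lambda>z. 2 * ((if i = j then z $ i else 0) - z $ i * z $ j * f (rad z))"])
      (use metric_nth(2) in \<open>simp add: mom_nth\<close>)
qed (simp_all add: pd_metric_zero)

lemma christoffel_zero:
  "christoffel g (Inl k) (Inl i) (Inr j) p = 0" "christoffel g (Inl k) (Inr i) (Inl j) p = 0"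
  "christoffel g (Inr k) (Inl i) (Inl j) p = 0" "christoffel g (Inr k) (Inr i) (Inr j) p = 0"
  unfolding christoffel_def sum_UNIV_Plus
  by (simp_all add: pd_metric_zero pd_metric_Inr matrix_inv_metric_nth[OF p])

lemma ginv_nth:
  "matrix_inv (g p) $ Inl i $ Inl j = 2 * ((if i = j then z $ i else 0) - z $ i * z $ j * f (rad z))"
  "matrix_inv (g p) $ Inr i $ Inr j = ((if i = j then 1 / z $ i else 0) + F (rad z)) / 2"
  "matrix_inv (g p) $ Inl i $ Inr j = 0" "matrix_inv (g p) $ Inr i $ Inl j = 0"
  using matrix_inv_metric_nth[OF p] by (simp_all add: z_def mom_nth)

lemma sum_ginv_xx:
  "(\<Sum>l\<in>UNIV. 2 * ((if k = l then z $ k else 0) - z $ k * z $ l * c) * T l) =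
    2 * z $ k * (T k - c * (\<Sum>l\<in>UNIV. z $ l * T l))"
  using exhaust_2[of k] by (auto simp: sum_2 algebra_simps)

lemma sum_ginv_tt:
  "(\<Sum>l\<in>UNIV. ((if k = l then 1 / z $ k else 0) + c) / 2 * T l) = (T k / z $ k + c * (\<Sum>l\<in>UNIV. T l)) / 2"
  using exhaust_2[of k] by (auto simp: sum_2 algebra_simps add_divide_distrib)

lemma nth_nonzero: "z $ i \<noteq> 0" and wfun_nonzero: "wfun (rad z) \<noteq> 0" and rad_f_eq: "rad z * f (rad z) = 1 - wfun (rad z)"
  using nth_pos[OF z_in, of i] wfun_pos[OF rad_in_I[OF z_in]] by (auto simp: wfun_def)

lemma christoffel_xxx: "christoffel g (Inl k) (Inl i) (Inl j) p = chrX z k i j"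
proof -
  define ew where "ew = efun (rad z) / wfun (rad z)"
  define T where "T = (\<lambda>l. ((if i = j \<and> l = i then - 1 / (z $ i)\<^sup>2 else 0) + ew) / 2)"
  \<comment> \<open>For a Hessian metric the three terms are one and the same third derivative of
    the potential, so their signed sum is a single copy of it.\<close>
  have T: "partial_deriv (Inl i) (\<lambda>q. g q $ Inl j $ Inl l) p + partial_deriv (Inl j) (\<lambda>q. g q $ Inl i $ Inl l) p
      - partial_deriv (Inl l) (\<lambda>q. g q $ Inl i $ Inl j) p = T l" for l
  proof -
    have "partial_deriv (Inl i) (\<lambda>q. g q $ Inl j $ Inl l) p = T l"
      "partial_deriv (Inl j) (\<lambda>q. g q $ Inl i $ Inl l) p = T l"
      "partial_deriv (Inl l) (\<lambda>q. g q $ Inl i $ Inl j) p = T l"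
      unfolding pd_metric_xx T_def ew_def by auto
    then show ?thesis by simp
  qed
  have S: "(\<Sum>l\<in>UNIV. z $ l * T l) = ((if i = j then - 1 / z $ i else 0) + rad z * ew) / 2"
    using exhaust_2[of i] nth_nonzero[of i]
    by (auto simp: sum_2 T_def rad_def power2_eq_square algebra_simps add_divide_distrib)
  have "christoffel g (Inl k) (Inl i) (Inl j) p = z $ k * (T k - f (rad z) * (\<Sum>l\<in>UNIV. z $ l * T l))"
    unfolding christoffel_def sum_UNIV_Plus T ginv_nth sum_ginv_xx by simp
  also have "\<dots> = ((if i = j then z $ k * f (rad z) / z $ i - (if k = i then 1 / z $ k else 0) else 0)
      + z $ k * (ew * (1 - rad z * f (rad z)))) / 2"
    unfolding S using nth_nonzero[of k] nth_nonzero[of i] unfolding T_def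
    by (cases "i = j"; cases "k = i"; simp add: power2_eq_square field_simps)
  finally show ?thesis unfolding rad_f_eq using wfun_nonzero by (simp add: chrX_def ew_def)
qed

lemma christoffel_xtt: "christoffel g (Inl k) (Inr a) (Inr b) p = chrT z k a b"
proof -
  define T where "T = (\<lambda>l. - 2 * ((if a = b \<and> l = a then 1 else 0)
       - ((if l = a then z $ b else 0) + (if l = b then z $ a else 0)) * f (rad z) - z $ a * z $ b * f1 (rad z)))"
  have T: "partial_deriv (Inr a) (\<lambda>q. g q $ Inr b $ Inl l) p + partial_deriv (Inr b) (\<lambda>q. g q $ Inr a $ Inl l) p
      - partial_deriv (Inl l) (\<lambda>q. g q $ Inr a $ Inr b) p = T l" for l
    unfolding pd_metric_tt pd_metric_zero pd_metric_Inr T_def by simp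
  have S: "(\<Sum>l\<in>UNIV. z $ l * T l) = - 2 * ((if a = b then z $ a else 0)
       - 2 * z $ a * z $ b * f (rad z) - rad z * z $ a * z $ b * f1 (rad z))"
    using exhaust_2[of a] exhaust_2[of b]
    by (auto simp: sum_2 T_def rad_def algebra_simps)
  have "christoffel g (Inl k) (Inr a) (Inr b) p = z $ k * (T k - f (rad z) * (\<Sum>l\<in>UNIV. z $ l * T l))"
    unfolding christoffel_def sum_UNIV_Plus T ginv_nth sum_ginv_xx by simp
  also have "\<dots> = chrT z k a b"
    unfolding S unfolding T_def chrT_def nfun_def wfun_def
    by (cases "k = a"; cases "k = b"; cases "a = b"; simp add: power2_eq_square algebra_simps)
  finally show ?thesis .
qed

text \<open>The torus block \<open>H\<close> is the inverse of the momentum block \<open>G\<close>,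
  so \<open>G dH = - dG H\<close>: up to sign and order of indices the mixed symbols are those of
  \<open>christoffel_xxx\<close>.\<close>

lemma christoffel_txt:
  "christoffel g (Inr c) (Inl i) (Inr b) p = - chrX z b i c"
  "christoffel g (Inr c) (Inr b) (Inl i) p = - chrX z b i c"
proof -
  define T where "T = (\<lambda>l. 2 * ((if b = l \<and> i = b then 1 else 0)
       - ((if i = b then z $ l else 0) + (if i = l then z $ b else 0)) * f (rad z) - z $ b * z $ l * f1 (rad z)))"
  have T: "partial_deriv (Inl i) (\<lambda>q. g q $ Inr b $ Inr l) p + partial_deriv (Inr b) (\<lambda>q. g q $ Inl i $ Inr l) p
      - partial_deriv (Inr l) (\<lambda>q. g q $ Inl i $ Inr b) p = T l"
     "partial_deriv (Inr b) (\<lambda>q. g q $ Inl i $ Inr l) p + partial_deriv (Inl i) (\<lambda>q. g q $ Inr b $ Inr l) p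
      - partial_deriv (Inr l) (\<lambda>q. g q $ Inr b $ Inl i) p = T l" for l
    unfolding pd_metric_tt pd_metric_zero pd_metric_Inr T_def by simp_all
  have S: "(\<Sum>l\<in>UNIV. T l) = 2 * ((if i = b then wfun (rad z) else 0) - z $ b * (f (rad z) + rad z * f1 (rad z)))"
    using exhaust_2[of i] exhaust_2[of b]
    by (auto simp: sum_2 T_def rad_def wfun_def algebra_simps)
  have 1: "christoffel g (Inr c) (Inl i) (Inr b) p = (T c / z $ c + F (rad z) * (\<Sum>l\<in>UNIV. T l)) / 4"
    unfolding christoffel_def sum_UNIV_Plus T ginv_nth sum_ginv_tt by simp
  have 2: "christoffel g (Inr c) (Inr b) (Inl i) p = (T c / z $ c + F (rad z) * (\<Sum>l\<in>UNIV. T l)) / 4"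
    unfolding christoffel_def sum_UNIV_Plus T ginv_nth sum_ginv_tt by simp
  have F: "F (rad z) = f (rad z) / wfun (rad z)" using F_f[OF rad_in_I[OF z_in]] by (simp add: wfun_def)
  \<comment> \<open>This form of \<open>efun\<close> is what the contraction with the angle block of
    the inverse metric, whose rank-one part is \<open>F\<close>, produces.\<close>
  have E: "efun (rad z) = f1 (rad z) + f (rad z) / wfun (rad z) * (f (rad z) + rad z * f1 (rad z))"
  proof -
    have "f1 (rad z) = f1 (rad z) * wfun (rad z) + (rad z * f (rad z)) * f1 (rad z)"
      unfolding rad_f_eq by algebra
    then show ?thesis using wfun_nonzero unfolding efun_def by (simp add: field_simps power2_eq_square)
  qed
  have 3: "(T c / z $ c + F (rad z) * (\<Sum>l\<in>UNIV. T l)) / 4 = - chrX z b i c"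
    unfolding S unfolding T_def chrX_def F E using nth_nonzero[of c] nth_nonzero[of i] nth_nonzero[of b] wfun_nonzero
    by (cases "i = c"; cases "i = b"; cases "b = c"; simp add: power2_eq_square field_simps)
  show "christoffel g (Inr c) (Inl i) (Inr b) p = - chrX z b i c"
     "christoffel g (Inr c) (Inr b) (Inl i) p = - chrX z b i c"
    unfolding 1 2 3 by simp_all
qed

end

end

section \<open>Ricci tensor and scalar curvature\<close>

context curvature_profile
begin

lemma chrX_sym: "chrX z k i j = chrX z k j i"
  by (auto simp: chrX_def)

context
  fixes p :: coords and z
  assumes p: "mom p \<in> pos_over I"
  defines "z \<equiv> mom p"
begin

lemma pd_christoffel:
  "partial_deriv (Inl l) (christoffel g (Inl k) (Inl i) (Inl j)) p = dchrX z l k i j"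
  "partial_deriv (Inl k) (christoffel g (Inl k) (Inr a) (Inr b)) p = dchrT z k a b"
  "partial_deriv (Inl l) (christoffel g (Inr c) (Inl i) (Inr b)) p = - dchrX z l b i c"
proof -
  show "partial_deriv (Inl l) (christoffel g (Inl k) (Inl i) (Inl j)) p = dchrX z l k i j"
    by (rule partial_deriv_Inl[OF open_pos_over[OF open_I] p, where G = "\<lambda>z. chrX z k i j"])
       (simp_all add: christoffel_xxx chrX_deriv[OF p] z_def)
  show "partial_deriv (Inl k) (christoffel g (Inl k) (Inr a) (Inr b)) p = dchrT z k a b"
    by (rule partial_deriv_Inl[OF open_pos_over[OF open_I] p, where G = "\<lambda>z. chrT z k a b"])
       (simp_all add: christoffel_xtt chrT_deriv[OF p] z_def)
  show "partial_deriv (Inl l) (christoffel g (Inr c) (Inl i) (Inr b)) p = - dchrX z l b i c"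
    by (rule partial_deriv_Inl[OF open_pos_over[OF open_I] p, where G = "\<lambda>z. - chrX z b i c"])
       (simp_all add: christoffel_txt DERIV_minus chrX_deriv[OF p] z_def)
qed

lemma pd_christoffel_zero:
  "partial_deriv l (christoffel g (Inl k) (Inr i) (Inl j)) p = 0"
  "partial_deriv l (christoffel g (Inr k) (Inl i) (Inl j)) p = 0"
  "partial_deriv l (christoffel g (Inr k) (Inr i) (Inr j)) p = 0"
  by (rule partial_deriv_zero[OF open_pos_over[OF open_I] p], rule christoffel_zero, assumption)+

lemmas christoffels = christoffel_zero[OF p] christoffel_xxx[OF p] christoffel_xtt[OF p] christoffel_txt[OF p]

text \<open>As \<open>det g = 1\<close>, the traces of the Christoffel symbols vanish and only two of the four terms of the Ricci tensor remain.\<close>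

lemma ricci_xx_sum:
  "ricci g (Inl i) (Inl j) p =
    (\<Sum>k\<in>UNIV. dchrX z k k i j) - 2 * (\<Sum>k\<in>UNIV. \<Sum>l\<in>UNIV. chrX z k j l * chrX z l i k)"
proof -
  have "chrX z k l m = chrX z k m l" for k l m by (rule chrX_sym)
  then show ?thesis
    unfolding ricci_def sum_UNIV_Plus christoffels pd_christoffel pd_christoffel_zero z_def[symmetric]
    by (simp add: sum_2)
qed

lemma ricci_tt_sum:
  "ricci g (Inr a) (Inr b) p =
    (\<Sum>k\<in>UNIV. dchrT z k a b)
    + (\<Sum>k\<in>UNIV. \<Sum>c\<in>UNIV. chrT z k b c * chrX z a k c + chrX z b k c * chrT z k a c)"
proof -
  have "chrX z c l c = chrX z c c l" for l c by (rule chrX_sym)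
  then show ?thesis
    unfolding ricci_def sum_UNIV_Plus christoffels pd_christoffel pd_christoffel_zero z_def[symmetric]
    by (simp add: sum_2)
qed

text \<open>The Ricci tensor has the shape of the metric, a diagonal plus a rank-one part; these are
  the two radial coefficients. With \<open>q = r^3 f\<close> one has
  \<open>ricA = q' / r^2\<close>.\<close>

definition "ricA = 3 * f (rad z) + rad z * f1 (rad z)"
definition "ricB = 4 * efun (rad z) + rad z * efun1 (rad z) - (f (rad z) + rad z * efun (rad z))\<^sup>2"

lemmas coord_nonzero = nth_nonzero[OF p, folded z_def]

lemma sum_dchrX: "(\<Sum>k\<in>UNIV. dchrX z k k i j) =
    ((if i = j then 1 / (z $ i)\<^sup>2 + (f (rad z) + rad z * f1 (rad z)) / z $ i else 0)
     + 2 * efun (rad z) + rad z * efun1 (rad z)) / 2"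
  unfolding dchrX_def using exhaust_2[of i] coord_nonzero[of i]
  by (cases "i = j") (auto simp: sum_2 power2_eq_square rad_def field_simps)

lemma sum_chrX_chrX: "(\<Sum>k\<in>UNIV. \<Sum>l\<in>UNIV. chrX z k j l * chrX z l i k) =
    ((if i = j then 1 / (z $ i)\<^sup>2 - 2 * f (rad z) / z $ i else 0)
     - 2 * efun (rad z) + (f (rad z) + rad z * efun (rad z))\<^sup>2) / 4"
proof -
  have r: "rad z = z $ 1 + z $ 2" by (simp add: rad_def)
  define s t fr er where "s = z $ 1" "t = z $ 2" "fr = f (rad z)" "er = efun (rad z)"
  note d = this
  have "s \<noteq> 0" "t \<noteq> 0" using coord_nonzero by (simp_all add: d)
  then show ?thesis
    unfolding chrX_def sum_2 d(3,4)[symmetric] unfolding r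
    using exhaust_2[of i] exhaust_2[of j]
    by (auto simp: field_simps power2_eq_square simp flip: d(1,2))
qed

lemma ricci_xx:
  "ricci g (Inl i) (Inl j) p = ((if i = j then ricA / z $ i else 0) + ricB) / 2"
  unfolding ricci_xx_sum sum_dchrX sum_chrX_chrX ricA_def ricB_def
  by (cases "i = j") (auto simp: add_divide_distrib diff_divide_distrib algebra_simps)

text \<open>The right side is the momentum block of the Ricci tensor multiplied on both sides by the
  inverse Hessian, as invariance under the complex structure requires; it is verified by direct
  computation.\<close>

lemma ricci_tt:
  "ricci g (Inr a) (Inr b) p = 2 * ((if a = b then z $ a * ricA else 0)
     + z $ a * z $ b * (ricA * f (rad z) * (rad z * f (rad z) - 2) + ricB * (wfun (rad z))\<^sup>2))"
proof -
  define s t where "s = z $ 1" "t = z $ 2"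
  note d = this
  define r fr er er1 where "r = rad z" "fr = f r" "er = efun r" "er1 = efun1 r"
  note d2 = this
  \<comment> \<open>\<open>efun\<close> and \<open>efun1\<close> are the free quantities, and the
    derivatives of \<open>f\<close> are expressed through them without division. Only
    \<open>s\<close> and \<open>t\<close> remain in denominators, and the claim becomes a polynomial
    identity.\<close>
  define wr fr1 fr2 where "wr = 1 - r * fr" "fr1 = er * wr - fr\<^sup>2"
    "fr2 = er1 * wr - 2 * fr * fr1 - er * (fr + r * fr1)"
  note d3 = this
  have r: "r = s + t" by (simp add: rad_def d d2)
  have wr: "wfun (rad z) = wr" by (simp add: wfun_def d2 d3)
  have "wfun (rad z) \<noteq> 0" using wfun_pos[of "rad z"] p by (simp add: pos_over_def z_def)
  then have wfun_nonzero: "wr \<noteq> 0" by (simp add: wr)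
  have "efun (rad z) * wfun (rad z) = f1 (rad z) + (f (rad z))\<^sup>2"
    using \<open>wfun (rad z) \<noteq> 0\<close> by (simp add: efun_def)
  then have f1: "f1 (rad z) = fr1" by (simp add: wr d3(2) d2)
  have "efun1 (rad z) * wfun (rad z) = f2 (rad z) + 2 * f (rad z) * f1 (rad z) + efun (rad z) * (f (rad z) + rad z * f1 (rad z))"
    using \<open>wfun (rad z) \<noteq> 0\<close> by (simp add: efun1_def)
  then have f2: "f2 (rad z) = fr2" by (simp add: wr f1 d3(3) d2)
  have nz: "s \<noteq> 0" "t \<noteq> 0" using coord_nonzero by (simp_all add: d)
  show ?thesis
    unfolding ricci_tt_sum chrX_def chrT_def dchrT_def nfun_def nfun1_def ricA_def ricB_def sum_2
    unfolding f1 f2 wr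
    unfolding d2(1)[symmetric]
    unfolding d2(2-)[symmetric]
    using exhaust_2[of a] exhaust_2[of b]
    apply (elim disjE)
    apply (simp_all flip: d)
    apply (insert nz)
    apply (simp_all add: divide_simps)
    unfolding d3 r
    apply (simp_all add: algebra_simps power2_eq_square)
    done
qed

text \<open>Multiplication by \<open>wfun\<close> removes the quotients inside \<open>efun\<close>
  and \<open>efun1\<close>; the scalar curvature contains \<open>ricB\<close> only in this
  product.\<close>

lemma ricB_w:
  "ricB * wfun (rad z) = 4 * f1 (rad z) + 3 * (f (rad z))\<^sup>2 + rad z * f2 (rad z) + rad z * f (rad z) * f1 (rad z)"
proof -
  define r fr er er1 fr1 fr2 where "r = rad z" "fr = f (rad z)" "er = efun (rad z)" "er1 = efun1 (rad z)"
    "fr1 = f1 (rad z)" "fr2 = f2 (rad z)"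
  note d = this
  define wr where "wr = wfun (rad z)"
  have wfun: "wr = 1 - r * fr" by (simp add: wfun_def wr_def d)
  have nz: "wr \<noteq> 0" using wfun_pos[of "rad z"] p by (simp add: pos_over_def z_def wr_def)
  have 1: "er * wr = fr1 + fr\<^sup>2" using nz by (simp add: d wr_def efun_def)
  have 2: "er1 * wr = fr2 + 2 * fr * fr1 + er * (fr + r * fr1)" using nz by (simp add: d wr_def efun1_def)
  have "(4 * er + r * er1 - (fr + r * er)\<^sup>2) * wr
      = 4 * (er * wr) + r * (er1 * wr) - fr\<^sup>2 * wr - 2 * r * fr * (er * wr) - r\<^sup>2 * er * (er * wr)"
    by algebra
  also have "\<dots> = 4 * fr1 + 3 * fr\<^sup>2 + r * fr2 + r * fr * fr1 + r * fr * (er * (1 - r * fr) - fr1 - fr\<^sup>2)"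
    unfolding 1 2 by (simp add: wfun algebra_simps power2_eq_square)
  also have "er * (1 - r * fr) - fr1 - fr\<^sup>2 = 0" using 1 by (simp add: wfun)
  finally show ?thesis by (simp add: ricB_def d wr_def)
qed

text \<open>The right side is \<open>2 (r^3 f)'' / r\<close>. Both blocks contribute the same trace
  \<open>A (1 + w) + r B w\<close>, in which the products of \<open>f\<close> with \<open>f\<close>
  and with \<open>f'\<close> cancel; this makes the extremal equation linear.\<close>

lemma scalar_curvature_eq:
  "scalar_curvature g p = 2 * ((rad z)\<^sup>2 * f2 (rad z) + 6 * rad z * f1 (rad z) + 6 * f (rad z))"
proof -
  define s t where "s = z $ 1" "t = z $ 2"
  note d = this
  define A B r fr where "A = ricA" "B = ricB" "r = rad z" "fr = f (rad z)"
  note d2 = this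
  define wr where "wr = wfun (rad z)"
  have wfun: "wr = 1 - r * fr" by (simp add: wfun_def wr_def d2)
  have r: "r = s + t" by (simp add: d d2 rad_def)
  have nz: "s \<noteq> 0" "t \<noteq> 0" "wr \<noteq> 0"
    using wfun_pos[of "rad z"] p coord_nonzero by (auto simp: pos_over_def z_def wr_def d)
  have F: "F (rad z) = fr / wr" using F_f[of "rad z"] p by (simp add: pos_over_def z_def wr_def wfun_def d2)
  define K where "K = A * fr * (r * fr - 2) + B * wr\<^sup>2"
  have T: "ricci g (Inr a) (Inr b) p = 2 * ((if a = b then z $ a * A else 0) + z $ a * z $ b * K)" for a b
    unfolding ricci_tt K_def d2 wr_def by simp
  have xx: "(\<Sum>i\<in>UNIV. \<Sum>j\<in>UNIV. matrix_inv (g p) $ Inl i $ Inl j * ricci g (Inl i) (Inl j) p)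
      = A * (1 + wr) + r * B * wr"
    unfolding ginv_nth[OF p] ricci_xx z_def[symmetric] sum_2 unfolding d2(4)[symmetric] unfolding d2(1-3)[symmetric] d[symmetric] wfun r
    using nz by (simp add: field_simps)
  have "(\<Sum>i\<in>UNIV. \<Sum>j\<in>UNIV. matrix_inv (g p) $ Inr i $ Inr j * ricci g (Inr i) (Inr j) p)
      = 2 * A + r * K + fr / wr * (r * A + r\<^sup>2 * K)"
    unfolding ginv_nth[OF p] z_def[symmetric] T F sum_2 unfolding d[symmetric] r
    using nz by (simp add: algebra_simps power2_eq_square add_divide_distrib)
  also have "\<dots> = (2 * A * wr + r * K * (wr + r * fr) + r * fr * A) / wr"
    using nz by (simp add: field_simps power2_eq_square)
  also have "2 * A * wr + r * K * (wr + r * fr) + r * fr * A = (A * (1 + wr) + r * B * wr) * wr"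
    unfolding K_def wfun by algebra
  finally have tt: "(\<Sum>i\<in>UNIV. \<Sum>j\<in>UNIV. matrix_inv (g p) $ Inr i $ Inr j * ricci g (Inr i) (Inr j) p)
      = A * (1 + wr) + r * B * wr" using nz by simp
  have "scalar_curvature g p = 2 * (A * (1 + wr) + r * (B * wr))"
    unfolding scalar_curvature_def sum_UNIV_Plus
    using xx tt by (simp add: ginv_nth[OF p] sum_2)
  also have "B * wr = 4 * f1 (rad z) + 3 * fr\<^sup>2 + r * f2 (rad z) + r * fr * f1 (rad z)"
    using ricB_w by (simp add: d2 wr_def)
  finally show ?thesis
    unfolding wfun by (simp add: d2 ricA_def algebra_simps power2_eq_square)
qed

end

end

section \<open>The distance\<close>

lemma angle_lattice_add: "k \<in> angle_lattice m \<Longrightarrow> l \<in> angle_lattice m \<Longrightarrow> k + l \<in> angle_lattice m"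
proof -
  assume "k \<in> angle_lattice m" "l \<in> angle_lattice m"
  then obtain i j n i' j' n' :: int where
    "k = of_int i *\<^sub>R axis 1 1 + of_int j *\<^sub>R axis 2 1 + of_int n *\<^sub>R (\<chi> _. 1 / real m)"
    "l = of_int i' *\<^sub>R axis 1 1 + of_int j' *\<^sub>R axis 2 1 + of_int n' *\<^sub>R (\<chi> _. 1 / real m)"
    unfolding angle_lattice_def by auto
  then have "k + l = of_int (i + i') *\<^sub>R axis 1 1 + of_int (j + j') *\<^sub>R axis 2 1 + of_int (n + n') *\<^sub>R (\<chi> _. 1 / real m)"
    by (simp add: algebra_simps)
  then show ?thesis unfolding angle_lattice_def by blast
qed

lemma angle_lattice_minus: "k \<in> angle_lattice m \<Longrightarrow> - k \<in> angle_lattice m"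
proof -
  assume "k \<in> angle_lattice m"
  then obtain i j n :: int where
    "k = of_int i *\<^sub>R axis 1 1 + of_int j *\<^sub>R axis 2 1 + of_int n *\<^sub>R (\<chi> _. 1 / real m)"
    unfolding angle_lattice_def by auto
  then have "- k = of_int (- i) *\<^sub>R axis 1 1 + of_int (- j) *\<^sub>R axis 2 1 + of_int (- n) *\<^sub>R (\<chi> _. 1 / real m)"
    by (simp add: algebra_simps)
  then show ?thesis unfolding angle_lattice_def by blast
qed

lemma angle_lattice_int: "of_int i *\<^sub>R axis 1 1 + of_int j *\<^sub>R axis 2 1 \<in> angle_lattice m"
proof -
  have "of_int i *\<^sub>R axis 1 1 + of_int j *\<^sub>R axis 2 1
    = of_int i *\<^sub>R axis 1 1 + of_int j *\<^sub>R axis 2 1 + of_int 0 *\<^sub>R (\<chi> _. 1 / real m)" by simp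
  then show ?thesis unfolding angle_lattice_def by blast
qed

text \<open>The shifts of the angles that do not move the point over \<open>x\<close>: the lattice
  and the circles collapsed there. They form a group, which makes the sets \<open>point_of\<close>
  the classes of an equivalence relation.\<close>

definition angle_kernel :: "nat \<Rightarrow> real \<Rightarrow> real^2 \<Rightarrow> (real^2) set" where
  "angle_kernel m a x = {(2 * pi) *\<^sub>R l + s\<^sub>1 *\<^sub>R axis 1 1 + s\<^sub>2 *\<^sub>R axis 2 1 + s\<^sub>0 *\<^sub>R (\<chi> _. 1 / real m) | l s\<^sub>1 s\<^sub>2 s\<^sub>0.
     l \<in> angle_lattice m \<and> (s\<^sub>1 \<noteq> 0 \<longrightarrow> x $ 1 = 0) \<and> (s\<^sub>2 \<noteq> 0 \<longrightarrow> x $ 2 = 0) \<and> (s\<^sub>0 \<noteq> 0 \<longrightarrow> rad x = a)}"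

lemma point_of_iff: "q \<in> point_of m a p \<longleftrightarrow> mom q = mom p \<and> ang q - ang p \<in> angle_kernel m a (mom p)"
proof -
  have "ang q = ang p + (2 * pi) *\<^sub>R l + s\<^sub>1 *\<^sub>R axis 1 1 + s\<^sub>2 *\<^sub>R axis 2 1 + s\<^sub>0 *\<^sub>R (\<chi> _. 1 / real m) \<longleftrightarrow>
    ang q - ang p = (2 * pi) *\<^sub>R l + s\<^sub>1 *\<^sub>R axis 1 1 + s\<^sub>2 *\<^sub>R axis 2 1 + s\<^sub>0 *\<^sub>R (\<chi> _. 1 / real m)" for l s\<^sub>1 s\<^sub>2 s\<^sub>0
    by (simp add: algebra_simps)
  then show ?thesis unfolding point_of_def angle_kernel_def by auto
qed

lemma angle_kernelI:
  "l \<in> angle_lattice m \<Longrightarrow> (s\<^sub>1 \<noteq> 0 \<longrightarrow> x $ 1 = 0) \<Longrightarrow> (s\<^sub>2 \<noteq> 0 \<longrightarrow> x $ 2 = 0) \<Longrightarrow> (s\<^sub>0 \<noteq> 0 \<longrightarrow> rad x = a) \<Longrightarrow>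
    k = (2 * pi) *\<^sub>R l + s\<^sub>1 *\<^sub>R axis 1 1 + s\<^sub>2 *\<^sub>R axis 2 1 + s\<^sub>0 *\<^sub>R (\<chi> _. 1 / real m) \<Longrightarrow> k \<in> angle_kernel m a x"
  unfolding angle_kernel_def by blast

lemma angle_kernel_0: "0 \<in> angle_kernel m a x"
  by (rule angle_kernelI[where s\<^sub>1 = 0 and s\<^sub>2 = 0 and s\<^sub>0 = 0, OF angle_lattice_int[of 0 0]]) auto

lemma angle_kernel_add:
  assumes "k \<in> angle_kernel m a x" "k' \<in> angle_kernel m a x" shows "k + k' \<in> angle_kernel m a x"
proof -
  obtain l s1 s2 s0 where 1: "l \<in> angle_lattice m" "s1 \<noteq> 0 \<longrightarrow> x $ 1 = 0" "s2 \<noteq> 0 \<longrightarrow> x $ 2 = 0" "s0 \<noteq> 0 \<longrightarrow> rad x = a"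
    "k = (2 * pi) *\<^sub>R l + s1 *\<^sub>R axis 1 1 + s2 *\<^sub>R axis 2 1 + s0 *\<^sub>R (\<chi> _. 1 / real m)"
    using assms(1) unfolding angle_kernel_def by auto
  obtain l' s1' s2' s0' where 2: "l' \<in> angle_lattice m" "s1' \<noteq> 0 \<longrightarrow> x $ 1 = 0" "s2' \<noteq> 0 \<longrightarrow> x $ 2 = 0" "s0' \<noteq> 0 \<longrightarrow> rad x = a"
    "k' = (2 * pi) *\<^sub>R l' + s1' *\<^sub>R axis 1 1 + s2' *\<^sub>R axis 2 1 + s0' *\<^sub>R (\<chi> _. 1 / real m)"
    using assms(2) unfolding angle_kernel_def by auto
  show ?thesis
    by (rule angle_kernelI[where s\<^sub>1 = "s1 + s1'" and s\<^sub>2 = "s2 + s2'" and s\<^sub>0 = "s0 + s0'", OF angle_lattice_add[OF 1(1) 2(1)]])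
       (use 1 2 in \<open>auto simp: algebra_simps\<close>)
qed

lemma angle_kernel_minus:
  assumes "k \<in> angle_kernel m a x" shows "- k \<in> angle_kernel m a x"
proof -
  obtain l s1 s2 s0 where 1: "l \<in> angle_lattice m" "s1 \<noteq> 0 \<longrightarrow> x $ 1 = 0" "s2 \<noteq> 0 \<longrightarrow> x $ 2 = 0" "s0 \<noteq> 0 \<longrightarrow> rad x = a"
    "k = (2 * pi) *\<^sub>R l + s1 *\<^sub>R axis 1 1 + s2 *\<^sub>R axis 2 1 + s0 *\<^sub>R (\<chi> _. 1 / real m)"
    using assms(1) unfolding angle_kernel_def by auto
  show ?thesis
    by (rule angle_kernelI[where s\<^sub>1 = "- s1" and s\<^sub>2 = "- s2" and s\<^sub>0 = "- s0", OF angle_lattice_minus[OF 1(1)]])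
       (use 1 in \<open>auto simp: algebra_simps\<close>)
qed

lemma point_of_self: "p \<in> point_of m a p"
  by (simp add: point_of_iff angle_kernel_0)

lemma point_of_eqI: assumes "q \<in> point_of m a p" shows "point_of m a q = point_of m a p"
proof -
  have 1: "mom q = mom p" and 2: "ang q - ang p \<in> angle_kernel m a (mom p)"
    using assms by (auto simp: point_of_iff)
  have "ang s - ang q \<in> angle_kernel m a (mom p) \<longleftrightarrow> ang s - ang p \<in> angle_kernel m a (mom p)" for s
    using angle_kernel_add[OF _ 2, of "ang s - ang q"]
      angle_kernel_add[OF _ angle_kernel_minus[OF 2], of "ang s - ang p"] by auto
  then show ?thesis using 1 by (auto simp: point_of_iff set_eq_iff)
qed

lemma segment_reg:
  assumes "segment_in D \<gamma>"
  obtains S where "finite S" "continuous_on {0..1} \<gamma>"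
    "\<And>t. t \<in> {0<..<1} - S \<Longrightarrow> (\<gamma> has_vector_derivative vector_derivative \<gamma> (at t)) (at t)"
    "continuous_on ({0<..<1} - S) (\<lambda>t. vector_derivative \<gamma> (at t))"
proof -
  obtain S where S: "finite S" "continuous_on {0..1} \<gamma>" "\<gamma> C1_differentiable_on ({0..1} - S)"
    using assms by (auto simp: segment_in_def valid_path_def piecewise_C1_differentiable_on_def)
  show thesis
  proof (rule that[OF S(1,2)])
    show "(\<gamma> has_vector_derivative vector_derivative \<gamma> (at t)) (at t)" if "t \<in> {0<..<1} - S" for t
      using S(3) that unfolding C1_differentiable_on_eq
      by (auto simp: vector_derivative_works[symmetric])
    show "continuous_on ({0<..<1} - S) (\<lambda>t. vector_derivative \<gamma> (at t))"
      using S(3) unfolding C1_differentiable_on_eq by (auto elim: continuous_on_subset)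
  qed
qed

lemma segment_in_reversepath: "segment_in D \<gamma> \<Longrightarrow> segment_in D (reversepath \<gamma>)"
  unfolding segment_in_def by (auto simp: reversepath_def pathstart_def pathfinish_def
      intro: valid_path_imp_reverse[unfolded reversepath_def])

lemma joins_append:
  "joins m a D A \<gamma>s B \<Longrightarrow> joins m a D B \<delta>s C \<Longrightarrow> joins m a D A (\<gamma>s @ \<delta>s) C"
  by (induction \<gamma>s arbitrary: A) auto

lemma joins_rev: "joins m a D A \<gamma>s B \<Longrightarrow> joins m a D B (rev (map reversepath \<gamma>s)) A"
proof (induction \<gamma>s arbitrary: A)
  case (Cons \<gamma> \<gamma>s)
  have "joins m a D (point_of m a (pathfinish \<gamma>)) [reversepath \<gamma>] A"
    using Cons.prems segment_in_reversepath by auto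
  moreover have "joins m a D B (rev (map reversepath \<gamma>s)) (point_of m a (pathfinish \<gamma>))"
    using Cons by auto
  ultimately show ?case by (simp only: rev.simps list.map joins_append)
qed auto

text \<open>\<open>bounds\<close> allows \<open>F\<close> a simple pole at \<open>a\<close>, as over
  the zero section, while the inverse Hessian, which involves only \<open>f\<close>, stays bounded.
  \<open>D_down\<close> and \<open>int_D\<close> make \<open>D\<close> an interval that contains
  \<open>a\<close> but no right endpoint.\<close>

locale U2_domain = momentum_profile "interior D" h F f
  for D :: "real set" and h F f :: "real \<Rightarrow> real" +
  fixes m :: nat and a :: real
  assumes m_pos: "1 \<le> m" and a_pos: "0 < a"
    and a_in: "a \<in> D" and D_ge: "\<And>r. r \<in> D \<Longrightarrow> a \<le> r"
    and D_down: "\<And>r s. r \<in> D \<Longrightarrow> a \<le> s \<Longrightarrow> s \<le> r \<Longrightarrow> s \<in> D"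
    and int_D: "interior D = D - {a}"
    and D_more: "\<exists>\<rho>\<in>D. a < \<rho>"
    and bounds: "\<And>\<rho>. \<rho> \<in> D \<Longrightarrow> \<exists>C. \<forall>r. a < r \<and> r \<le> \<rho> \<longrightarrow> \<bar>F r\<bar> * (r - a) \<le> C \<and> \<bar>f r\<bar> \<le> C"
begin

abbreviation "pt \<equiv> point_of m a"
abbreviation "len \<gamma>s \<equiv> \<Sum>\<gamma>\<leftarrow>\<gamma>s. riem_length (U2_metric h) \<gamma>"
abbreviation "jn \<equiv> joins m a D"
abbreviation "dst \<equiv> riem_dist m a D h"
abbreviation "Pol \<equiv> mom_polygon D"
abbreviation "MI \<equiv> mom_int D"

definition speed :: "coords \<Rightarrow> coords \<Rightarrow> real" where
  "speed p v = sqrt (v \<bullet> (U2_metric h p *v v))"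

lemma MI_pos_over: "x \<in> MI \<Longrightarrow> x \<in> pos_over (interior D)"
  by (simp add: mom_int_eq_pos_over)

lemma speed_eq: "mom p \<in> MI \<Longrightarrow> speed p v = sqrt (quadG (mom p) (mom v) + quadH (mom p) (ang v))"
  by (simp add: speed_def metric_quad MI_pos_over)

lemma speed_nonneg: "mom p \<in> MI \<Longrightarrow> 0 \<le> speed p v"
  by (simp add: speed_eq quadG_nonneg quadH_nonneg MI_pos_over)

lemma F_cont: "continuous_on (interior D) F"
proof -
  have "continuous_on (interior D) (\<lambda>r. f r / (1 - r * f r))"
    using w_pos by (intro continuous_intros f_cont) fastforce
  then show ?thesis using F_f by (simp cong: continuous_on_cong)
qed

text \<open>The indicator removes the finitely many parameters without derivative; on the remaining
  open set the speed is continuous.\<close>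

lemma speed_measurable:
  assumes \<gamma>: "segment_in D \<gamma>" and S: "finite S"
    "continuous_on {0..1} \<gamma>" "continuous_on ({0<..<1} - S) (\<lambda>t. vector_derivative \<gamma> (at t))"
  shows "(\<lambda>t. indicator ({0<..<1} - S) t * speed (\<gamma> t) (vector_derivative \<gamma> (at t))) \<in> borel_measurable borel"
proof -
  let ?T = "{0<..<1} - S"
  have int: "mom (\<gamma> t) \<in> MI" if "t \<in> ?T" for t using \<gamma> that by (auto simp: segment_in_def)
  have p: "0 < mom (\<gamma> t) $ 1" "0 < mom (\<gamma> t) $ 2" "rad (mom (\<gamma> t)) \<in> interior D" if "t \<in> ?T" for t
    using int[OF that] by (auto simp: mom_int_def)
  have c: "continuous_on ?T \<gamma>" using S(2) by (rule continuous_on_subset) auto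
  have rm: "continuous_on ?T (\<lambda>t. rad (mom (\<gamma> t)))" by (intro continuous_intros c)
  have cF: "continuous_on ?T (\<lambda>t. F (rad (mom (\<gamma> t))))" "continuous_on ?T (\<lambda>t. f (rad (mom (\<gamma> t))))"
    by (rule continuous_on_compose2[OF F_cont rm] continuous_on_compose2[OF f_cont rm]; use p in blast)+
  have "continuous_on ?T (\<lambda>t. sqrt (quadG (mom (\<gamma> t)) (mom (vector_derivative \<gamma> (at t)))
      + quadH (mom (\<gamma> t)) (ang (vector_derivative \<gamma> (at t)))))"
    unfolding quadG_def quadH_def
    by (intro continuous_intros c S cF) (use p in force)+
  then have "continuous_on ?T (\<lambda>t. speed (\<gamma> t) (vector_derivative \<gamma> (at t)))"
    by (subst continuous_on_cong[OF refl speed_eq[OF int]])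
  then have "(\<lambda>t. indicator ?T t *\<^sub>R speed (\<gamma> t) (vector_derivative \<gamma> (at t))) \<in> borel_measurable borel"
    by (intro borel_measurable_continuous_on_indicator) (auto simp: S(1) finite_imp_closed)
  then show ?thesis by simp
qed

lemma riem_length_eq:
  assumes S: "finite S"
  shows "riem_length (U2_metric h) \<gamma> =
    (\<integral>\<^sup>+ t. ennreal (indicator ({0<..<1} - S) t * speed (\<gamma> t) (vector_derivative \<gamma> (at t))) \<partial>lborel)"
proof -
  have "AE t in lborel. t \<notin> insert 0 (insert 1 S)"
    using S by (intro AE_not_in finite_imp_null_set_lborel) auto
  then have "AE t in lborel. ennreal (speed (\<gamma> t) (vector_derivative \<gamma> (at t))) * indicator {0..1} t =
      ennreal (indicator ({0<..<1} - S) t * speed (\<gamma> t) (vector_derivative \<gamma> (at t)))"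
    by eventually_elim (auto simp: indicator_def)
  then show ?thesis unfolding riem_length_def Let_def speed_def[symmetric]
    by (rule nn_integral_cong_AE)
qed

lemma riem_length_reversepath:
  assumes \<gamma>: "segment_in D \<gamma>"
  shows "riem_length (U2_metric h) (reversepath \<gamma>) = riem_length (U2_metric h) \<gamma>"
proof -
  obtain S where S: "finite S" "continuous_on {0..1} \<gamma>"
    "\<And>t. t \<in> {0<..<1} - S \<Longrightarrow> (\<gamma> has_vector_derivative vector_derivative \<gamma> (at t)) (at t)"
    "continuous_on ({0<..<1} - S) (\<lambda>t. vector_derivative \<gamma> (at t))"
    using segment_reg[OF \<gamma>] by blast
  let ?T = "{0<..<1} - S"
  let ?s = "\<lambda>t. indicator ?T t * speed (\<gamma> t) (vector_derivative \<gamma> (at t))"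
  have S': "finite ((\<lambda>t. 1 - t) ` S)" using S by simp
  have "riem_length (U2_metric h) (reversepath \<gamma>) = (\<integral>\<^sup>+ t. ennreal (?s (1 + (-1) * t)) \<partial>lborel)"
    unfolding riem_length_eq[OF S']
  proof (rule nn_integral_cong, cases)
    fix t :: real
    assume t: "t \<in> {0<..<1} - (\<lambda>t. 1 - t) ` S"
    then have t': "1 - t \<in> ?T" by (force simp: image_iff)
    have "((\<lambda>t. 1 - t) has_vector_derivative - 1) (at t)"
      by (auto intro!: derivative_eq_intros)
    then have "(reversepath \<gamma> has_vector_derivative (- 1) *\<^sub>R vector_derivative \<gamma> (at (1 - t))) (at t)"
      unfolding reversepath_def
      using vector_diff_chain_at[of "\<lambda>t. 1 - t" "-1" t \<gamma>] S(3)[OF t'] by (simp add: o_def)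
    then have "vector_derivative (reversepath \<gamma>) (at t) = - vector_derivative \<gamma> (at (1 - t))"
      using vector_derivative_at by fastforce
    moreover have "speed p (- v) = speed p v" for p v
      by (simp add: speed_def linear_neg[OF matrix_vector_mul_linear])
    ultimately show "ennreal (indicator ({0<..<1} - (\<lambda>t. 1 - t) ` S) t * speed (reversepath \<gamma> t) (vector_derivative (reversepath \<gamma>) (at t)))
      = ennreal (?s (1 + (-1) * t))"
      using t t' by (simp add: reversepath_def)
  next
    fix t :: real
    assume t: "t \<notin> {0<..<1} - (\<lambda>t. 1 - t) ` S"
    then have t': "1 + (- 1) * t \<notin> ?T" by (force simp: image_iff)
    show "ennreal (indicator ({0<..<1} - (\<lambda>t. 1 - t) ` S) t * speed (reversepath \<gamma> t) (vector_derivative (reversepath \<gamma>) (at t)))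
      = ennreal (?s (1 + (-1) * t))"
      unfolding indicator_simps(2)[OF t] indicator_simps(2)[OF t'] by simp
  qed
  also have "\<dots> = (\<integral>\<^sup>+ t. ennreal (?s t) \<partial>lborel)"
    using nn_integral_real_affine[of "\<lambda>t. ennreal (?s t)" "-1" 1] speed_measurable[OF \<gamma> S(1,2,4)] by simp
  finally show ?thesis by (simp add: riem_length_eq[OF S(1)])
qed

text \<open>Functions on the manifold whose gradient has norm at most \<open>K\<close> bound the distance from below.\<close>

definition lip :: "real \<Rightarrow> (coords \<Rightarrow> 'b::euclidean_space) \<Rightarrow> bool" where
  "lip K \<Phi> \<longleftrightarrow> 0 < K \<and> continuous_on {p. mom p \<in> Pol} \<Phi> \<and>
     (\<forall>p q. mom p \<in> Pol \<longrightarrow> q \<in> pt p \<longrightarrow> \<Phi> q = \<Phi> p) \<and>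
     (\<forall>p. mom p \<in> MI \<longrightarrow> (\<exists>\<Phi>'. (\<Phi> has_derivative \<Phi>') (at p) \<and> (\<forall>v. norm (\<Phi>' v) \<le> K * speed p v)))"

lemma MI_Pol: "x \<in> MI \<Longrightarrow> x \<in> Pol"
  using interior_subset by (auto simp: mom_int_def mom_polygon_def)

lemma lip_segment:
  assumes L: "lip K \<Phi>" and \<gamma>: "segment_in D \<gamma>"
  shows "ennreal (norm (\<Phi> (pathfinish \<gamma>) - \<Phi> (pathstart \<gamma>))) \<le> ennreal K * riem_length (U2_metric h) \<gamma>"
proof -
  obtain S where S: "finite S" "continuous_on {0..1} \<gamma>"
    "\<And>t. t \<in> {0<..<1} - S \<Longrightarrow> (\<gamma> has_vector_derivative vector_derivative \<gamma> (at t)) (at t)"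
    "continuous_on ({0<..<1} - S) (\<lambda>t. vector_derivative \<gamma> (at t))"
    using segment_reg[OF \<gamma>] by blast
  have int: "mom (\<gamma> t) \<in> MI" if "t \<in> {0<..<1}" for t using \<gamma> that by (auto simp: segment_in_def)
  have pol: "mom (\<gamma> t) \<in> Pol" if "t \<in> {0..1}" for t
    using \<gamma> int[of t] that MI_Pol by (cases "t = 0"; cases "t = 1") (auto simp: segment_in_def pathstart_def pathfinish_def)
  define \<Phi>' where "\<Phi>' = (\<lambda>p. SOME G. (\<Phi> has_derivative G) (at p) \<and> (\<forall>v. norm (G v) \<le> K * speed p v))"
  have \<Phi>': "(\<Phi> has_derivative \<Phi>' p) (at p) \<and> (\<forall>v. norm (\<Phi>' p v) \<le> K * speed p v)" if "mom p \<in> MI" for p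
  proof -
    have "\<exists>G. (\<Phi> has_derivative G) (at p) \<and> (\<forall>v. norm (G v) \<le> K * speed p v)"
      using L that unfolding lip_def by blast
    then show ?thesis unfolding \<Phi>'_def by (rule someI_ex)
  qed
  have "ennreal (norm ((\<Phi> \<circ> \<gamma>) 1 - (\<Phi> \<circ> \<gamma>) 0)) \<le> ennreal K *
      (\<integral>\<^sup>+ t. ennreal (indicator ({0<..<1} - S) t * speed (\<gamma> t) (vector_derivative \<gamma> (at t))) \<partial>lborel)"
  proof (rule norm_diff_le_nn_integral[OF S(1) _ _ _ _ speed_measurable[OF \<gamma> S(1,2,4)],
        where f' = "\<lambda>t. \<Phi>' (\<gamma> t) (vector_derivative \<gamma> (at t))"])
    show "0 < K" using L by (simp add: lip_def)
    show "continuous_on {0..1} (\<Phi> \<circ> \<gamma>)"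
      unfolding o_def using L pol by (intro continuous_on_compose2[OF _ S(2)]) (auto simp: lip_def)
    show "(\<Phi> \<circ> \<gamma> has_vector_derivative \<Phi>' (\<gamma> t) (vector_derivative \<gamma> (at t))) (at t)" if t: "t \<in> {0<..<1} - S" for t
      using vector_derivative_diff_chain_within[OF S(3)[OF t], of \<Phi> "\<Phi>' (\<gamma> t)"] \<Phi>'[of "\<gamma> t"] int[of t] t
      by (auto intro: has_derivative_at_withinI)
    show "norm (\<Phi>' (\<gamma> t) (vector_derivative \<gamma> (at t))) \<le> K * (indicator ({0<..<1} - S) t * speed (\<gamma> t) (vector_derivative \<gamma> (at t)))"
      if t: "t \<in> {0<..<1} - S" for t
      using \<Phi>'[of "\<gamma> t"] int[of t] t by auto
    show "0 \<le> indicator ({0<..<1} - S) t * speed (\<gamma> t) (vector_derivative \<gamma> (at t))" for t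
      using int[of t] by (auto simp: indicator_def speed_nonneg)
  qed
  then show ?thesis by (simp add: riem_length_eq[OF S(1)] pathstart_def pathfinish_def)
qed

text \<open>At a joint the coordinate vector may jump, but only within its class, where
  \<open>\<Phi>\<close> is constant; so the increments over the segments add up.\<close>

lemma lip_joins:
  assumes L: "lip K \<Phi>"
  shows "jn (pt p) \<gamma>s (pt q) \<Longrightarrow> mom p \<in> Pol \<Longrightarrow> ennreal (norm (\<Phi> p - \<Phi> q)) \<le> ennreal K * len \<gamma>s"
proof (induction \<gamma>s arbitrary: p)
  case Nil
  then have "\<Phi> q = \<Phi> p" using L point_of_self[of q m a] unfolding lip_def by auto
  then show ?case by simp
next
  case (Cons \<gamma> \<gamma>s)
  let ?s = "pathstart \<gamma>" and ?e = "pathfinish \<gamma>"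
  have \<gamma>: "segment_in D \<gamma>" and "pt ?s = pt p" and j: "jn (pt ?e) \<gamma>s (pt q)" using Cons.prems by auto
  then have 1: "\<Phi> ?s = \<Phi> p" using L Cons.prems point_of_self[of ?s m a] unfolding lip_def by auto
  have e: "mom ?e \<in> Pol" using \<gamma> by (simp add: segment_in_def)
  have "norm (\<Phi> p - \<Phi> q) \<le> norm (\<Phi> ?e - \<Phi> ?s) + norm (\<Phi> ?e - \<Phi> q)"
    using norm_triangle_ineq4[of "\<Phi> ?e - \<Phi> q" "\<Phi> ?e - \<Phi> ?s"] 1 by (simp add: norm_minus_commute)
  then have "ennreal (norm (\<Phi> p - \<Phi> q)) \<le> ennreal (norm (\<Phi> ?e - \<Phi> ?s)) + ennreal (norm (\<Phi> ?e - \<Phi> q))"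
    by (simp add: ennreal_plus[symmetric] ennreal_leI del: ennreal_plus)
  also have "\<dots> \<le> ennreal K * riem_length (U2_metric h) \<gamma> + ennreal K * len \<gamma>s"
    by (intro add_mono lip_segment[OF L \<gamma>] Cons.IH[OF j e])
  finally show ?case by (simp add: distrib_left)
qed

end

section \<open>Upper bounds for the distance from explicit paths\<close>

lemma norm2_sq: "(norm (v::real^2))\<^sup>2 = (v $ 1)\<^sup>2 + (v $ 2)\<^sup>2"
  by (simp add: norm_vec_def L2_set_def sum_2)

lemma norm_coords_sq: "(norm (v::coords))\<^sup>2 = (norm (mom v))\<^sup>2 + (norm (ang v))\<^sup>2"
  by (simp add: norm_vec_def L2_set_def sum_UNIV_Plus sum_2 mom_nth ang_nth sum_nonneg)

text \<open>A homothety of the momenta towards \<open>x\<close> with the angles fixed. It maps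
  straight lines to straight lines and does not increase Euclidean distances, so a whole segment is
  moved off the edges at once.\<close>

definition pull :: "real \<Rightarrow> real^2 \<Rightarrow> coords \<Rightarrow> coords" where
  "pull \<delta> x p = (\<chi> i. case i of Inl j \<Rightarrow> (1 - \<delta>) * p $ Inl j + \<delta> * x $ j | Inr j \<Rightarrow> p $ Inr j)"

lemma mom_pull: "mom (pull \<delta> x p) = (1 - \<delta>) *\<^sub>R mom p + \<delta> *\<^sub>R x"
  and ang_pull: "ang (pull \<delta> x p) = ang p"
  by (auto simp: pull_def mom_def ang_def vec_eq_iff)

lemma coords_eqI: "mom p = mom q \<Longrightarrow> ang p = ang q \<Longrightarrow> p = q"
  by (simp add: vec_eq_iff mom_def ang_def) (metis sum.exhaust)

lemma norm_pull_le: assumes "0 \<le> \<delta>" "\<delta> \<le> 1" shows "norm (pull \<delta> x q - pull \<delta> x p) \<le> norm (q - p)"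
proof -
  have "mom (pull \<delta> x q - pull \<delta> x p) = (1 - \<delta>) *\<^sub>R mom (q - p)"
    by (simp add: mom_diff mom_pull algebra_simps)
  then have "(norm (mom (pull \<delta> x q - pull \<delta> x p)))\<^sup>2 \<le> (norm (mom (q - p)))\<^sup>2"
    using assms by (simp add: power_mult_distrib mult_left_le_one_le power_le_one)
  then have "(norm (pull \<delta> x q - pull \<delta> x p))\<^sup>2 \<le> (norm (q - p))\<^sup>2"
    unfolding norm_coords_sq by (simp add: ang_diff ang_pull)
  then show ?thesis by (rule power2_le_imp_le) simp
qed

context U2_domain
begin

definition joined :: "coords \<Rightarrow> coords \<Rightarrow> real \<Rightarrow> bool" where
  "joined p q L \<longleftrightarrow> 0 \<le> L \<and> (\<exists>\<gamma>s. jn (pt p) \<gamma>s (pt q) \<and> len \<gamma>s \<le> ennreal L)"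

lemma joined_trans: assumes "joined p q L" "joined q s M" shows "joined p s (L + M)"
proof -
  obtain \<gamma>s \<delta>s where "jn (pt p) \<gamma>s (pt q)" "len \<gamma>s \<le> ennreal L" "jn (pt q) \<delta>s (pt s)" "len \<delta>s \<le> ennreal M"
    and nn: "0 \<le> L" "0 \<le> M"
    using assms unfolding joined_def by blast
  then have "jn (pt p) (\<gamma>s @ \<delta>s) (pt s)" "len (\<gamma>s @ \<delta>s) \<le> ennreal (L + M)"
    using joins_append by (auto intro: add_mono)
  then show ?thesis using nn unfolding joined_def by (blast intro: add_nonneg_nonneg)
qed

lemma len_rev: "jn A \<gamma>s B \<Longrightarrow> len (rev (map reversepath \<gamma>s)) = len \<gamma>s"
  by (induction \<gamma>s arbitrary: A) (auto simp: riem_length_reversepath add.commute)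

lemma joined_sym: assumes "joined p q L" shows "joined q p L"
  using assms joins_rev len_rev unfolding joined_def by metis

lemma joined_mono: "joined p q L \<Longrightarrow> L \<le> M \<Longrightarrow> joined p q M"
  unfolding joined_def by (meson order_trans ennreal_leI)

lemma joined_linepath:
  assumes pq: "mom p \<in> Pol" "mom q \<in> Pol" and int: "\<And>t. 0 < t \<Longrightarrow> t < 1 \<Longrightarrow> mom (linepath p q t) \<in> MI"
    and \<psi>: "continuous_on {0..1} \<psi>" "\<And>t. t \<in> {0<..<1} \<Longrightarrow> (\<psi> has_real_derivative \<psi>' t) (at t)"
    and le: "\<And>t. 0 < t \<Longrightarrow> t < 1 \<Longrightarrow> speed (linepath p q t) (q - p) \<le> \<psi>' t"
    and L: "\<psi> 1 - \<psi> 0 \<le> L" "0 \<le> L"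
  shows "joined p q L"
proof -
  have "jn (pt p) [linepath p q] (pt q)" using pq int by (auto simp: segment_in_def)
  moreover have "riem_length (U2_metric h) (linepath p q) = (\<integral>\<^sup>+ t\<in>{0..1}. ennreal (speed (linepath p q t) (q - p)) \<partial>lborel)"
    unfolding riem_length_def Let_def vector_derivative_linepath_at speed_def ..
  moreover have "\<dots> \<le> ennreal (\<psi> 1 - \<psi> 0)"
    by (rule nn_integral_le_diff[OF \<psi>]) (use le int speed_nonneg in auto)
  ultimately have "len [linepath p q] \<le> ennreal L" using L by (auto intro: order_trans ennreal_leI)
  then show ?thesis using \<open>jn (pt p) [linepath p q] (pt q)\<close> L unfolding joined_def by blast
qed

lemma mom_linepath: "mom (linepath p q t) = (1 - t) *\<^sub>R mom p + t *\<^sub>R mom q"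
  and ang_linepath: "ang (linepath p q t) = (1 - t) *\<^sub>R ang p + t *\<^sub>R ang q"
  by (simp_all add: linepath_def mom_add mom_scaleR ang_add ang_scaleR)

lemma PolD: "x \<in> Pol \<Longrightarrow> 0 \<le> x $ 1 \<and> 0 \<le> x $ 2 \<and> rad x \<in> D \<and> a \<le> rad x"
  using D_ge by (auto simp: mom_polygon_def)

lemma MI_iff: "x \<in> MI \<longleftrightarrow> 0 < x $ 1 \<and> 0 < x $ 2 \<and> a < rad x \<and> rad x \<in> D"
  using D_ge by (auto simp: mom_int_def int_D less_le)

text \<open>\<open>\<eta>\<close> bounds the distance to the three edges from below. The Hessian is
  singular there only through \<open>1 / x_i\<close> and \<open>F\<close>, each at most a constant
  over \<open>\<eta>\<close>, while the inverse Hessian is bounded for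
  \<open>r \<le> \<rho>\<close>.\<close>

lemma speed_le:
  assumes \<rho>: "\<rho> \<in> D"
  obtains C where "0 < C" "\<And>p v \<eta>. mom p \<in> MI \<Longrightarrow> rad (mom p) \<le> \<rho> \<Longrightarrow> 0 < \<eta> \<Longrightarrow> \<eta> \<le> mom p $ 1 \<Longrightarrow> \<eta> \<le> mom p $ 2 \<Longrightarrow>
     \<eta> \<le> rad (mom p) - a \<Longrightarrow> speed p v \<le> sqrt (C / \<eta> * (norm (mom v))\<^sup>2 + C * (norm (ang v))\<^sup>2)"
proof -
  obtain B where B: "\<And>r. a < r \<Longrightarrow> r \<le> \<rho> \<Longrightarrow> \<bar>F r\<bar> * (r - a) \<le> B \<and> \<bar>f r\<bar> \<le> B"
    using bounds[OF \<rho>] by blast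
  define B' where "B' = max B 0"
  have B': "0 \<le> B'" "\<And>r. a < r \<Longrightarrow> r \<le> \<rho> \<Longrightarrow> \<bar>F r\<bar> * (r - a) \<le> B' \<and> \<bar>f r\<bar> \<le> B'"
    using B unfolding B'_def by force+
  have \<rho>0: "0 < \<rho>" using D_ge[OF \<rho>] a_pos by simp
  define C where "C = 1 + B' + 2 * \<rho> + 4 * B' * \<rho>\<^sup>2"
  have "0 \<le> 4 * B' * \<rho>\<^sup>2" using B'(1) by simp
  then have C: "0 < C" "1/2 + B' \<le> C" "2 * \<rho> + 4 * B' * \<rho>\<^sup>2 \<le> C"
    unfolding C_def using B'(1) \<rho>0 by linarith+
  show thesis
  proof (rule that[OF C(1)])
    fix p v \<eta>
    assume p: "mom p \<in> MI" "rad (mom p) \<le> \<rho>" and \<eta>: "0 < \<eta>" "\<eta> \<le> mom p $ 1" "\<eta> \<le> mom p $ 2" "\<eta> \<le> rad (mom p) - a"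
    define x y r where "x = mom p $ 1" "y = mom p $ 2" "r = rad (mom p)"
    note d = this
    have xy: "0 < x" "0 < y" "r = x + y" "a < r" "r \<le> \<rho>" "x \<le> \<rho>" "y \<le> \<rho>"
      using p by (auto simp: d MI_iff rad_def)
    have e: "\<eta> \<le> x" "\<eta> \<le> y" "\<eta> \<le> r - a" using \<eta> by (auto simp: d)
    have G: "quadG (mom p) u \<le> C / \<eta> * (norm u)\<^sup>2" for u
    proof -
      have 1: "(u $ 1)\<^sup>2 / x \<le> (u $ 1)\<^sup>2 / \<eta>" "(u $ 2)\<^sup>2 / y \<le> (u $ 2)\<^sup>2 / \<eta>"
        using e \<eta>(1) xy by (auto intro!: divide_left_mono)
      have "\<bar>F r\<bar> * \<eta> \<le> \<bar>F r\<bar> * (r - a)" using e by (intro mult_left_mono) auto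
      also have "\<dots> \<le> B'" using B'(2)[of r] xy by simp
      finally have "\<bar>F r\<bar> \<le> B' / \<eta>" using \<eta>(1) by (simp add: pos_le_divide_eq)
      then have "F r \<le> B' / \<eta>" by simp
      then have "F r * (u $ 1 + u $ 2)\<^sup>2 \<le> B' / \<eta> * (u $ 1 + u $ 2)\<^sup>2" by (intro mult_right_mono) auto
      also have "\<dots> \<le> B' / \<eta> * (2 * ((u $ 1)\<^sup>2 + (u $ 2)\<^sup>2))"
        using B'(1) \<eta>(1) sum_squares_bound[of "u $ 1" "u $ 2"]
        by (intro mult_left_mono) (auto simp: power2_eq_square algebra_simps)
      finally have 2: "F r * (u $ 1 + u $ 2)\<^sup>2 \<le> B' / \<eta> * (2 * ((u $ 1)\<^sup>2 + (u $ 2)\<^sup>2))" .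
      have "quadG (mom p) u \<le> ((u $ 1)\<^sup>2 / \<eta> + (u $ 2)\<^sup>2 / \<eta> + B' / \<eta> * (2 * ((u $ 1)\<^sup>2 + (u $ 2)\<^sup>2))) / 2"
        unfolding quadG_def d[symmetric] by (intro divide_right_mono add_mono 1 2) simp
      also have "\<dots> = (1/2 + B') / \<eta> * (norm u)\<^sup>2" using \<eta>(1) by (simp add: norm2_sq field_simps)
      also have "\<dots> \<le> C / \<eta> * (norm u)\<^sup>2"
        using C \<eta>(1) by (intro mult_right_mono divide_right_mono) auto
      finally show ?thesis .
    qed
    have H: "quadH (mom p) u \<le> C * (norm u)\<^sup>2" for u
    proof -
      have 1: "x * (u $ 1)\<^sup>2 \<le> \<rho> * (u $ 1)\<^sup>2" "y * (u $ 2)\<^sup>2 \<le> \<rho> * (u $ 2)\<^sup>2"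
        using xy by (auto intro!: mult_right_mono)
      have 2: "- f r * (x * u $ 1 + y * u $ 2)\<^sup>2 \<le> B' * (x * u $ 1 + y * u $ 2)\<^sup>2"
        using B'(2)[of r] xy by (intro mult_right_mono) auto
      have "(x * u $ 1 + y * u $ 2)\<^sup>2 \<le> 2 * ((x * u $ 1)\<^sup>2 + (y * u $ 2)\<^sup>2)"
        using sum_squares_bound[of "x * u $ 1" "y * u $ 2"] by (auto simp: power2_eq_square algebra_simps)
      also have "\<dots> \<le> 2 * (\<rho>\<^sup>2 * (u $ 1)\<^sup>2 + \<rho>\<^sup>2 * (u $ 2)\<^sup>2)"
        using xy by (intro mult_left_mono add_mono) (auto simp: power_mult_distrib intro!: mult_right_mono power_mono)
      finally have "(x * u $ 1 + y * u $ 2)\<^sup>2 \<le> 2 * \<rho>\<^sup>2 * (norm u)\<^sup>2" by (simp add: norm2_sq algebra_simps)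
      then have 3: "B' * (x * u $ 1 + y * u $ 2)\<^sup>2 \<le> B' * (2 * \<rho>\<^sup>2 * (norm u)\<^sup>2)"
        using B'(1) by (rule mult_left_mono)
      have lin: "2 * (A + B - E) \<le> 2 * (A' + B' + G)"
        if "A \<le> A'" "B \<le> B'" "- E \<le> K" "K \<le> G" for A A' B B' E K G :: real
        using add_mono[OF add_mono[OF that(1,2)] order_trans[OF that(3,4)]] by simp
      have "quadH (mom p) u \<le> 2 * (\<rho> * (u $ 1)\<^sup>2 + \<rho> * (u $ 2)\<^sup>2 + B' * (2 * \<rho>\<^sup>2 * (norm u)\<^sup>2))"
        unfolding quadH_def d[symmetric] by (rule lin[OF 1 2[unfolded mult_minus_left] 3])
      also have "\<dots> = (2 * \<rho> + 4 * B' * \<rho>\<^sup>2) * (norm u)\<^sup>2" by (simp add: norm2_sq algebra_simps)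
      also have "\<dots> \<le> C * (norm u)\<^sup>2" using C by (intro mult_right_mono) auto
      finally show ?thesis .
    qed
    show "speed p v \<le> sqrt (C / \<eta> * (norm (mom v))\<^sup>2 + C * (norm (ang v))\<^sup>2)"
      unfolding speed_eq[OF p(1)] using G[of "mom v"] H[of "ang v"] by simp
  qed
qed

lemma MI_mix:
  assumes "x \<in> Pol" "y \<in> MI" "0 < t" "t \<le> 1" shows "(1 - t) *\<^sub>R x + t *\<^sub>R y \<in> MI"
proof -
  have x: "0 \<le> x $ 1" "0 \<le> x $ 2" "rad x \<in> D" "a \<le> rad x" using PolD[OF assms(1)] by auto
  have y: "0 < y $ 1" "0 < y $ 2" "rad y \<in> D" "a < rad y" using assms(2) by (auto simp: MI_iff)
  have "(1 - t) * a + t * a < (1 - t) * rad x + t * rad y"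
    using x y assms by (intro add_le_less_mono mult_left_mono mult_strict_left_mono) auto
  moreover have "(1 - t) * rad x + t * rad y \<le> max (rad x) (rad y)"
    using assms by (intro convex_bound_le) auto
  moreover have "max (rad x) (rad y) \<in> D" using x y by (simp add: max_def)
  moreover have "rad ((1 - t) *\<^sub>R x + t *\<^sub>R y) = (1 - t) * rad x + t * rad y"
    by (simp add: rad_add rad_scaleR)
  moreover have "(1 - t) * a + t * a = a" by (simp add: algebra_simps)
  moreover have "0 < (1 - t) * x $ i + t * y $ i" for i
    using x y assms exhaust_2[of i] by (auto intro!: add_nonneg_pos)
  ultimately show ?thesis using D_down[of "max (rad x) (rad y)"] by (simp add: MI_iff)
qed

text \<open>The path pulls both endpoints towards a fixed interior point by the fraction \<open>\<delta>\<close> and joins the results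
  by a straight line. The metric blows up at the edges at most like the inverse distance to them, so each
  pull costs \<open>O(sqrt \<delta>)\<close>, even from a corner.\<close>

lemma joined_bound:
  assumes \<rho>: "\<rho> \<in> D" "a < \<rho>"
  obtains C where "0 < C" "\<And>\<delta>. 0 < \<delta> \<Longrightarrow> \<delta> \<le> 1 \<Longrightarrow> \<exists>K\<ge>0. \<forall>p q. mom p \<in> Pol \<longrightarrow> rad (mom p) \<le> \<rho> \<longrightarrow>
    mom q \<in> Pol \<longrightarrow> rad (mom q) \<le> \<rho> \<longrightarrow> joined p q (C * sqrt \<delta> + K * norm (q - p))"
proof -
  obtain B where B: "0 < B" "\<And>p v \<eta>. mom p \<in> MI \<Longrightarrow> rad (mom p) \<le> \<rho> \<Longrightarrow> 0 < \<eta> \<Longrightarrow> \<eta> \<le> mom p $ 1 \<Longrightarrow> \<eta> \<le> mom p $ 2 \<Longrightarrow>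
     \<eta> \<le> rad (mom p) - a \<Longrightarrow> speed p v \<le> sqrt (B / \<eta> * (norm (mom v))\<^sup>2 + B * (norm (ang v))\<^sup>2)"
    using speed_le[OF \<rho>(1)] by blast
  \<comment> \<open>A diagonal point with \<open>r\<close> halfway between \<open>a\<close> and
    \<open>\<rho>\<close>; the number \<open>\<eta>\<close> defined next bounds its distance to the
    three edges from below.\<close>
  define x0 :: "real^2" where "x0 = (\<chi> i. (a + \<rho>) / 4)"
  have rx0: "rad x0 = (a + \<rho>) / 2" by (simp add: rad_def x0_def)
  have x0: "x0 \<in> MI" using \<rho> a_pos D_down[OF \<rho>(1), of "(a + \<rho>) / 2"] by (simp add: MI_iff rx0) (simp add: x0_def)
  define \<eta> where "\<eta> = min (\<rho> - a) a / 2"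
  have \<eta>: "0 < \<eta>" "\<eta> \<le> x0 $ 1" "\<eta> \<le> x0 $ 2" "\<eta> \<le> rad x0 - a" using \<rho> a_pos unfolding rx0 by (auto simp: \<eta>_def x0_def min_def)
  define A where "A = B / \<eta> * (2 * \<rho>)\<^sup>2"
  have A: "0 < A" unfolding A_def using B \<eta> \<rho> a_pos by simp
  \<comment> \<open>The functions \<open>x_1\<close>, \<open>x_2\<close>, \<open>r - a\<close> are
    affine and nonnegative on the polygon, so pulling by \<open>\<delta>\<close> towards
    \<open>x0\<close> makes each at least \<open>\<delta> * \<eta>\<close>.\<close>
  have pm: "mom (pull \<delta> x0 p) \<in> MI" "rad (mom (pull \<delta> x0 p)) \<le> \<rho>"
      "\<delta> * \<eta> \<le> mom (pull \<delta> x0 p) $ 1" "\<delta> * \<eta> \<le> mom (pull \<delta> x0 p) $ 2" "\<delta> * \<eta> \<le> rad (mom (pull \<delta> x0 p)) - a"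
    if p: "mom p \<in> Pol" "rad (mom p) \<le> \<rho>" and \<delta>: "0 < \<delta>" "\<delta> \<le> 1" for \<delta> p
  proof -
    show "mom (pull \<delta> x0 p) \<in> MI" unfolding mom_pull by (rule MI_mix[OF p(1) x0 \<delta>])
    have P: "0 \<le> mom p $ 1" "0 \<le> mom p $ 2" "a \<le> rad (mom p)" using PolD[OF p(1)] by auto
    have "rad (mom (pull \<delta> x0 p)) = (1 - \<delta>) * rad (mom p) + \<delta> * rad x0" by (simp add: mom_pull rad_add rad_scaleR)
    moreover have "\<dots> \<le> \<rho>" using p \<delta> \<rho> by (intro convex_bound_le) (auto simp: rx0)
    moreover have "(1 - \<delta>) * a + \<delta> * (\<eta> + a) \<le> (1 - \<delta>) * rad (mom p) + \<delta> * rad x0"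
      using P \<eta> \<delta> by (intro add_mono mult_left_mono) auto
    ultimately show "rad (mom (pull \<delta> x0 p)) \<le> \<rho>" "\<delta> * \<eta> \<le> rad (mom (pull \<delta> x0 p)) - a"
      by (auto simp: algebra_simps)
    have "0 \<le> (1 - \<delta>) * mom p $ 1" "0 \<le> (1 - \<delta>) * mom p $ 2" "\<delta> * \<eta> \<le> \<delta> * x0 $ 1" "\<delta> * \<eta> \<le> \<delta> * x0 $ 2"
      using P \<delta> \<eta> by (auto intro: mult_left_mono)
    then show "\<delta> * \<eta> \<le> mom (pull \<delta> x0 p) $ 1" "\<delta> * \<eta> \<le> mom (pull \<delta> x0 p) $ 2"
      by (auto simp: mom_pull)
  qed
  \<comment> \<open>At time \<open>t\<close> the curve is pulled by \<open>t * \<delta>\<close>, so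
    it is \<open>t * \<delta> * \<eta>\<close> away from the edges, and its velocity has size at
    most \<open>2 * \<rho> * \<delta>\<close>. The speed is at most
    \<open>sqrt (A * \<delta> / t)\<close>, with integral
    \<open>2 * sqrt (A * \<delta>)\<close>.\<close>
  have spoke: "joined p (pull \<delta> x0 p) (2 * sqrt A * sqrt \<delta>)"
    if p: "mom p \<in> Pol" "rad (mom p) \<le> \<rho>" and \<delta>: "0 < \<delta>" "\<delta> \<le> 1" for \<delta> p
  proof (rule joined_linepath[where \<psi> = "\<lambda>t. 2 * sqrt (A * \<delta>) * sqrt t" and \<psi>' = "\<lambda>t. sqrt (A * \<delta>) / sqrt t"])
    have eq: "linepath p (pull \<delta> x0 p) t = pull (t * \<delta>) x0 p" for t
      by (rule coords_eqI) (simp_all add: mom_linepath ang_linepath mom_pull ang_pull algebra_simps)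
    have P: "0 \<le> mom p $ 1" "0 \<le> mom p $ 2" "a \<le> rad (mom p)" using PolD[OF p(1)] by auto
    show "mom p \<in> Pol" by (rule p)
    show "mom (pull \<delta> x0 p) \<in> Pol" using pm(1)[OF p \<delta>] by (rule MI_Pol)
    have td: "0 < t * \<delta>" "t * \<delta> \<le> 1" if "0 < t" "t < 1" for t using that \<delta> by (auto intro: mult_le_one)
    show "mom (linepath p (pull \<delta> x0 p) t) \<in> MI" if "0 < t" "t < 1" for t
      unfolding eq using pm(1)[OF p td[OF that]] .
    show "continuous_on {0..1} (\<lambda>t. 2 * sqrt (A * \<delta>) * sqrt t)" by (intro continuous_intros)
    show "((\<lambda>t. 2 * sqrt (A * \<delta>) * sqrt t) has_real_derivative sqrt (A * \<delta>) / sqrt t) (at t)" if "t \<in> {0<..<1}" for t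
      using that by (auto intro!: derivative_eq_intros simp: field_simps)
    show "speed (linepath p (pull \<delta> x0 p) t) (pull \<delta> x0 p - p) \<le> sqrt (A * \<delta>) / sqrt t" if t: "0 < t" "t < 1" for t
    proof -
      have a0: "ang (pull \<delta> x0 p - p) = 0" by (simp add: ang_diff ang_pull)
      have m: "mom (pull \<delta> x0 p - p) = \<delta> *\<^sub>R (x0 - mom p)" by (simp add: mom_diff mom_pull algebra_simps)
      have "\<bar>(x0 - mom p) $ 1\<bar> \<le> \<rho>" "\<bar>(x0 - mom p) $ 2\<bar> \<le> \<rho>"
        using P p(2) \<rho> a_pos by (auto simp: x0_def rad_def abs_le_iff field_simps)
      then have "((x0 - mom p) $ 1)\<^sup>2 \<le> \<rho>\<^sup>2" "((x0 - mom p) $ 2)\<^sup>2 \<le> \<rho>\<^sup>2" by (auto intro: power2_le_iff_abs_le[THEN iffD2] simp: abs_le_square_iff[symmetric])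
      then have "(norm (x0 - mom p))\<^sup>2 \<le> \<rho>\<^sup>2 + \<rho>\<^sup>2" unfolding norm2_sq by (rule add_mono)
      also have "\<dots> \<le> (2 * \<rho>)\<^sup>2" by (simp add: power2_eq_square)
      finally have "(norm (x0 - mom p))\<^sup>2 \<le> (2 * \<rho>)\<^sup>2" .
      then have n: "(norm (mom (pull \<delta> x0 p - p)))\<^sup>2 \<le> \<delta>\<^sup>2 * (2 * \<rho>)\<^sup>2"
        unfolding m by (simp add: power_mult_distrib mult_left_mono)
      have "speed (linepath p (pull \<delta> x0 p) t) (pull \<delta> x0 p - p)
        \<le> sqrt (B / (t * \<delta> * \<eta>) * (norm (mom (pull \<delta> x0 p - p)))\<^sup>2 + B * (norm (ang (pull \<delta> x0 p - p)))\<^sup>2)"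
        unfolding eq by (rule B(2)) (use pm[OF p td[OF t]] td[OF t] \<eta> in auto)
      also have "\<dots> \<le> sqrt (B / (t * \<delta> * \<eta>) * (\<delta>\<^sup>2 * (2 * \<rho>)\<^sup>2))"
      proof (rule real_sqrt_le_mono)
        have "B / (t * \<delta> * \<eta>) * (norm (mom (pull \<delta> x0 p - p)))\<^sup>2 \<le> B / (t * \<delta> * \<eta>) * (\<delta>\<^sup>2 * (2 * \<rho>)\<^sup>2)"
          by (rule mult_left_mono[OF n]) (use B(1) \<eta>(1) \<delta> t in simp)
        then show "B / (t * \<delta> * \<eta>) * (norm (mom (pull \<delta> x0 p - p)))\<^sup>2 + B * (norm (ang (pull \<delta> x0 p - p)))\<^sup>2
          \<le> B / (t * \<delta> * \<eta>) * (\<delta>\<^sup>2 * (2 * \<rho>)\<^sup>2)" unfolding a0 by simp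
      qed
      also have "B / (t * \<delta> * \<eta>) * (\<delta>\<^sup>2 * (2 * \<rho>)\<^sup>2) = A * \<delta> / t"
        using \<delta> t \<eta> by (simp add: A_def field_simps power2_eq_square)
      finally show ?thesis by (simp add: real_sqrt_divide)
    qed
    show "2 * sqrt (A * \<delta>) * sqrt 1 - 2 * sqrt (A * \<delta>) * sqrt 0 \<le> 2 * sqrt A * sqrt \<delta>"
      by (simp add: real_sqrt_mult)
    show "0 \<le> 2 * sqrt A * sqrt \<delta>" using A \<delta> by simp
  qed
  show thesis
  proof (rule that[of "4 * sqrt A"])
    show "0 < 4 * sqrt A" using A by simp
    fix \<delta> :: real assume \<delta>: "0 < \<delta>" "\<delta> \<le> 1"
    \<comment> \<open>All points of the middle line are pulled by the same \<open>\<delta>\<close>,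
      so there the metric is at most \<open>K\<^sup>2\<close> times the Euclidean one.
      \<open>K\<close> depends on \<open>\<delta>\<close> and is unbounded as
      \<open>\<delta>\<close> tends to 0.\<close>
    define K where "K = sqrt (B / (\<delta> * \<eta>) + B)"
    have K: "0 \<le> K" unfolding K_def using B \<eta> \<delta> by simp
    have "joined p q (4 * sqrt A * sqrt \<delta> + K * norm (q - p))"
      if p: "mom p \<in> Pol" "rad (mom p) \<le> \<rho>" and q: "mom q \<in> Pol" "rad (mom q) \<le> \<rho>" for p q
    proof -
      let ?p = "pull \<delta> x0 p" and ?q = "pull \<delta> x0 q"
      have lp: "mom (linepath ?p ?q t) \<in> MI" "speed (linepath ?p ?q t) (?q - ?p) \<le> K * norm (q - p)" if t: "0 < t" "t < 1" for t
      proof -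
        let ?s = "linepath p q t"
        have eq: "linepath ?p ?q t = pull \<delta> x0 ?s"
          by (rule coords_eqI) (simp_all add: mom_linepath ang_linepath mom_pull ang_pull algebra_simps)
        have P: "0 \<le> mom p $ 1" "0 \<le> mom p $ 2" "a \<le> rad (mom p)" "0 \<le> mom q $ 1" "0 \<le> mom q $ 2" "a \<le> rad (mom q)"
          using PolD[OF p(1)] PolD[OF q(1)] by auto
        have r: "rad (mom ?s) = (1 - t) * rad (mom p) + t * rad (mom q)" by (simp add: mom_linepath rad_add rad_scaleR)
        have r1: "rad (mom ?s) \<le> \<rho>" unfolding r using p q t by (intro convex_bound_le) auto
        have "(1 - t) * a + t * a \<le> rad (mom ?s)" unfolding r using P t by (intro add_mono mult_left_mono) auto
        then have r2: "a \<le> rad (mom ?s)" by (simp add: algebra_simps)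
        have s: "mom ?s \<in> Pol" using P t r1 r2 D_down[OF \<rho>(1)] by (auto simp: mom_polygon_def mom_linepath)
        show "mom (linepath ?p ?q t) \<in> MI" unfolding eq by (rule pm(1)[OF s r1 \<delta>])
        have "speed (linepath ?p ?q t) (?q - ?p) \<le> sqrt (B / (\<delta> * \<eta>) * (norm (mom (?q - ?p)))\<^sup>2 + B * (norm (ang (?q - ?p)))\<^sup>2)"
          unfolding eq by (rule B(2)) (use pm[OF s r1 \<delta>] \<delta> \<eta> in auto)
        also have "\<dots> \<le> sqrt ((B / (\<delta> * \<eta>) + B) * (norm (?q - ?p))\<^sup>2)"
          using B(1) \<delta> \<eta>(1) unfolding norm_coords_sq[of "?q - ?p"] by (intro real_sqrt_le_mono) (auto simp: algebra_simps)
        also have "\<dots> = K * norm (?q - ?p)" by (simp add: K_def real_sqrt_mult)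
        also have "\<dots> \<le> K * norm (q - p)" using K norm_pull_le \<delta> by (intro mult_left_mono) auto
        finally show "speed (linepath ?p ?q t) (?q - ?p) \<le> K * norm (q - p)" .
      qed
      have "joined ?p ?q (K * norm (q - p))"
        by (rule joined_linepath[where \<psi> = "\<lambda>t. K * norm (q - p) * t" and \<psi>' = "\<lambda>t. K * norm (q - p)"])
           (use pm(1)[OF p \<delta>] pm(1)[OF q \<delta>] MI_Pol lp K in \<open>auto intro!: derivative_eq_intros continuous_intros\<close>)
      then have "joined p q (2 * sqrt A * sqrt \<delta> + K * norm (q - p) + 2 * sqrt A * sqrt \<delta>)"
        using joined_trans[OF joined_trans[OF spoke[OF p \<delta>]] joined_sym[OF spoke[OF q \<delta>]]] by blast
      then show ?thesis by (simp add: algebra_simps)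
    qed
    then show "\<exists>K\<ge>0. \<forall>p q. mom p \<in> Pol \<longrightarrow> rad (mom p) \<le> \<rho> \<longrightarrow>
      mom q \<in> Pol \<longrightarrow> rad (mom q) \<le> \<rho> \<longrightarrow> joined p q (4 * sqrt A * sqrt \<delta> + K * norm (q - p))"
      using K by blast
  qed
qed

end

text \<open>The coefficients of the metric are only bounded for \<open>r \<le> \<rho>\<close>; this factor turns local gradient bounds into
  global ones.\<close>

definition cutoff :: "real \<Rightarrow> real \<Rightarrow> real" where
  "cutoff \<rho> r = (max 0 (\<rho> - r))\<^sup>2"

text \<open>The square makes the function differentiable also at \<open>r = \<rho>\<close>.\<close>

lemma cutoff_deriv: "(cutoff \<rho> has_real_derivative - 2 * max 0 (\<rho> - r)) (at r)"
proof -
  consider "r < \<rho>" | "\<rho> < r" | "r = \<rho>" by linarith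
  then show ?thesis
  proof cases
    case 1
    have "((\<lambda>r. (\<rho> - r)\<^sup>2) has_real_derivative - 2 * max 0 (\<rho> - r)) (at r)"
      using 1 by (auto intro!: derivative_eq_intros)
    then show ?thesis
      by (rule has_field_derivative_transform_within_open[of _ _ _ "{..<\<rho>}"]) (use 1 in \<open>auto simp: cutoff_def\<close>)
  next
    case 2
    have "((\<lambda>r. 0) has_real_derivative - 2 * max 0 (\<rho> - r)) (at r)" using 2 by auto
    then show ?thesis
      by (rule has_field_derivative_transform_within_open[of _ _ _ "{\<rho><..}"]) (use 2 in \<open>auto simp: cutoff_def\<close>)
  next
    case 3
    have "((\<lambda>h. (cutoff \<rho> (\<rho> + h) - cutoff \<rho> \<rho>) / h) \<longlongrightarrow> 0) (at 0)"
    proof (rule Lim_null_comparison[where g = "\<lambda>h. \<bar>h\<bar>"])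
      show "\<forall>\<^sub>F h in at 0. norm ((cutoff \<rho> (\<rho> + h) - cutoff \<rho> \<rho>) / h) \<le> \<bar>h\<bar>"
        by (rule eventuallyI) (auto simp: cutoff_def max_def power2_eq_square)
      show "((\<lambda>h. \<bar>h\<bar>) \<longlongrightarrow> 0) (at (0::real))" by (intro tendsto_eq_intros) auto
    qed
    then show ?thesis using 3 by (simp add: DERIV_def)
  qed
qed

lemma cutoff_bounds: assumes "0 \<le> r" "0 < \<rho>"
  shows "0 \<le> cutoff \<rho> r" "cutoff \<rho> r \<le> \<rho>\<^sup>2" "\<bar>- 2 * max 0 (\<rho> - r)\<bar> \<le> 2 * \<rho>"
  using assms by (auto simp: cutoff_def max_def power_mono)

lemma cis_add_2pi_int: "cis (x + 2 * pi * of_int n) = cis x"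
  by (simp add: cis_mult[symmetric] cis_multiple_2pi)

lemma cis_eqD: assumes "cis x = cis y" obtains n :: int where "x = y + 2 * pi * of_int n"
proof -
  have "cos x = cos y" "sin x = sin y" using assms by (auto simp: complex_eq_iff)
  then show thesis using that sin_cos_eq_iff[of x y] by auto
qed

section \<open>Finiteness, triangle inequality and Lipschitz bounds for the distance\<close>

context U2_domain
begin

lemma D_bigger: assumes "r \<in> D" obtains \<rho> where "\<rho> \<in> D" "r < \<rho>" "a < \<rho>"
proof (cases "r = a")
  case True then show thesis using D_more that by auto
next
  case False
  then have "r \<in> interior D" using assms by (simp add: int_D)
  then obtain e where e: "0 < e" "ball r e \<subseteq> interior D" using open_contains_ball[of "interior D"] by auto
  have "r + e / 2 \<in> interior D" using e by (auto simp: dist_real_def)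
  then show thesis using that[of "r + e / 2"] e D_ge[OF assms] by (simp add: int_D)
qed

text \<open>Finite length matters: \<open>enn2real\<close> sends an infinite infimum to \<open>0\<close>.\<close>

lemma joined_ex: assumes "mom p \<in> Pol" "mom q \<in> Pol" shows "\<exists>L. joined p q L"
proof -
  have "rad (mom p) \<in> D" "rad (mom q) \<in> D" using assms PolD by auto
  then have "max (rad (mom p)) (rad (mom q)) \<in> D" by (simp add: max_def)
  then obtain \<rho> where \<rho>: "\<rho> \<in> D" "max (rad (mom p)) (rad (mom q)) < \<rho>" "a < \<rho>" by (rule D_bigger)
  show ?thesis using joined_bound[OF \<rho>(1,3)] assms \<rho>(2)
    by (metis less_imp_le max_less_iff_conj zero_less_one order_refl)
qed

lemma dst_le: assumes "joined p q L" shows "dst (pt p) (pt q) \<le> L"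
proof -
  obtain \<gamma>s where \<gamma>s: "jn (pt p) \<gamma>s (pt q)" "len \<gamma>s \<le> ennreal L" and L: "0 \<le> L"
    using assms unfolding joined_def by blast
  have "(INF \<gamma>s\<in>{\<gamma>s. jn (pt p) \<gamma>s (pt q)}. len \<gamma>s) \<le> ennreal L"
    using \<gamma>s by (intro INF_lower2[of \<gamma>s]) auto
  then show ?thesis unfolding riem_dist_def by (rule enn2real_leI[OF L])
qed

lemma dst_nonneg: "0 \<le> dst A B"
  unfolding riem_dist_def by simp

text \<open>Near-optimal curves exist because the infimum is finite, so that \<open>enn2real\<close>
  loses nothing.\<close>

lemma joined_dst: assumes "mom p \<in> Pol" "mom q \<in> Pol" "0 < \<epsilon>" shows "joined p q (dst (pt p) (pt q) + \<epsilon>)"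
proof -
  let ?I = "INF \<gamma>s\<in>{\<gamma>s. jn (pt p) \<gamma>s (pt q)}. len \<gamma>s"
  obtain L \<gamma>s where "jn (pt p) \<gamma>s (pt q)" "len \<gamma>s \<le> ennreal L"
    using joined_ex[OF assms(1,2)] unfolding joined_def by blast
  then have "?I \<le> ennreal L" by (intro INF_lower2[of \<gamma>s]) auto
  then have fin: "?I < top" using ennreal_less_top le_less_trans by blast
  then have "?I < ennreal (dst (pt p) (pt q) + \<epsilon>)"
    unfolding riem_dist_def using assms(3) by (cases ?I) (auto simp: ennreal_less_iff)
  then obtain \<delta>s where "jn (pt p) \<delta>s (pt q)" "len \<delta>s < ennreal (dst (pt p) (pt q) + \<epsilon>)"
    by (auto simp: INF_less_iff)
  then show ?thesis unfolding joined_def using assms(3) dst_nonneg[of "pt p" "pt q"] by (auto intro: less_imp_le)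
qed

lemma lip_dst:
  assumes L: "lip K \<Phi>" and p: "mom p \<in> Pol" "mom q \<in> Pol"
  shows "norm (\<Phi> p - \<Phi> q) \<le> K * dst (pt p) (pt q)"
proof -
  have K: "0 < K" using L by (simp add: lip_def)
  have "norm (\<Phi> p - \<Phi> q) / K \<le> dst (pt p) (pt q)"
  proof (rule field_le_epsilon)
    fix \<epsilon> :: real assume "0 < \<epsilon>"
    from joined_dst[OF p this] obtain \<gamma>s where g: "jn (pt p) \<gamma>s (pt q)" "len \<gamma>s \<le> ennreal (dst (pt p) (pt q) + \<epsilon>)"
      "0 \<le> dst (pt p) (pt q) + \<epsilon>"
      unfolding joined_def by blast
    have "ennreal (norm (\<Phi> p - \<Phi> q)) \<le> ennreal K * ennreal (dst (pt p) (pt q) + \<epsilon>)"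
      using lip_joins[OF L g(1) p(1)] g(2) by (meson mult_left_mono order_trans zero_le)
    also have "\<dots> = ennreal (K * (dst (pt p) (pt q) + \<epsilon>))" using K g(3) by (simp add: ennreal_mult)
    finally have "norm (\<Phi> p - \<Phi> q) \<le> K * (dst (pt p) (pt q) + \<epsilon>)"
      using K g(3) by (subst (asm) ennreal_le_iff) auto
    then show "norm (\<Phi> p - \<Phi> q) / K \<le> dst (pt p) (pt q) + \<epsilon>" using K by (simp add: field_simps)
  qed
  then show ?thesis using K by (simp add: field_simps)
qed

lemma dst_triangle: assumes "mom p \<in> Pol" "mom q \<in> Pol" "mom s \<in> Pol"
  shows "dst (pt p) (pt s) \<le> dst (pt p) (pt q) + dst (pt q) (pt s)"
proof (rule field_le_epsilon)
  fix \<epsilon> :: real assume e: "0 < \<epsilon>"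
  have "dst (pt p) (pt s) \<le> (dst (pt p) (pt q) + \<epsilon> / 2) + (dst (pt q) (pt s) + \<epsilon> / 2)"
    by (rule dst_le[OF joined_trans[OF joined_dst joined_dst]]) (use assms e in auto)
  then show "dst (pt p) (pt s) \<le> dst (pt p) (pt q) + dst (pt q) (pt s) + \<epsilon>" by (simp add: field_simps)
qed

text \<open>The gradients of \<open>r\<close>, \<open>x_1\<close>, \<open>x_2\<close> have as
  squared norm \<open>quadH\<close> of a constant covector, and \<open>quadH\<close> contains
  \<open>f\<close> but not \<open>F\<close>; hence the bound is uniform up to the edges.\<close>

lemma momentum_le_speed:
  assumes \<rho>: "\<rho> \<in> D"
  obtains K where "0 < K" "\<And>p v. mom p \<in> MI \<Longrightarrow> rad (mom p) \<le> \<rho> \<Longrightarrow>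
    \<bar>rad (mom v)\<bar> \<le> K * speed p v \<and> \<bar>mom v $ 1\<bar> \<le> K * speed p v \<and> \<bar>mom v $ 2\<bar> \<le> K * speed p v"
proof -
  obtain B where B: "\<And>r. a < r \<Longrightarrow> r \<le> \<rho> \<Longrightarrow> \<bar>f r\<bar> \<le> B"
    using bounds[OF \<rho>] by blast
  have \<rho>0: "0 < \<rho>" using D_ge[OF \<rho>] a_pos by simp
  define K where "K = 2 * (\<rho> + \<bar>B\<bar> * \<rho>\<^sup>2)"
  have K: "0 < K" unfolding K_def using \<rho>0 by (simp add: add_pos_nonneg)
  have key: "\<bar>k $ 1 * mom v $ 1 + k $ 2 * mom v $ 2\<bar> \<le> sqrt K * speed p v"
    if p: "mom p \<in> MI" "rad (mom p) \<le> \<rho>" and k: "k $ 1 = 0 \<or> k $ 1 = 1" "k $ 2 = 0 \<or> k $ 2 = 1" for p v and k :: "real^2"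
  proof -
    define x y r where "x = mom p $ 1" "y = mom p $ 2" "r = rad (mom p)"
    note d = this
    have xy: "0 < x" "0 < y" "r = x + y" "a < r" "r \<le> \<rho>"
      using p by (auto simp: d MI_iff rad_def)
    \<comment> \<open>Entries 0 and 1 equal their squares, so both parts of \<open>quadH\<close> are
      expressed through the single number \<open>z\<close>.\<close>
    define z where "z = x * k $ 1 + y * k $ 2"
    have z: "0 \<le> z" "z \<le> \<rho>" "x * (k $ 1)\<^sup>2 + y * (k $ 2)\<^sup>2 = z" unfolding z_def using xy k by auto
    have "\<bar>f r\<bar> * z\<^sup>2 \<le> \<bar>B\<bar> * \<rho>\<^sup>2"
      using B[of r] xy z by (intro mult_mono power_mono) auto
    then have "- f r * z\<^sup>2 \<le> \<bar>B\<bar> * \<rho>\<^sup>2"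
      using mult_right_mono[OF abs_ge_minus_self[of "f r"], of "z\<^sup>2"] by simp
    then have H: "quadH (mom p) k \<le> K"
      unfolding quadH_def d[symmetric] z(3) K_def z_def[symmetric] using z(2) by (simp add: algebra_simps)
    have G: "0 \<le> quadG (mom p) (mom v)" "0 \<le> quadH (mom p) (ang v)"
      using p by (auto intro: quadG_nonneg quadH_nonneg MI_pos_over)
    have "(k $ 1 * mom v $ 1 + k $ 2 * mom v $ 2)\<^sup>2 \<le> quadH (mom p) k * quadG (mom p) (mom v)"
      by (rule pairing_le[OF MI_pos_over[OF p(1)]])
    also have "\<dots> \<le> K * (quadG (mom p) (mom v) + quadH (mom p) (ang v))"
      using H G K by (intro mult_mono) auto
    finally have "sqrt ((k $ 1 * mom v $ 1 + k $ 2 * mom v $ 2)\<^sup>2) \<le> sqrt (K * (quadG (mom p) (mom v) + quadH (mom p) (ang v)))"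
      by (rule real_sqrt_le_mono)
    then show ?thesis by (simp add: real_sqrt_mult speed_eq[OF p(1)])
  qed
  show thesis
  proof (rule that[of "sqrt K"])
    show "0 < sqrt K" using K by simp
    fix p v assume p: "mom p \<in> MI" "rad (mom p) \<le> \<rho>"
    show "\<bar>rad (mom v)\<bar> \<le> sqrt K * speed p v \<and> \<bar>mom v $ 1\<bar> \<le> sqrt K * speed p v \<and> \<bar>mom v $ 2\<bar> \<le> sqrt K * speed p v"
      using key[OF p, of "\<chi> i. 1" v] key[OF p, of "axis 1 1" v] key[OF p, of "axis 2 1" v]
      by (simp add: axis_def rad_def)
  qed
qed

text \<open>The same duality with the two blocks exchanged. The factor \<open>quadG\<close> is
  unbounded near the edges, so functions of the angles need damping.\<close>

lemma angle_le_speed: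
  assumes p: "mom p \<in> MI"
  shows "(k $ 1 * ang v $ 1 + k $ 2 * ang v $ 2)\<^sup>2 \<le> quadG (mom p) k * (speed p v)\<^sup>2"
proof -
  have G: "0 \<le> quadG (mom p) (mom v)" "0 \<le> quadH (mom p) (ang v)" "0 \<le> quadG (mom p) k"
    using p by (auto intro: quadG_nonneg quadH_nonneg MI_pos_over)
  have "(k $ 1 * ang v $ 1 + k $ 2 * ang v $ 2)\<^sup>2 \<le> quadH (mom p) (ang v) * quadG (mom p) k"
    using pairing_le[OF MI_pos_over[OF p], of "ang v" k] by (simp add: mult.commute)
  also have "\<dots> \<le> (quadG (mom p) (mom v) + quadH (mom p) (ang v)) * quadG (mom p) k"
    using G by (intro mult_right_mono) auto
  finally show ?thesis using G by (simp add: speed_eq[OF p] mult.commute)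
qed

text \<open>A character of the torus becomes Lipschitz after multiplication by a function
  \<open>\<mu>\<close> of the momenta that vanishes where the angle degenerates: the third bound
  asks \<open>\<mu>\<^sup>2\<close> to absorb the blow-up of the gradient of the phase.\<close>

lemma lip_cutoff:
  fixes k :: "real^2" and \<mu> :: "real^2 \<Rightarrow> real"
  assumes \<rho>: "\<rho> \<in> D"
    and \<mu>: "\<And>x. (\<mu> has_derivative \<mu>' x) (at x)"
    and K: "0 \<le> K"
    and b: "\<And>x. x \<in> MI \<Longrightarrow> rad x \<le> \<rho> \<Longrightarrow> \<bar>\<mu> x\<bar> \<le> K"
       "\<And>x v. x \<in> MI \<Longrightarrow> rad x \<le> \<rho> \<Longrightarrow> \<bar>\<mu>' x v\<bar> \<le> K * (\<bar>v $ 1\<bar> + \<bar>v $ 2\<bar>)"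
       "\<And>x. x \<in> MI \<Longrightarrow> rad x \<le> \<rho> \<Longrightarrow> (\<mu> x)\<^sup>2 * quadG x k \<le> K\<^sup>2"
    and inv: "\<And>p q. mom p \<in> Pol \<Longrightarrow> q \<in> pt p \<Longrightarrow> \<mu> (mom p) \<noteq> 0 \<Longrightarrow>
       cis (k $ 1 * ang q $ 1 + k $ 2 * ang q $ 2) = cis (k $ 1 * ang p $ 1 + k $ 2 * ang p $ 2)"
  obtains K' where "lip K' (\<lambda>p. of_real (cutoff \<rho> (rad (mom p)) * \<mu> (mom p)) * cis (k $ 1 * ang p $ 1 + k $ 2 * ang p $ 2))"
proof -
  obtain M where M: "0 < M" "\<And>p v. mom p \<in> MI \<Longrightarrow> rad (mom p) \<le> \<rho> \<Longrightarrow>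
    \<bar>rad (mom v)\<bar> \<le> M * speed p v \<and> \<bar>mom v $ 1\<bar> \<le> M * speed p v \<and> \<bar>mom v $ 2\<bar> \<le> M * speed p v"
    using momentum_le_speed[OF \<rho>] by blast
  have \<rho>0: "0 < \<rho>" using D_ge[OF \<rho>] a_pos by simp
  define \<kappa> where "\<kappa> = (\<lambda>p::coords. k $ 1 * ang p $ 1 + k $ 2 * ang p $ 2)"
  have lk: "bounded_linear \<kappa>"
    unfolding \<kappa>_def ang_nth
    by (intro linear_conv_bounded_linear[THEN iffD1]) (auto simp: linear_iff algebra_simps)
  \<comment> \<open>The three products come from the derivatives of the cutoff, of
    \<open>\<mu>\<close> and of the phase; the summand 1 makes \<open>K'\<close> positive.\<close>
  define K' where "K' = 1 + (2 * \<rho> * M * K + \<rho>\<^sup>2 * (K * (2 * M)) + \<rho>\<^sup>2 * K)"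
  have K': "0 < K'" unfolding K'_def using \<rho>0 M K by (simp add: add_pos_nonneg)
  let ?\<Phi> = "\<lambda>p. of_real (cutoff \<rho> (rad (mom p)) * \<mu> (mom p)) * cis (\<kappa> p)"
  have "lip K' ?\<Phi>"
    unfolding lip_def
  proof (intro conjI allI impI)
    show "0 < K'" by (rule K')
    have c\<mu>: "continuous_on UNIV \<mu>" using \<mu> by (meson continuous_at_imp_continuous_on has_derivative_continuous)
    have cc: "continuous_on UNIV (cutoff \<rho>)" unfolding cutoff_def by (intro continuous_intros)
    have cis: "continuous_on UNIV cis" unfolding cis_conv_exp[abs_def] by (intro continuous_intros)
    show "continuous_on {p. mom p \<in> Pol} ?\<Phi>"
      by (intro continuous_intros continuous_on_compose2[OF cc] continuous_on_compose2[OF c\<mu>] continuous_on_compose2[OF cis]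
          bounded_linear.continuous_on[OF lk]) auto
    show "?\<Phi> q = ?\<Phi> p" if "mom p \<in> Pol" "q \<in> pt p" for p q
      using inv[OF that] that(2) by (cases "\<mu> (mom p) = 0") (auto simp: point_of_iff \<kappa>_def)
  next
    fix p assume p: "mom p \<in> MI"
    let ?r = "rad (mom p)"
    let ?c = "cutoff \<rho> ?r" and ?c' = "- 2 * max 0 (\<rho> - ?r)"
    have D1: "((\<lambda>p. cutoff \<rho> (rad (mom p))) has_derivative (\<lambda>v. ?c' * rad (mom v))) (at p)"
      using has_derivative_compose[OF bounded_linear_imp_has_derivative[OF bounded_linear_compose[OF bounded_linear_rad bounded_linear_mom]]
          cutoff_deriv[unfolded has_field_derivative_def]] by blast
    have D2: "((\<lambda>p. \<mu> (mom p)) has_derivative (\<lambda>v. \<mu>' (mom p) (mom v))) (at p)"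
      by (rule has_derivative_compose[OF bounded_linear_imp_has_derivative[OF bounded_linear_mom] \<mu>])
    have "(cis has_vector_derivative (\<i> * cis t)) (at t)" for t
      unfolding cis_conv_exp[abs_def] by (auto intro!: derivative_eq_intros has_vector_derivative_real_field)
    then have D3: "((\<lambda>p. cis (\<kappa> p)) has_derivative (\<lambda>v. \<kappa> v *\<^sub>R (\<i> * cis (\<kappa> p)))) (at p)"
      using has_derivative_compose[OF bounded_linear_imp_has_derivative[OF lk]]
      unfolding has_vector_derivative_def by blast
    define \<Phi>' where "\<Phi>' = (\<lambda>v. of_real (?c * \<mu> (mom p)) * (\<kappa> v *\<^sub>R (\<i> * cis (\<kappa> p)))
        + of_real (?c * \<mu>' (mom p) (mom v) + ?c' * rad (mom v) * \<mu> (mom p)) * cis (\<kappa> p))"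
    have D: "(?\<Phi> has_derivative \<Phi>') (at p)"
      unfolding \<Phi>'_def
      by (rule has_derivative_mult[OF has_derivative_of_real[OF has_derivative_mult[OF D1 D2]] D3])
    have "norm (\<Phi>' v) \<le> K' * speed p v" for v
    proof (cases "?r \<le> \<rho>")
      case False
      then have "\<Phi>' v = 0" by (simp add: \<Phi>'_def cutoff_def)
      then show ?thesis using speed_nonneg[OF p, of v] K' by simp
    next
      case True
      have s: "0 \<le> speed p v" by (rule speed_nonneg[OF p])
      have r: "0 \<le> ?r" using p a_pos by (auto simp: MI_iff)
      note cb = cutoff_bounds[OF r \<rho>0]
      note m = M(2)[OF p True, of v] and bb = b[OF p True]
      have "(\<mu> (mom p) * \<kappa> v)\<^sup>2 = (\<mu> (mom p))\<^sup>2 * (\<kappa> v)\<^sup>2" by (simp add: power_mult_distrib)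
      also have "\<dots> \<le> (\<mu> (mom p))\<^sup>2 * (quadG (mom p) k * (speed p v)\<^sup>2)"
        unfolding \<kappa>_def by (intro mult_left_mono angle_le_speed[OF p]) auto
      also have "\<dots> = ((\<mu> (mom p))\<^sup>2 * quadG (mom p) k) * (speed p v)\<^sup>2" by simp
      also have "\<dots> \<le> K\<^sup>2 * (speed p v)\<^sup>2" using bb(3) by (intro mult_right_mono) auto
      finally have "(\<mu> (mom p) * \<kappa> v)\<^sup>2 \<le> (K * speed p v)\<^sup>2" by (simp add: power_mult_distrib)
      then have 1: "\<bar>\<mu> (mom p) * \<kappa> v\<bar> \<le> K * speed p v" using K s by (simp add: abs_le_square_iff[symmetric])
      have 2: "\<bar>\<mu>' (mom p) (mom v)\<bar> \<le> K * (2 * M) * speed p v"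
      proof -
        have "\<bar>mom v $ 1\<bar> + \<bar>mom v $ 2\<bar> \<le> 2 * M * speed p v" using m by (simp add: algebra_simps)
        then have "K * (\<bar>mom v $ 1\<bar> + \<bar>mom v $ 2\<bar>) \<le> K * (2 * M * speed p v)" using K by (rule mult_left_mono)
        then show ?thesis using bb(2)[of "mom v"] by (simp add: mult.assoc)
      qed
      have "norm (\<Phi>' v) \<le> ?c * \<bar>\<mu> (mom p) * \<kappa> v\<bar> + (?c * \<bar>\<mu>' (mom p) (mom v)\<bar> + \<bar>?c'\<bar> * \<bar>rad (mom v)\<bar> * \<bar>\<mu> (mom p)\<bar>)"
      proof -
        define X where "X = ?c * \<mu>' (mom p) (mom v) + ?c' * rad (mom v) * \<mu> (mom p)"
        have "\<bar>X\<bar> \<le> \<bar>?c * \<mu>' (mom p) (mom v)\<bar> + \<bar>?c' * rad (mom v) * \<mu> (mom p)\<bar>"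
          unfolding X_def by (rule abs_triangle_ineq)
        then have X: "\<bar>X\<bar> \<le> ?c * \<bar>\<mu>' (mom p) (mom v)\<bar> + \<bar>?c'\<bar> * \<bar>rad (mom v)\<bar> * \<bar>\<mu> (mom p)\<bar>"
          using cb(1) by (simp only: abs_mult abs_of_nonneg)
        have "norm (\<Phi>' v) \<le> norm (of_real (?c * \<mu> (mom p)) * (\<kappa> v *\<^sub>R (\<i> * cis (\<kappa> p)))) + norm (of_real X * cis (\<kappa> p))"
          unfolding \<Phi>'_def X_def by (rule norm_triangle_ineq)
        also have "\<dots> = ?c * \<bar>\<mu> (mom p) * \<kappa> v\<bar> + \<bar>X\<bar>" using cb(1) by (simp add: norm_mult abs_mult)
        finally show ?thesis using X by linarith
      qed
      also have "\<dots> \<le> \<rho>\<^sup>2 * (K * speed p v) + (\<rho>\<^sup>2 * (K * (2 * M) * speed p v) + 2 * \<rho> * (M * speed p v) * K)"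
        using cb 1 2 m bb(1) K s \<rho>0 M(1) by (intro add_mono mult_mono) auto
      also have "\<dots> = (K' - 1) * speed p v" by (simp add: K'_def algebra_simps)
      also have "\<dots> \<le> K' * speed p v" using s by (intro mult_right_mono) auto
      finally show ?thesis .
    qed
    then show "\<exists>\<Phi>'. (?\<Phi> has_derivative \<Phi>') (at p) \<and> (\<forall>v. norm (\<Phi>' v) \<le> K' * speed p v)"
      using D by blast
  qed
  then show thesis using that unfolding \<kappa>_def by blast
qed

end

section \<open>Functions that separate points; the distance is a metric\<close>

context U2_domain
begin

lemma kernelD:
  assumes "q \<in> pt p"
  obtains i j n :: int and s1 s2 s0 where "mom q = mom p"
    "ang q $ 1 - ang p $ 1 = 2 * pi * (of_int i + of_int n / real m) + s1 + s0 / real m"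
    "ang q $ 2 - ang p $ 2 = 2 * pi * (of_int j + of_int n / real m) + s2 + s0 / real m"
    "s1 \<noteq> 0 \<longrightarrow> mom p $ 1 = 0" "s2 \<noteq> 0 \<longrightarrow> mom p $ 2 = 0" "s0 \<noteq> 0 \<longrightarrow> rad (mom p) = a"
proof -
  have "mom q = mom p" "ang q - ang p \<in> angle_kernel m a (mom p)" using assms by (auto simp: point_of_iff)
  then obtain l s1 s2 s0 where 1: "l \<in> angle_lattice m" "s1 \<noteq> 0 \<longrightarrow> mom p $ 1 = 0" "s2 \<noteq> 0 \<longrightarrow> mom p $ 2 = 0"
    "s0 \<noteq> 0 \<longrightarrow> rad (mom p) = a"
    "ang q - ang p = (2 * pi) *\<^sub>R l + s1 *\<^sub>R axis 1 1 + s2 *\<^sub>R axis 2 1 + s0 *\<^sub>R (\<chi> _. 1 / real m)"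
    unfolding angle_kernel_def by auto
  obtain i j n :: int where l: "l = of_int i *\<^sub>R axis 1 1 + of_int j *\<^sub>R axis 2 1 + of_int n *\<^sub>R (\<chi> _. 1 / real m)"
    using 1(1) unfolding angle_lattice_def by auto
  have "ang q $ 1 - ang p $ 1 = 2 * pi * (of_int i + of_int n / real m) + s1 + s0 / real m"
    "ang q $ 2 - ang p $ 2 = 2 * pi * (of_int j + of_int n / real m) + s2 + s0 / real m"
    unfolding vector_minus_component[symmetric] 1(5) l by (simp_all add: axis_def)
  then show thesis by (rule that[OF \<open>mom q = mom p\<close> _ _ 1(2-4)])
qed

lemma kernelI:
  assumes "mom q = mom p"
    "ang q $ 1 - ang p $ 1 = 2 * pi * (of_int i + of_int n / real m) + s1 + s0 / real m"
    "ang q $ 2 - ang p $ 2 = 2 * pi * (of_int j + of_int n / real m) + s2 + s0 / real m"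
    "s1 \<noteq> 0 \<longrightarrow> mom p $ 1 = 0" "s2 \<noteq> 0 \<longrightarrow> mom p $ 2 = 0" "s0 \<noteq> 0 \<longrightarrow> rad (mom p) = a"
  shows "q \<in> pt p"
proof -
  have "of_int i *\<^sub>R axis 1 1 + of_int j *\<^sub>R axis 2 1 + of_int n *\<^sub>R (\<chi> _. 1 / real m) \<in> angle_lattice m"
    unfolding angle_lattice_def by blast
  then have "ang q - ang p \<in> angle_kernel m a (mom p)"
    by (rule angle_kernelI[where s\<^sub>1 = s1 and s\<^sub>2 = s2 and s\<^sub>0 = s0])
       (use assms in \<open>auto simp: vec_eq_iff forall_2 axis_def\<close>)
  then show ?thesis using assms(1) by (simp add: point_of_iff)
qed

lemma MI_le: assumes "x \<in> MI" "rad x \<le> \<rho>"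
  shows "0 < x $ i" "x $ i \<le> \<rho>" "0 < rad x" "0 < rad x - a" "rad x - a \<le> \<rho>" "0 < \<rho>"
  using assms a_pos exhaust_2[of i] by (auto simp: MI_iff rad_def)

lemma lip_rad:
  assumes \<rho>: "\<rho> \<in> D"
  obtains K where "lip K (\<lambda>p. complex_of_real (cutoff \<rho> (rad (mom p))))"
proof -
  obtain K where "lip K (\<lambda>p. of_real (cutoff \<rho> (rad (mom p)) * 1) * cis ((0::real^2) $ 1 * ang p $ 1 + (0::real^2) $ 2 * ang p $ 2))"
    by (rule lip_cutoff[OF \<rho>, of "\<lambda>_. 1" "\<lambda>_ _. 0" 1 0]) (auto simp: quadG_def)
  then show thesis using that by simp
qed

lemma lip_x1:
  assumes \<rho>: "\<rho> \<in> D"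
  obtains K where "lip K (\<lambda>p. complex_of_real (cutoff \<rho> (rad (mom p)) * mom p $ 1))"
proof -
  have \<rho>0: "0 < \<rho>" using D_ge[OF \<rho>] a_pos by simp
  obtain K where "lip K (\<lambda>p. of_real (cutoff \<rho> (rad (mom p)) * mom p $ 1) * cis ((0::real^2) $ 1 * ang p $ 1 + (0::real^2) $ 2 * ang p $ 2))"
  proof (rule lip_cutoff[OF \<rho>, of "\<lambda>x. x $ 1" "\<lambda>_ v. v $ 1" "1 + \<rho>" 0])
    show "((\<lambda>x. x $ 1) has_derivative (\<lambda>v. v $ 1)) (at x)" for x :: "real^2"
      by (rule bounded_linear_imp_has_derivative[OF bounded_linear_vec_nth])
    show "\<bar>x $ 1\<bar> \<le> 1 + \<rho>" if "x \<in> MI" "rad x \<le> \<rho>" for x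
      using MI_le(1,2)[OF that, of 1] by simp
    show "\<bar>v $ 1\<bar> \<le> (1 + \<rho>) * (\<bar>v $ 1\<bar> + \<bar>v $ 2\<bar>)" for v :: "real^2"
      using mult_mono[of 1 "1 + \<rho>" "\<bar>v $ 1\<bar>" "\<bar>v $ 1\<bar> + \<bar>v $ 2\<bar>"] \<rho>0 by simp
  qed (use \<rho>0 in \<open>auto simp: quadG_def\<close>)
  then show thesis using that by simp
qed

text \<open>The characters of the torus that survive the lattice quotient are generated by \<open>\<theta>\<^sub>1 - \<theta>\<^sub>2\<close> and \<open>m \<theta>\<^sub>i\<close>. Each is
  multiplied by a function vanishing on the edges where it is not defined.\<close>

lemma lip_x1x2:
  assumes \<rho>: "\<rho> \<in> D"
  obtains K where "lip K (\<lambda>p. complex_of_real (cutoff \<rho> (rad (mom p)) * (mom p $ 1 * mom p $ 2)) * cis (ang p $ 1 - ang p $ 2))"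
proof -
  have \<rho>0: "0 < \<rho>" using D_ge[OF \<rho>] a_pos by simp
  define k :: "real^2" where "k = (\<chi> i. if i = 1 then 1 else -1)"
  define K where "K = 1 + \<rho> + \<rho> * \<rho> + \<rho> * \<rho> * \<rho>"
  have K: "\<rho> \<le> K" "\<rho> * \<rho> \<le> K" "\<rho> * \<rho> * \<rho> \<le> K" "1 \<le> K" using \<rho>0 by (auto simp: K_def)
  obtain K' where "lip K' (\<lambda>p. of_real (cutoff \<rho> (rad (mom p)) * (mom p $ 1 * mom p $ 2)) * cis (k $ 1 * ang p $ 1 + k $ 2 * ang p $ 2))"
  proof (rule lip_cutoff[OF \<rho>, of "\<lambda>x. x $ 1 * x $ 2" "\<lambda>x v. x $ 1 * v $ 2 + v $ 1 * x $ 2" K k])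
    show "((\<lambda>x. x $ 1 * x $ 2) has_derivative (\<lambda>v. x $ 1 * v $ 2 + v $ 1 * x $ 2)) (at x)" for x :: "real^2"
      by (rule has_derivative_mult; rule bounded_linear_imp_has_derivative[OF bounded_linear_vec_nth])
    show "0 \<le> K" using K by simp
    fix x :: "real^2" assume x: "x \<in> MI" "rad x \<le> \<rho>"
    note b = MI_le[OF x]
    have "x $ 1 * x $ 2 \<le> \<rho> * \<rho>" using b(1)[of 1] b(1)[of 2] b(2)[of 1] b(2)[of 2] by (intro mult_mono) auto
    then show "\<bar>x $ 1 * x $ 2\<bar> \<le> K" using K b(1)[of 1] b(1)[of 2] by simp
    \<comment> \<open>For the covector \<open>(1, -1)\<close> the term with \<open>F\<close> drops
      out, so no factor \<open>r - a\<close> is needed and this character survives on the zero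
      section.\<close>
    have q: "quadG x k = (1 / x $ 1 + 1 / x $ 2) / 2" by (simp add: quadG_def k_def)
    have "(x $ 1 * x $ 2)\<^sup>2 * quadG x k = (x $ 1 * x $ 2) * rad x / 2"
      unfolding q rad_def using b(1)[of 1] b(1)[of 2] by (simp add: field_simps power2_eq_square)
    also have "\<dots> \<le> (\<rho> * \<rho>) * \<rho> / 2"
      using b(1)[of 1] b(1)[of 2] b(2)[of 1] b(2)[of 2] b(3) x(2) by (intro divide_right_mono mult_mono) auto
    also have "\<dots> \<le> K * 1" using K \<rho>0 by (simp add: field_simps)
    also have "\<dots> \<le> K\<^sup>2" using K unfolding power2_eq_square by (intro mult_left_mono) auto
    finally show "(x $ 1 * x $ 2)\<^sup>2 * quadG x k \<le> K\<^sup>2" .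
    fix v :: "real^2"
    have "\<bar>x $ 1 * v $ 2 + v $ 1 * x $ 2\<bar> \<le> x $ 1 * \<bar>v $ 2\<bar> + \<bar>v $ 1\<bar> * x $ 2"
      using abs_triangle_ineq[of "x $ 1 * v $ 2" "v $ 1 * x $ 2"] b(1)[of 1] b(1)[of 2] by (simp add: abs_mult)
    also have "\<dots> \<le> K * \<bar>v $ 2\<bar> + \<bar>v $ 1\<bar> * K"
      using b(2)[of 1] b(2)[of 2] K by (intro add_mono mult_right_mono mult_left_mono) auto
    finally show "\<bar>x $ 1 * v $ 2 + v $ 1 * x $ 2\<bar> \<le> K * (\<bar>v $ 1\<bar> + \<bar>v $ 2\<bar>)" by (simp add: algebra_simps)
  next
    fix p q assume pq: "mom p \<in> Pol" "q \<in> pt p" "mom p $ 1 * mom p $ 2 \<noteq> 0"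
    obtain i j n :: int and s1 s2 s0 where e: "mom q = mom p"
      "ang q $ 1 - ang p $ 1 = 2 * pi * (of_int i + of_int n / real m) + s1 + s0 / real m"
      "ang q $ 2 - ang p $ 2 = 2 * pi * (of_int j + of_int n / real m) + s2 + s0 / real m"
      "s1 \<noteq> 0 \<longrightarrow> mom p $ 1 = 0" "s2 \<noteq> 0 \<longrightarrow> mom p $ 2 = 0" "s0 \<noteq> 0 \<longrightarrow> rad (mom p) = a"
      by (rule kernelD[OF pq(2)])
    have "s1 = 0" "s2 = 0" using e pq(3) by auto
    then have "ang q $ 1 - ang q $ 2 = ang p $ 1 - ang p $ 2 + 2 * pi * of_int (i - j)"
      using e by (simp add: algebra_simps)
    then have "cis (ang q $ 1 - ang q $ 2) = cis (ang p $ 1 - ang p $ 2)" by (simp only: cis_add_2pi_int)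
    then show "cis (k $ 1 * ang q $ 1 + k $ 2 * ang q $ 2) = cis (k $ 1 * ang p $ 1 + k $ 2 * ang p $ 2)"
      by (simp add: k_def)
  qed
  then show thesis using that by (simp add: k_def)
qed

text \<open>Off the collapsed circles each angle is defined modulo \<open>2 pi / m\<close>, hence
  the factor \<open>m\<close> in the phase. Its gradient contains \<open>1 / x_i\<close> and the
  pole of \<open>F\<close> at \<open>a\<close>; the factor \<open>x_i (r - a)\<close> compensates
  both.\<close>

lemma lip_xi:
  assumes \<rho>: "\<rho> \<in> D"
  obtains K where "lip K (\<lambda>p. complex_of_real (cutoff \<rho> (rad (mom p)) * (mom p $ i * (rad (mom p) - a))) * cis (real m * ang p $ i))"
proof -
  have \<rho>0: "0 < \<rho>" using D_ge[OF \<rho>] a_pos by simp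
  obtain B where B: "\<And>r. a < r \<Longrightarrow> r \<le> \<rho> \<Longrightarrow> \<bar>F r\<bar> * (r - a) \<le> B" using bounds[OF \<rho>] by blast
  define k :: "real^2" where "k = axis i (real m)"
  define K where "K = 1 + 2 * \<rho> + \<rho> * \<rho> + (real m)\<^sup>2 * (\<rho> * \<rho> * \<rho> + \<rho> * \<rho> * \<rho> * \<bar>B\<bar>)"
  have "0 \<le> (real m)\<^sup>2 * (\<rho> * \<rho> * \<rho> + \<rho> * \<rho> * \<rho> * \<bar>B\<bar>)" using \<rho>0 by simp
  then have K: "2 * \<rho> \<le> K" "\<rho> * \<rho> \<le> K" "(real m)\<^sup>2 * (\<rho> * \<rho> * \<rho> + \<rho> * \<rho> * \<rho> * \<bar>B\<bar>) \<le> K" "1 \<le> K"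
    using \<rho>0 mult_pos_pos[OF \<rho>0 \<rho>0] unfolding K_def by linarith+
  have ki: "k $ 1 * u $ 1 + k $ 2 * u $ 2 = real m * u $ i" for u :: "real^2"
    using exhaust_2[of i] by (auto simp: k_def axis_def)
  obtain K' where "lip K' (\<lambda>p. of_real (cutoff \<rho> (rad (mom p)) * (mom p $ i * (rad (mom p) - a))) * cis (k $ 1 * ang p $ 1 + k $ 2 * ang p $ 2))"
  proof (rule lip_cutoff[OF \<rho>, of "\<lambda>x. x $ i * (rad x - a)" "\<lambda>x v. x $ i * (rad v - 0) + v $ i * (rad x - a)" K k])
    show "((\<lambda>x. x $ i * (rad x - a)) has_derivative (\<lambda>v. x $ i * (rad v - 0) + v $ i * (rad x - a))) (at x)" for x
      by (intro has_derivative_mult has_derivative_diff has_derivative_const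
          bounded_linear_imp_has_derivative bounded_linear_vec_nth bounded_linear_rad)
    show "0 \<le> K" using K by simp
    fix x :: "real^2" assume x: "x \<in> MI" "rad x \<le> \<rho>"
    note b = MI_le[OF x]
    have "x $ i * (rad x - a) \<le> \<rho> * \<rho>" using b(1)[of i] b(2)[of i] b(4,5) by (intro mult_mono) auto
    then show "\<bar>x $ i * (rad x - a)\<bar> \<le> K" using K b(1)[of i] b(4) by (simp add: abs_mult)
    have q: "quadG x k = (real m)\<^sup>2 * (1 / x $ i + F (rad x)) / 2"
      using exhaust_2[of i] by (auto simp: quadG_def k_def axis_def algebra_simps)
    have "F (rad x) * (rad x - a) \<le> \<bar>F (rad x)\<bar> * (rad x - a)" using b(4) by (intro mult_right_mono) auto
    also have "\<dots> \<le> \<bar>B\<bar>" using B[of "rad x"] b x by auto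
    finally have FB: "F (rad x) * (rad x - a) \<le> \<bar>B\<bar>" .
    have "(x $ i * (rad x - a))\<^sup>2 * quadG x k =
      (real m)\<^sup>2 * (x $ i * (rad x - a) * (rad x - a) + x $ i * x $ i * (rad x - a) * (F (rad x) * (rad x - a))) / 2"
      unfolding q using b(1)[of i] by (simp add: field_simps power2_eq_square)
    also have "\<dots> \<le> (real m)\<^sup>2 * (\<rho> * \<rho> * \<rho> + \<rho> * \<rho> * \<rho> * \<bar>B\<bar>) / 2"
    proof -
      have "x $ i * (rad x - a) * (rad x - a) \<le> \<rho> * \<rho> * \<rho>"
        using b(1)[of i] b(2)[of i] b(4,5,6) by (intro mult_mono) auto
      moreover have "x $ i * x $ i * (rad x - a) * (F (rad x) * (rad x - a)) \<le> x $ i * x $ i * (rad x - a) * \<bar>B\<bar>"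
        using b(1)[of i] b(4) FB by (intro mult_left_mono) auto
      moreover have "x $ i * x $ i * (rad x - a) * \<bar>B\<bar> \<le> \<rho> * \<rho> * \<rho> * \<bar>B\<bar>"
        using b(1)[of i] b(2)[of i] b(4,5,6) by (intro mult_mono) auto
      ultimately show ?thesis by (intro divide_right_mono mult_left_mono) auto
    qed
    also have "\<dots> \<le> (real m)\<^sup>2 * (\<rho> * \<rho> * \<rho> + \<rho> * \<rho> * \<rho> * \<bar>B\<bar>)" using \<rho>0 by simp
    also have "\<dots> \<le> K * 1" using K by simp
    also have "\<dots> \<le> K\<^sup>2" using K unfolding power2_eq_square by (intro mult_left_mono) auto
    finally show "(x $ i * (rad x - a))\<^sup>2 * quadG x k \<le> K\<^sup>2" .
    fix v :: "real^2"
    have "\<bar>x $ i * (rad v - 0) + v $ i * (rad x - a)\<bar> \<le> \<bar>x $ i * rad v\<bar> + \<bar>v $ i * (rad x - a)\<bar>"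
      using abs_triangle_ineq[of "x $ i * rad v" "v $ i * (rad x - a)"] by simp
    also have "\<dots> = x $ i * \<bar>rad v\<bar> + \<bar>v $ i\<bar> * (rad x - a)" using b(1)[of i] b(4) by (simp add: abs_mult)
    also have "\<dots> \<le> \<rho> * (\<bar>v $ 1\<bar> + \<bar>v $ 2\<bar>) + (\<bar>v $ 1\<bar> + \<bar>v $ 2\<bar>) * \<rho>"
      using b(1)[of i] b(2)[of i] b(4,5,6) exhaust_2[of i]
      by (intro add_mono mult_mono) (auto simp: rad_def)
    also have "\<dots> = 2 * \<rho> * (\<bar>v $ 1\<bar> + \<bar>v $ 2\<bar>)" by (simp add: algebra_simps)
    also have "\<dots> \<le> K * (\<bar>v $ 1\<bar> + \<bar>v $ 2\<bar>)" using K by (intro mult_right_mono) auto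
    finally show "\<bar>x $ i * (rad v - 0) + v $ i * (rad x - a)\<bar> \<le> K * (\<bar>v $ 1\<bar> + \<bar>v $ 2\<bar>)" .
  next
    fix p q assume pq: "mom p \<in> Pol" "q \<in> pt p" "mom p $ i * (rad (mom p) - a) \<noteq> 0"
    obtain i1 j n :: int and s1 s2 s0 where e: "mom q = mom p"
      "ang q $ 1 - ang p $ 1 = 2 * pi * (of_int i1 + of_int n / real m) + s1 + s0 / real m"
      "ang q $ 2 - ang p $ 2 = 2 * pi * (of_int j + of_int n / real m) + s2 + s0 / real m"
      "s1 \<noteq> 0 \<longrightarrow> mom p $ 1 = 0" "s2 \<noteq> 0 \<longrightarrow> mom p $ 2 = 0" "s0 \<noteq> 0 \<longrightarrow> rad (mom p) = a"
      by (rule kernelD[OF pq(2)])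
    have "\<exists>l::int. ang q $ i - ang p $ i = 2 * pi * (of_int l + of_int n / real m)"
      using e pq(3) exhaust_2[of i] by auto
    then obtain l :: int where l: "ang q $ i - ang p $ i = 2 * pi * (of_int l + of_int n / real m)" by blast
    have "real m * (ang q $ i - ang p $ i) = 2 * pi * of_int (int m * l + n)"
      unfolding l using m_pos by (simp add: field_simps)
    then have "real m * ang q $ i = real m * ang p $ i + 2 * pi * of_int (int m * l + n)"
      by (simp add: algebra_simps)
    then show "cis (k $ 1 * ang q $ 1 + k $ 2 * ang q $ 2) = cis (k $ 1 * ang p $ 1 + k $ 2 * ang p $ 2)"
      unfolding ki by (simp only: cis_add_2pi_int)
  qed
  then show thesis using that unfolding ki by blast
qed

text \<open>At distance zero all Lipschitz functions agree. They determine the momenta, and then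
  those combinations of the angles that are still defined over the given stratum of the polygon;
  what they leave open is exactly the part of the torus collapsed there.\<close>

lemma dst_zero:
  assumes pq: "mom p \<in> Pol" "mom q \<in> Pol" and z: "dst (pt p) (pt q) = 0"
  shows "pt p = pt q"
proof -
  have eq: "\<Phi> p = \<Phi> q" if "lip K \<Phi>" for K and \<Phi> :: "coords \<Rightarrow> complex"
    using lip_dst[OF that pq] z by simp
  have "rad (mom p) \<in> D" "rad (mom q) \<in> D" using pq PolD by auto
  then have "max (rad (mom p)) (rad (mom q)) \<in> D" by (simp add: max_def)
  \<comment> \<open>\<open>\<rho>\<close> exceeds both radii, and below \<open>\<rho>\<close> the
    cutoff is positive and strictly decreasing.\<close>
  then obtain \<rho> where \<rho>: "\<rho> \<in> D" "max (rad (mom p)) (rad (mom q)) < \<rho>" by (rule D_bigger)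
  have r: "rad (mom p) = rad (mom q)"
  proof -
    obtain K where "lip K (\<lambda>p. complex_of_real (cutoff \<rho> (rad (mom p))))" by (rule lip_rad[OF \<rho>(1)])
    from eq[OF this] have "cutoff \<rho> (rad (mom p)) = cutoff \<rho> (rad (mom q))" by (simp only: of_real_eq_iff)
    then show ?thesis using \<rho>(2) by (auto simp: cutoff_def max_def split: if_splits)
  qed
  define c where "c = cutoff \<rho> (rad (mom p))"
  have c: "c \<noteq> 0" "cutoff \<rho> (rad (mom q)) = c" using \<rho>(2) r by (auto simp: cutoff_def c_def)
  have "mom p $ 1 = mom q $ 1"
  proof -
    obtain K where "lip K (\<lambda>p. complex_of_real (cutoff \<rho> (rad (mom p)) * mom p $ 1))" by (rule lip_x1[OF \<rho>(1)])
    from eq[OF this] show ?thesis using c by (simp add: c_def)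
  qed
  moreover have "mom p $ 2 = mom q $ 2" using calculation r by (simp add: rad_def)
  ultimately have mom: "mom q = mom p" by (simp add: vec_eq_iff forall_2)
  have A: "\<exists>n::int. ang q $ 1 - ang q $ 2 = ang p $ 1 - ang p $ 2 + 2 * pi * of_int n" if "mom p $ 1 * mom p $ 2 \<noteq> 0"
  proof -
    obtain K where "lip K (\<lambda>p. complex_of_real (cutoff \<rho> (rad (mom p)) * (mom p $ 1 * mom p $ 2)) * cis (ang p $ 1 - ang p $ 2))"
      by (rule lip_x1x2[OF \<rho>(1)])
    from eq[OF this] have "cis (ang q $ 1 - ang q $ 2) = cis (ang p $ 1 - ang p $ 2)"
      using c that by (simp add: mom c_def)
    then show ?thesis by (elim cis_eqD) blast
  qed
  have B: "\<exists>n::int. ang q $ i - ang p $ i = 2 * pi * (of_int n / real m)" if "mom p $ i \<noteq> 0" "rad (mom p) \<noteq> a" for i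
  proof -
    obtain K where "lip K (\<lambda>p. complex_of_real (cutoff \<rho> (rad (mom p)) * (mom p $ i * (rad (mom p) - a))) * cis (real m * ang p $ i))"
      by (rule lip_xi[OF \<rho>(1)])
    from eq[OF this] have "cis (real m * ang q $ i) = cis (real m * ang p $ i)"
      using c that by (simp add: mom c_def)
    then obtain n :: int where "real m * ang q $ i = real m * ang p $ i + 2 * pi * of_int n" by (rule cis_eqD)
    then have "ang q $ i - ang p $ i = 2 * pi * (of_int n / real m)" using m_pos by (simp add: field_simps)
    then show ?thesis by blast
  qed
  have m0: "real m \<noteq> 0" using m_pos by simp
  \<comment> \<open>The two momenta cannot vanish together, as \<open>r \<ge> a > 0\<close>; the
    polygon has no corner at the origin.\<close>
  have p0: "mom p $ 1 \<noteq> 0 \<or> mom p $ 2 \<noteq> 0" using PolD[OF pq(1)] a_pos by (auto simp: rad_def)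
  have "q \<in> pt p"
  proof (cases "rad (mom p) = a")
    case True
    show ?thesis
    proof (cases "mom p $ 1 = 0 \<or> mom p $ 2 = 0")
      case False
      then obtain n :: int where "ang q $ 1 - ang q $ 2 = ang p $ 1 - ang p $ 2 + 2 * pi * of_int n" using A by auto
      then have "ang q $ 1 - ang p $ 1 = 2 * pi * of_int n + (ang q $ 2 - ang p $ 2)" by (simp add: algebra_simps)
      \<comment> \<open>On the zero section a common shift of both angles runs along the collapsed
        circle and is absorbed by \<open>s0\<close>.\<close>
      then show ?thesis using True m0
        by (intro kernelI[of q p n 0 0 "real m * (ang q $ 2 - ang p $ 2)" 0 0, OF mom]) auto
    next
      \<comment> \<open>At a corner the two collapsed circles span the torus, so every shift is
        absorbed.\<close>
      case z: True
      then show ?thesis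
      proof
        assume "mom p $ 1 = 0"
        then show ?thesis using True m0
          by (intro kernelI[of q p 0 0 "ang q $ 1 - ang p $ 1 - (ang q $ 2 - ang p $ 2)" "real m * (ang q $ 2 - ang p $ 2)" 0 0, OF mom]) auto
      next
        assume "mom p $ 2 = 0"
        then show ?thesis using True m0
          by (intro kernelI[of q p 0 0 0 "real m * (ang q $ 1 - ang p $ 1)" 0 "ang q $ 2 - ang p $ 2 - (ang q $ 1 - ang p $ 1)", OF mom]) auto
      qed
    qed
  next
    case False
    show ?thesis
    proof (cases "mom p $ 1 = 0 \<or> mom p $ 2 = 0")
      case nz: False
      then obtain n :: int where n: "ang q $ 1 - ang q $ 2 = ang p $ 1 - ang p $ 2 + 2 * pi * of_int n" using A by auto
      obtain l :: int where l: "ang q $ 1 - ang p $ 1 = 2 * pi * (of_int l / real m)" using B[of 1] nz False by auto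
      \<comment> \<open>The first angle is known modulo \<open>2 pi / m\<close> and the difference
        of the angles modulo \<open>2 pi\<close>; together this is equality modulo
        \<open>2 pi\<close> times the lattice.\<close>
      show ?thesis using n l by (intro kernelI[of q p 0 l 0 0 "- n" 0, OF mom]) (auto simp: algebra_simps)
    next
      case True
      then show ?thesis
      proof
        assume x: "mom p $ 1 = 0"
        then obtain l :: int where l: "ang q $ 2 - ang p $ 2 = 2 * pi * (of_int l / real m)" using B[of 2] p0 False by auto
        show ?thesis using l x by (intro kernelI[of q p 0 l "ang q $ 1 - ang p $ 1 - 2 * pi * (of_int l / real m)" 0 0 0, OF mom]) auto
      next
        assume x: "mom p $ 2 = 0"
        then obtain l :: int where l: "ang q $ 1 - ang p $ 1 = 2 * pi * (of_int l / real m)" using B[of 1] p0 False by auto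
        show ?thesis using l x by (intro kernelI[of q p 0 l 0 0 0 "ang q $ 2 - ang p $ 2 - 2 * pi * (of_int l / real m)", OF mom]) auto
      qed
    qed
  qed
  then show ?thesis using point_of_eqI[of q m a p] by simp
qed

lemma space_overE:
  assumes "A \<in> space_over m a E" obtains p where "A = pt p" "mom p \<in> mom_polygon E"
  using assms unfolding space_over_def by auto

lemma dst_refl: "dst A A = 0"
proof -
  have "(INF \<gamma>s\<in>{\<gamma>s. jn A \<gamma>s A}. len \<gamma>s) \<le> 0"
    by (rule INF_lower2[of "[]"]) auto
  then show ?thesis unfolding riem_dist_def by simp
qed

lemma dst_commute: "dst A B = dst B A"
proof -
  have "(INF \<gamma>s\<in>{\<gamma>s. jn A \<gamma>s B}. len \<gamma>s) \<le> (INF \<gamma>s\<in>{\<gamma>s. jn B \<gamma>s A}. len \<gamma>s)" for A B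
  proof (rule INF_mono)
    fix \<gamma>s assume "\<gamma>s \<in> {\<gamma>s. jn B \<gamma>s A}"
    then have "jn A (rev (map reversepath \<gamma>s)) B" "len (rev (map reversepath \<gamma>s)) = len \<gamma>s"
      using joins_rev len_rev by blast+
    then show "\<exists>\<delta>s\<in>{\<gamma>s. jn A \<gamma>s B}. len \<delta>s \<le> len \<gamma>s" by (metis mem_Collect_eq order_refl)
  qed
  then show ?thesis unfolding riem_dist_def by (metis order_antisym)
qed

lemma Metric_space_dst: "Metric_space (space_over m a D) dst"
proof
  show "0 \<le> dst A B" for A B by (rule dst_nonneg)
  show "dst A B = dst B A" for A B by (rule dst_commute)
  show "dst A B = 0 \<longleftrightarrow> A = B" if "A \<in> space_over m a D" "B \<in> space_over m a D" for A B
    using that dst_zero dst_refl by (elim space_overE) auto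
  show "dst A C \<le> dst A B + dst B C"
    if "A \<in> space_over m a D" "B \<in> space_over m a D" "C \<in> space_over m a D" for A B C
    using that dst_triangle by (elim space_overE) auto
qed

end

section \<open>Completeness and volume\<close>

text \<open>A representative with bounded angles, for compactness; uniqueness is not the aim. Shifts
  by multiples of \<open>2 pi\<close> suffice, since the integer vectors belong to the
  lattice.\<close>

definition trunc_ang :: "coords \<Rightarrow> coords" where
  "trunc_ang p = (\<chi> i. case i of Inl j \<Rightarrow> p $ Inl j | Inr j \<Rightarrow> p $ Inr j - 2 * pi * of_int \<lfloor>p $ Inr j / (2 * pi)\<rfloor>)"

lemma mom_trunc_ang: "mom (trunc_ang p) = mom p"
  by (simp add: trunc_ang_def mom_def)

lemma ang_trunc_ang: "0 \<le> ang (trunc_ang p) $ j" "ang (trunc_ang p) $ j \<le> 2 * pi"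
proof -
  have e: "ang (trunc_ang p) $ j = 2 * pi * frac (p $ Inr j / (2 * pi))"
    by (simp add: trunc_ang_def ang_nth frac_def field_simps)
  show "0 \<le> ang (trunc_ang p) $ j" "ang (trunc_ang p) $ j \<le> 2 * pi"
    unfolding e using frac_lt_1[of "p $ Inr j / (2 * pi)"] by simp_all
qed

lemma prod_coords: "(\<Prod>i\<in>UNIV. f i) = f (Inl 1) * f (Inl 2) * (f (Inr 1) * f (Inr (2::2)))"
  for f :: "2 + 2 \<Rightarrow> real"
  by (simp add: prod_UNIV_Plus UNIV_2 mult.assoc)

definition box_corner :: "real \<Rightarrow> real \<Rightarrow> real \<Rightarrow> coords" where
  "box_corner x \<theta>\<^sub>1 \<theta>\<^sub>2 = (\<chi> i. case i of Inl j \<Rightarrow> x | Inr j \<Rightarrow> if j = 1 then \<theta>\<^sub>1 else \<theta>\<^sub>2)"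

lemma mem_coords_box:
  "p \<in> cbox (box_corner x s t) (box_corner y s' t') \<longleftrightarrow>
    x \<le> mom p $ 1 \<and> mom p $ 1 \<le> y \<and> x \<le> mom p $ 2 \<and> mom p $ 2 \<le> y \<and>
    s \<le> ang p $ 1 \<and> ang p $ 1 \<le> s' \<and> t \<le> ang p $ 2 \<and> ang p $ 2 \<le> t'"
  unfolding mem_box_cart split_sum_all forall_2 by (auto simp: box_corner_def mom_nth ang_nth)

lemma emeasure_coords_box:
  assumes "x \<le> y" "s \<le> s'" "t \<le> t'"
  shows "emeasure lborel (cbox (box_corner x s t) (box_corner y s' t')) = ennreal ((y - x)\<^sup>2 * (s' - s) * (t' - t))"
proof -
  have "box_corner x s t \<in> cbox (box_corner x s t) (box_corner y s' t')"
    using assms unfolding mem_coords_box by (simp add: box_corner_def mom_nth ang_nth)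
  then have "measure lborel (cbox (box_corner x s t) (box_corner y s' t')) = (y - x)\<^sup>2 * (s' - s) * (t' - t)"
    by (subst content_cbox_cart) (auto simp: prod_coords box_corner_def power2_eq_square)
  then show ?thesis
    using emeasure_lborel_cbox_finite[of "box_corner x s t" "box_corner y s' t'"] by (simp add: emeasure_eq_ennreal_measure)
qed

context U2_domain
begin

lemma pt_trunc_ang: "pt (trunc_ang p) = pt p"
proof (rule point_of_eqI)
  show "trunc_ang p \<in> pt p"
    by (rule kernelI[of "trunc_ang p" p "- \<lfloor>p $ Inr 1 / (2 * pi)\<rfloor>" 0 0 0 "- \<lfloor>p $ Inr 2 / (2 * pi)\<rfloor>" 0, OF mom_trunc_ang])
       (auto simp: trunc_ang_def ang_nth)
qed

text \<open>First \<open>\<delta>\<close> is fixed so that the two pulls cost little, then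
  \<open>n\<close> is taken large enough for the constant \<open>K\<close> belonging to this
  \<open>\<delta>\<close>.\<close>

lemma dst_tendsto_0:
  assumes \<rho>: "\<rho> \<in> D" "a < \<rho>" and s: "\<And>n. mom (s n) \<in> Pol" "\<And>n. rad (mom (s n)) \<le> \<rho>"
    and l: "mom l \<in> Pol" "rad (mom l) \<le> \<rho>" and lim: "s \<longlonglongrightarrow> l"
  shows "(\<lambda>n. dst (pt (s n)) (pt l)) \<longlonglongrightarrow> 0"
proof -
  obtain C where C: "0 < C" "\<And>\<delta>. 0 < \<delta> \<Longrightarrow> \<delta> \<le> 1 \<Longrightarrow> \<exists>K\<ge>0. \<forall>p q. mom p \<in> Pol \<longrightarrow> rad (mom p) \<le> \<rho> \<longrightarrow>
    mom q \<in> Pol \<longrightarrow> rad (mom q) \<le> \<rho> \<longrightarrow> joined p q (C * sqrt \<delta> + K * norm (q - p))"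
    using joined_bound[OF \<rho>] by blast
  show ?thesis
  proof (rule LIMSEQ_I)
    fix \<epsilon> :: real assume e: "0 < \<epsilon>"
    define \<delta> where "\<delta> = min 1 ((\<epsilon> / (2 * C))\<^sup>2)"
    have \<delta>: "0 < \<delta>" "\<delta> \<le> 1" using e C(1) by (auto simp: \<delta>_def)
    have "sqrt \<delta> \<le> sqrt ((\<epsilon> / (2 * C))\<^sup>2)" unfolding \<delta>_def by (intro real_sqrt_le_mono) simp
    then have "sqrt \<delta> \<le> \<epsilon> / (2 * C)" using C(1) e by (simp only: real_sqrt_abs) simp
    then have "C * sqrt \<delta> \<le> C * (\<epsilon> / (2 * C))" using C(1) by (intro mult_left_mono) auto
    then have 1: "C * sqrt \<delta> \<le> \<epsilon> / 2" using C(1) by simp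
    obtain K where K: "0 \<le> K" "\<And>p q. mom p \<in> Pol \<Longrightarrow> rad (mom p) \<le> \<rho> \<Longrightarrow>
      mom q \<in> Pol \<Longrightarrow> rad (mom q) \<le> \<rho> \<Longrightarrow> joined p q (C * sqrt \<delta> + K * norm (q - p))"
      using C(2)[OF \<delta>] by blast
    have "0 < \<epsilon> / (2 * (K + 1))" using e K by simp
    then obtain N where N: "\<And>n. n \<ge> N \<Longrightarrow> norm (s n - l) < \<epsilon> / (2 * (K + 1))"
      using LIMSEQ_D[OF lim] by blast
    have "norm (dst (pt (s n)) (pt l) - 0) < \<epsilon>" if "n \<ge> N" for n
    proof -
      have "dst (pt (s n)) (pt l) \<le> C * sqrt \<delta> + K * norm (l - s n)" by (rule dst_le[OF K(2)]) (use s l in auto)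
      also have "\<dots> \<le> \<epsilon> / 2 + (K + 1) * norm (s n - l)"
        using 1 K(1) by (intro add_mono mult_mono) (auto simp: norm_minus_commute)
      also have "\<dots> < \<epsilon> / 2 + (K + 1) * (\<epsilon> / (2 * (K + 1)))"
        using N[OF that] K by (intro add_strict_left_mono mult_strict_left_mono) auto
      also have "\<dots> = \<epsilon>" using K by (simp add: field_simps)
      finally show ?thesis using dst_nonneg[of "pt (s n)" "pt l"] by simp
    qed
    then show "\<exists>N. \<forall>n\<ge>N. norm (dst (pt (s n)) (pt l) - 0) < \<epsilon>" by blast
  qed
qed

text \<open>A Hopf-Rinow argument: \<open>u\<close> stays bounded along a Cauchy sequence, so
  properness confines the momenta, and truncation the angles, to a compact coordinate set. A
  subsequence converges in coordinates, hence for the distance, and a Cauchy sequence with a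
  convergent subsequence converges.\<close>

lemma mcomplete_criterion:
  assumes E: "E \<subseteq> D" "\<And>\<rho>. \<rho> \<in> D \<Longrightarrow> closed (E \<inter> {..\<rho>})"
    and lu: "\<And>p q. mom p \<in> Pol \<Longrightarrow> mom q \<in> Pol \<Longrightarrow> \<bar>u (rad (mom p)) - u (rad (mom q))\<bar> \<le> K * dst (pt p) (pt q)" "0 \<le> K"
    and proper: "\<And>B. \<exists>\<rho>\<in>D. \<forall>r\<in>E. u r \<le> B \<longrightarrow> r \<le> \<rho>"
  shows "Metric_space.mcomplete (space_over m a E) dst"
proof -
  have EP: "x \<in> Pol" if "x \<in> mom_polygon E" for x using that E(1) by (auto simp: mom_polygon_def)
  have "space_over m a E \<subseteq> space_over m a D" unfolding space_over_def using EP by auto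
  then interpret M: Metric_space "space_over m a E" dst
    by (rule Metric_space.subspace[OF Metric_space_dst])
  show ?thesis unfolding M.mcomplete_def
  proof (intro allI impI)
    fix \<sigma> assume c: "M.MCauchy \<sigma>"
    have "\<exists>p. \<sigma> n = pt p \<and> mom p \<in> mom_polygon E \<and> (\<forall>j. 0 \<le> ang p $ j \<and> ang p $ j \<le> 2 * pi)" for n
    proof -
      have "\<sigma> n \<in> space_over m a E" using c by (auto simp: M.MCauchy_def)
      then obtain p where "\<sigma> n = pt p" "mom p \<in> mom_polygon E" by (rule space_overE)
      then show ?thesis using pt_trunc_ang[of p] mom_trunc_ang[of p] ang_trunc_ang[of p]
        by (intro exI[of _ "trunc_ang p"]) auto
    qed
    then obtain s where s: "\<And>n. \<sigma> n = pt (s n)" "\<And>n. mom (s n) \<in> mom_polygon E"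
      "\<And>n j. 0 \<le> ang (s n) $ j \<and> ang (s n) $ j \<le> 2 * pi" by metis
    obtain N where N: "\<And>n. n \<ge> N \<Longrightarrow> dst (\<sigma> n) (\<sigma> N) < 1"
      using c zero_less_one unfolding M.MCauchy_def by (metis order_refl)
    have "u (rad (mom (s n))) \<le> u (rad (mom (s N))) + K" if "n \<ge> N" for n
    proof -
      have "\<bar>u (rad (mom (s n))) - u (rad (mom (s N)))\<bar> \<le> K * dst (pt (s n)) (pt (s N))"
        by (rule lu(1)) (use EP s in auto)
      also have "\<dots> \<le> K * 1" using N[OF that] s(1) lu(2) by (intro mult_left_mono) auto
      finally show ?thesis by simp
    qed
    moreover obtain \<rho>' where \<rho>': "\<rho>' \<in> D" "\<forall>r\<in>E. u r \<le> u (rad (mom (s N))) + K \<longrightarrow> r \<le> \<rho>'" using proper by blast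
    ultimately have "rad (mom (s n)) \<le> \<rho>'" if "n \<ge> N" for n using s(2)[of n] that by (auto simp: mom_polygon_def)
    moreover obtain \<rho> where \<rho>: "\<rho> \<in> D" "\<rho>' < \<rho>" "a < \<rho>" using D_bigger[OF \<rho>'(1)] by blast
    ultimately have rs: "rad (mom (s n)) \<le> \<rho>" if "n \<ge> N" for n using that by force
    define S where "S = {p. 0 \<le> mom p $ 1 \<and> 0 \<le> mom p $ 2} \<inter> ((\<lambda>p. rad (mom p)) -` (E \<inter> {..\<rho>}))
       \<inter> cbox (box_corner 0 0 0) (box_corner \<rho> (2 * pi) (2 * pi))"
    have "closed {p. 0 \<le> mom p $ 1 \<and> 0 \<le> mom p $ 2}"
      by (intro closed_Collect_conj closed_Collect_le continuous_intros)
    moreover have "closed ((\<lambda>p. rad (mom p)) -` (E \<inter> {..\<rho>}))"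
      by (rule closed_vimage[OF E(2)[OF \<rho>(1)]]) (intro continuous_intros)
    ultimately have "compact S" unfolding S_def by (intro closed_Int_compact closed_Int compact_cbox)
    moreover have sS: "s (N + n) \<in> S" for n
      using s(2)[of "N + n"] s(3)[of "N + n"] rs[of "N + n"]
      by (auto simp: S_def mem_coords_box mom_polygon_def rad_def)
    ultimately obtain l r where l: "l \<in> S" "strict_mono (r :: nat \<Rightarrow> nat)" "((\<lambda>n. s (N + n)) \<circ> r) \<longlonglongrightarrow> l"
      unfolding compact_def by metis
    have lE: "mom l \<in> mom_polygon E" "rad (mom l) \<le> \<rho>" using l(1) by (auto simp: S_def mom_polygon_def)
    have lim: "(\<lambda>n. dst (pt (s (N + r n))) (pt l)) \<longlonglongrightarrow> 0"
      by (rule dst_tendsto_0[OF \<rho>(1,3)]) (use s(2) EP rs lE l(3) in \<open>auto simp: o_def\<close>)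
    have "limitin M.mtopology (\<sigma> \<circ> (\<lambda>n. N + r n)) (pt l) sequentially"
      unfolding M.limit_metric_sequentially
    proof (intro conjI allI impI)
      show "pt l \<in> space_over m a E" using lE by (auto simp: space_over_def)
      fix \<epsilon> :: real assume "0 < \<epsilon>"
      then obtain M' where "\<And>n. n \<ge> M' \<Longrightarrow> norm (dst (pt (s (N + r n))) (pt l) - 0) < \<epsilon>"
        using LIMSEQ_D[OF lim] by blast
      then show "\<exists>N'. \<forall>n\<ge>N'. (\<sigma> \<circ> (\<lambda>n. N + r n)) n \<in> space_over m a E \<and> dst ((\<sigma> \<circ> (\<lambda>n. N + r n)) n) (pt l) < \<epsilon>"
        using c s(1) by (intro exI[of _ M']) (auto simp: M.MCauchy_def)
    qed
    moreover have "strict_mono (\<lambda>n. N + r n)" using l(2) by (simp add: strict_mono_def)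
    ultimately have "limitin M.mtopology \<sigma> (pt l) sequentially"
      using M.MCauchy_convergent_subsequence[OF c] by blast
    then show "\<exists>x. limitin M.mtopology \<sigma> x sequentially" by blast
  qed
qed

text \<open>The squared gradient of a function of \<open>r\<close> is \<open>u'\<^sup>2\<close>
  times \<open>quadH\<close> of the covector \<open>(1, 1)\<close>, and the latter equals
  \<open>2 r (1 - r f)\<close>.\<close>

lemma lip_radial:
  assumes K: "0 < K" and c: "continuous_on D u"
    and d: "\<And>r. r \<in> interior D \<Longrightarrow> (u has_real_derivative u' r) (at r)"
    and b: "\<And>r. r \<in> interior D \<Longrightarrow> (u' r)\<^sup>2 * (2 * r * (1 - r * f r)) \<le> K\<^sup>2"
  shows "lip K (\<lambda>p. u (rad (mom p)))"
  unfolding lip_def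
proof (intro conjI allI impI)
  show "0 < K" by (rule K)
  show "continuous_on {p. mom p \<in> Pol} (\<lambda>p. u (rad (mom p)))"
    by (intro continuous_on_compose2[OF c] continuous_intros) (auto simp: mom_polygon_def)
  show "u (rad (mom q)) = u (rad (mom p))" if "q \<in> pt p" for p q using that by (simp add: point_of_iff)
  fix p assume p: "mom p \<in> MI"
  let ?r = "rad (mom p)"
  have r: "?r \<in> interior D" using p by (auto simp: mom_int_def)
  have "((\<lambda>p. u (rad (mom p))) has_derivative (\<lambda>v. u' ?r * rad (mom v))) (at p)"
    using has_derivative_compose[OF bounded_linear_imp_has_derivative[OF bounded_linear_compose[OF bounded_linear_rad bounded_linear_mom]]
        d[OF r, unfolded has_field_derivative_def]] by blast
  moreover have "norm (u' ?r * rad (mom v)) \<le> K * speed p v" for v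
  proof -
    have G: "0 \<le> quadG (mom p) (mom v)" "0 \<le> quadH (mom p) (ang v)"
      using p by (auto intro: quadG_nonneg quadH_nonneg MI_pos_over)
    have q: "quadH (mom p) (\<chi> i. 1) = 2 * ?r * (1 - ?r * f ?r)"
      unfolding quadH_def by (simp add: rad_def power2_eq_square algebra_simps)
    have "(u' ?r * rad (mom v))\<^sup>2 \<le> (u' ?r)\<^sup>2 * (quadH (mom p) (\<chi> i. 1) * quadG (mom p) (mom v))"
      unfolding power_mult_distrib using pairing_le[OF MI_pos_over[OF p], of "\<chi> i. 1" "mom v"]
      by (intro mult_left_mono) (auto simp: rad_def)
    also have "\<dots> = ((u' ?r)\<^sup>2 * (2 * ?r * (1 - ?r * f ?r))) * quadG (mom p) (mom v)" unfolding q by simp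
    also have "\<dots> \<le> K\<^sup>2 * (quadG (mom p) (mom v) + quadH (mom p) (ang v))"
      using b[OF r] G by (intro mult_mono) auto
    also have "\<dots> = (K * speed p v)\<^sup>2" using G by (simp add: speed_eq[OF p] power_mult_distrib)
    finally show ?thesis using K speed_nonneg[OF p, of v] by (simp add: abs_le_square_iff[symmetric])
  qed
  ultimately show "\<exists>\<Phi>'. ((\<lambda>p. u (rad (mom p))) has_derivative \<Phi>') (at p) \<and> (\<forall>v. norm (\<Phi>' v) \<le> K * speed p v)"
    by blast
qed

text \<open>The ray through \<open>mom p\<close> with fixed angles follows the gradient of
  \<open>r\<close>, so its length element \<open>dr / sqrt (2 r (1 - r f))\<close> is the smallest
  possible for a given change of \<open>r\<close>.\<close>

lemma joined_radial:
  assumes p: "mom p \<in> MI" and q: "mom q = (s / rad (mom p)) *\<^sub>R mom p" "ang q = ang p"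
    and s: "a < s" "s \<le> rad (mom p)"
    and \<Psi>: "\<And>t. s \<le> t \<Longrightarrow> t \<le> rad (mom p) \<Longrightarrow> (\<Psi> has_real_derivative \<Psi>' t) (at t)"
    and b: "\<And>t. s \<le> t \<Longrightarrow> t \<le> rad (mom p) \<Longrightarrow> sqrt (1 / (2 * t * (1 - t * f t))) \<le> \<Psi>' t"
  shows "joined q p (\<Psi> (rad (mom p)) - \<Psi> s)"
proof -
  define r where "r = rad (mom p)"
  have r: "0 < r" "r \<in> D" "s \<le> r" "a < r" using p s a_pos by (auto simp: MI_iff r_def)
  define \<tau> where "\<tau> = (\<lambda>t. s + t * (r - s))"
  have \<tau>: "s \<le> \<tau> t" "\<tau> t \<le> r" "a < \<tau> t" "0 < \<tau> t" "\<tau> t \<in> interior D" if "0 \<le> t" "t \<le> 1" for t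
  proof -
    show 1: "s \<le> \<tau> t" using that r by (simp add: \<tau>_def)
    show 2: "\<tau> t \<le> r" using mult_right_mono[OF that(2), of "r - s"] r by (simp add: \<tau>_def)
    show "a < \<tau> t" "0 < \<tau> t" "\<tau> t \<in> interior D" using 1 2 s a_pos D_down[OF r(2), of "\<tau> t"] by (auto simp: int_D)
  qed
  have mt: "mom (linepath q p t) = (\<tau> t / r) *\<^sub>R mom p" for t
  proof -
    have "(1 - t) * (s / r) + t = \<tau> t / r" using r by (simp add: \<tau>_def field_simps)
    then show ?thesis unfolding mom_linepath q(1) r_def[symmetric] by (simp add: scaleR_add_left[symmetric])
  qed
  have rt: "rad (mom (linepath q p t)) = \<tau> t" for t using r by (simp add: mt rad_scaleR r_def)
  have int: "mom (linepath q p t) \<in> MI" if "0 \<le> t" "t \<le> 1" for t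
    using p \<tau>[OF that] r unfolding MI_iff rt by (auto simp: mt MI_iff int_D)
  have speed: "speed (linepath q p t) (p - q) \<le> (r - s) * \<Psi>' (\<tau> t)" if t: "0 \<le> t" "t \<le> 1" for t
  proof -
    note tt = \<tau>[OF t]
    have w: "0 < 1 - \<tau> t * f (\<tau> t)" using w_pos[OF tt(5)] .
    have F: "F (\<tau> t) = f (\<tau> t) / (1 - \<tau> t * f (\<tau> t))" using F_f[OF tt(5)] .
    have v: "mom (p - q) = ((r - s) / r) *\<^sub>R mom p" "ang (p - q) = 0"
      using r by (simp_all add: mom_diff ang_diff q r_def[symmetric] diff_divide_distrib scaleR_diff_left)
    define x y where "x = mom p $ 1" "y = mom p $ 2"
    note xy = this
    have xy0: "0 < x" "0 < y" "x + y = r" using p by (auto simp: xy MI_iff r_def rad_def)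
    have "quadG (mom (linepath q p t)) (mom (p - q)) =
       (((r - s) / r * x)\<^sup>2 / (\<tau> t / r * x) + ((r - s) / r * y)\<^sup>2 / (\<tau> t / r * y)
        + F (\<tau> t) * ((r - s) / r * x + (r - s) / r * y)\<^sup>2) / 2"
      unfolding quadG_def rt unfolding mt v by (simp add: xy)
    also have "((r - s) / r * x)\<^sup>2 / (\<tau> t / r * x) = (r - s)\<^sup>2 / (r * \<tau> t) * x"
      using xy0 r tt by (simp add: field_simps power2_eq_square)
    also have "((r - s) / r * y)\<^sup>2 / (\<tau> t / r * y) = (r - s)\<^sup>2 / (r * \<tau> t) * y"
      using xy0 r tt by (simp add: field_simps power2_eq_square)
    also have "(r - s) / r * x + (r - s) / r * y = r - s"
      using xy0 r by (metis distrib_left nonzero_eq_divide_eq less_irrefl)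
    also have "(r - s)\<^sup>2 / (r * \<tau> t) * x + (r - s)\<^sup>2 / (r * \<tau> t) * y = (r - s)\<^sup>2 / \<tau> t"
      unfolding distrib_left[symmetric] xy0(3) using r tt by simp
    also have "((r - s)\<^sup>2 / \<tau> t + F (\<tau> t) * (r - s)\<^sup>2) / 2 = (r - s)\<^sup>2 * (1 / (2 * \<tau> t * (1 - \<tau> t * f (\<tau> t))))"
      unfolding F using w tt(4) by (simp add: field_simps)
    finally have "speed (linepath q p t) (p - q) = sqrt ((r - s)\<^sup>2 * (1 / (2 * \<tau> t * (1 - \<tau> t * f (\<tau> t)))))"
      unfolding speed_eq[OF int[OF t]] v(2) by (simp add: quadH_def)
    also have "\<dots> = (r - s) * sqrt (1 / (2 * \<tau> t * (1 - \<tau> t * f (\<tau> t))))"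
      using r by (simp only: real_sqrt_mult) simp
    also have "\<dots> \<le> (r - s) * \<Psi>' (\<tau> t)"
      using b[of "\<tau> t"] tt r by (intro mult_left_mono) (auto simp: r_def)
    finally show ?thesis .
  qed
  have D1: "((\<lambda>t. \<Psi> (\<tau> t)) has_real_derivative (r - s) * \<Psi>' (\<tau> t)) (at t)" if t: "0 \<le> t" "t \<le> 1" for t
  proof -
    have "(\<tau> has_real_derivative (r - s)) (at t)" unfolding \<tau>_def by (auto intro!: derivative_eq_intros)
    moreover have "(\<Psi> has_real_derivative \<Psi>' (\<tau> t)) (at (\<tau> t))" using \<Psi>[of "\<tau> t"] \<tau>[OF t] by (simp add: r_def)
    ultimately show ?thesis using DERIV_chain2 by (metis mult.commute)
  qed
  have mono: "\<Psi> s \<le> \<Psi> r"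
  proof (rule DERIV_nonneg_imp_nondecreasing[OF r(3)])
    fix t assume t: "s \<le> t" "t \<le> r"
    then have "t \<in> interior D" using s D_down[OF r(2), of t] by (auto simp: int_D)
    then have "0 \<le> sqrt (1 / (2 * t * (1 - t * f t)))" using w_pos[of t] I_pos[of t] by simp
    then have "0 \<le> \<Psi>' t" using b[of t] t unfolding r_def by linarith
    then show "\<exists>y. (\<Psi> has_real_derivative y) (at t) \<and> 0 \<le> y"
      using \<Psi>[of t] t by (auto simp: r_def)
  qed
  have "joined q p (\<Psi> r - \<Psi> s)"
  proof (rule joined_linepath[where \<psi> = "\<lambda>t. \<Psi> (\<tau> t)" and \<psi>' = "\<lambda>t. (r - s) * \<Psi>' (\<tau> t)"])
    show "mom q \<in> Pol" using int[of 0] MI_Pol by (simp add: linepath_0')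
    show "mom p \<in> Pol" using p MI_Pol by simp
    show "continuous_on {0..1} (\<lambda>t. \<Psi> (\<tau> t))"
      using D1 by (intro continuous_at_imp_continuous_on ballI DERIV_isCont) auto
  qed (use int speed D1 mono in \<open>auto simp: \<tau>_def\<close>)
  then show ?thesis by (simp add: r_def)
qed

text \<open>By \<open>det_metric\<close> volume is Lebesgue measure in the coordinates, so an
  enclosing box suffices; the range of the first angle is enlarged to the full
  \<open>2 pi\<close>.\<close>

lemma volume_le:
  assumes "0 \<le> \<rho>" "\<And>p. mom p \<in> MI \<Longrightarrow> pt p \<in> S \<Longrightarrow> rad (mom p) \<le> \<rho>"
  shows "volume_of m a D h S \<le> ennreal (\<rho>\<^sup>2 * (2 * pi) * (2 * pi))"
proof -
  let ?B = "cbox (box_corner 0 0 0) (box_corner \<rho> (2 * pi) (2 * pi))"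
  have "2 * pi / real m \<le> 2 * pi" using m_pos by (simp add: field_simps)
  then have sub: "p \<in> ?B" if "mom p \<in> MI" "ang p $ 1 \<in> {0..<2 * pi / real m}" "ang p $ 2 \<in> {0..<2 * pi}" "pt p \<in> S" for p
    using that assms(2)[OF that(1,4)] by (auto simp: mem_coords_box MI_iff rad_def)
  have "volume_of m a D h S \<le> (\<integral>\<^sup>+ p. indicator ?B p \<partial>lborel)"
    unfolding volume_of_def riem_volume_def
  proof (rule nn_integral_mono)
    fix p
    show "ennreal (sqrt (det (U2_metric h p))) * indicator {p. mom p \<in> MI \<and> ang p $ 1 \<in> {0..<2 * pi / real m} \<and>
       ang p $ 2 \<in> {0..<2 * pi} \<and> pt p \<in> S} p \<le> indicator ?B p"
      using sub[of p] det_metric[OF MI_pos_over, of p] by (auto simp: indicator_def)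
  qed
  also have "\<dots> = ennreal (\<rho>\<^sup>2 * (2 * pi) * (2 * pi))"
    using emeasure_coords_box[of 0 \<rho> 0 "2 * pi" 0 "2 * pi"] assms(1) by simp
  finally show ?thesis .
qed

text \<open>The inscribed box has both momenta between \<open>\<alpha>\<close> and
  \<open>\<beta>\<close>, hence \<open>r\<close> between twice these values. Half of each angular
  period keeps the closed box inside the half-open fundamental domain.\<close>

lemma volume_ge:
  assumes "0 < \<alpha>" "a < 2 * \<alpha>" "\<alpha> \<le> \<beta>" "2 * \<beta> \<in> D"
    and S: "\<And>p. mom p \<in> MI \<Longrightarrow> 2 * \<alpha> \<le> rad (mom p) \<Longrightarrow> rad (mom p) \<le> 2 * \<beta> \<Longrightarrow>
      (\<And>j. 0 \<le> ang p $ j \<and> ang p $ j \<le> 2 * pi) \<Longrightarrow> pt p \<in> S"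
  shows "ennreal ((\<beta> - \<alpha>)\<^sup>2 * (pi / m) * pi) \<le> volume_of m a D h S"
proof -
  let ?B = "cbox (box_corner \<alpha> 0 0) (box_corner \<beta> (pi / m) pi)"
  let ?S = "{p. mom p \<in> MI \<and> ang p $ 1 \<in> {0..<2 * pi / real m} \<and> ang p $ 2 \<in> {0..<2 * pi} \<and> pt p \<in> S}"
  have m1: "pi / m \<le> 2 * pi" "pi / m < 2 * pi / real m" using m_pos by (auto simp: field_simps)
  have sub: "p \<in> ?S" if "p \<in> ?B" for p
  proof -
    have b: "\<alpha> \<le> mom p $ 1" "mom p $ 1 \<le> \<beta>" "\<alpha> \<le> mom p $ 2" "mom p $ 2 \<le> \<beta>"
       "0 \<le> ang p $ 1" "ang p $ 1 \<le> pi / m" "0 \<le> ang p $ 2" "ang p $ 2 \<le> pi" using that by (auto simp: mem_coords_box)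
    then have r: "2 * \<alpha> \<le> rad (mom p)" "rad (mom p) \<le> 2 * \<beta>" by (auto simp: rad_def)
    have M: "mom p \<in> MI" using b r assms D_down[OF assms(4), of "rad (mom p)"] by (auto simp: MI_iff)
    have "0 \<le> ang p $ j \<and> ang p $ j \<le> 2 * pi" for j using b m1 exhaust_2[of j] by auto
    then have "pt p \<in> S" by (intro S[OF M r])
    then show ?thesis using b m1 M pi_gt_zero by auto
  qed
  have "ennreal ((\<beta> - \<alpha>)\<^sup>2 * (pi / m) * pi) = (\<integral>\<^sup>+ p. indicator ?B p \<partial>lborel)"
    using emeasure_coords_box[of \<alpha> \<beta> 0 "pi / m" 0 pi] assms by simp
  also have "\<dots> \<le> volume_of m a D h S"
    unfolding volume_of_def riem_volume_def
    using sub by (intro nn_integral_mono) (auto simp: indicator_def det_metric[OF MI_pos_over])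
  finally show ?thesis .
qed

text \<open>\<open>joined_bound\<close> with \<open>\<delta> = 1\<close>. It covers the way from the
  base point, which may lie on an edge, to the start of a radial path.\<close>

lemma joined_base:
  assumes A: "mom p0 \<in> Pol" and r0: "r0 \<in> D" "a < r0"
  obtains C where "\<And>p. mom p \<in> Pol \<Longrightarrow> rad (mom p) \<le> r0 \<Longrightarrow> (\<And>j. 0 \<le> ang p $ j \<and> ang p $ j \<le> 2 * pi) \<Longrightarrow> joined p0 p C"
proof -
  define \<rho> where "\<rho> = max r0 (rad (mom p0))"
  have \<rho>: "\<rho> \<in> D" "a < \<rho>" using r0 PolD[OF A] by (auto simp: \<rho>_def max_def)
  obtain C K where C: "0 < C" "0 \<le> K" "\<And>p q. mom p \<in> Pol \<Longrightarrow> rad (mom p) \<le> \<rho> \<Longrightarrow>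
    mom q \<in> Pol \<Longrightarrow> rad (mom q) \<le> \<rho> \<Longrightarrow> joined p q (C * sqrt 1 + K * norm (q - p))"
    using joined_bound[OF \<rho>] zero_less_one order_refl by metis
  show thesis
  proof (rule that[of "C + K * (2 * r0 + 4 * pi + norm p0)"])
    fix p assume p: "mom p \<in> Pol" "rad (mom p) \<le> r0" "\<And>j. 0 \<le> ang p $ j \<and> ang p $ j \<le> 2 * pi"
    have "norm p \<le> (\<Sum>i\<in>UNIV. \<bar>p $ i\<bar>)" by (rule norm_le_l1_cart)
    also have "\<dots> = \<bar>mom p $ 1\<bar> + \<bar>mom p $ 2\<bar> + (\<bar>ang p $ 1\<bar> + \<bar>ang p $ 2\<bar>)"
      by (simp add: sum_UNIV_Plus sum_2 mom_nth ang_nth)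
    also have "\<dots> \<le> 2 * r0 + 4 * pi" using PolD[OF p(1)] p(2) p(3)[of 1] p(3)[of 2] by (auto simp: rad_def)
    finally have "norm (p - p0) \<le> 2 * r0 + 4 * pi + norm p0" using norm_triangle_ineq4[of p p0] by linarith
    then have "K * norm (p - p0) \<le> K * (2 * r0 + 4 * pi + norm p0)" using C by (intro mult_left_mono) auto
    moreover have "joined p0 p (C * sqrt 1 + K * norm (p - p0))" by (rule C(3)) (use A p in \<open>auto simp: \<rho>_def\<close>)
    ultimately show "joined p0 p (C + K * (2 * r0 + 4 * pi + norm p0))" by (auto elim: joined_mono)
  qed
qed

end

section \<open>Metrics given by a polynomial\<close>

lemma smooth_rational:
  assumes U: "open U" and q: "\<And>r. r \<in> U \<Longrightarrow> poly q r \<noteq> 0"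
    and g: "\<And>r. r \<in> U \<Longrightarrow> g r = poly p r / poly q r"
  shows "smooth_fun_on g U"
proof -
  \<comment> \<open>Only some rational form of each derivative is carried along; squaring the
    denominator keeps it free of zeros on \<open>U\<close>.\<close>
  have main: "\<exists>p q. \<forall>r\<in>U. poly q r \<noteq> 0 \<and> (deriv ^^ k) g r = poly p r / poly q r" for k
  proof (induction k)
    case 0 show ?case using q g by auto
  next
    case (Suc k)
    then obtain p q where pq: "\<And>r. r \<in> U \<Longrightarrow> poly q r \<noteq> 0" "\<And>r. r \<in> U \<Longrightarrow> (deriv ^^ k) g r = poly p r / poly q r" by blast
    have "deriv ((deriv ^^ k) g) r = poly (pderiv p * q - p * pderiv q) r / poly (q * q) r" if r: "r \<in> U" for r
    proof (rule DERIV_imp_deriv)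
      have "((\<lambda>r. poly p r / poly q r) has_real_derivative poly (pderiv p * q - p * pderiv q) r / poly (q * q) r) (at r)"
        using pq(1)[OF r] by (auto intro!: derivative_eq_intros)
      then show "((deriv ^^ k) g has_real_derivative poly (pderiv p * q - p * pderiv q) r / poly (q * q) r) (at r)"
        by (rule has_field_derivative_transform_within_open[OF _ U r]) (simp add: pq(2))
    qed
    then show ?case using pq(1) by (intro exI[of _ "pderiv p * q - p * pderiv q"] exI[of _ "q * q"]) auto
  qed
  show ?thesis unfolding smooth_fun_on_def
  proof (intro allI ballI)
    fix k r assume r: "r \<in> U"
    obtain p q where pq: "\<And>r. r \<in> U \<Longrightarrow> poly q r \<noteq> 0" "\<And>r. r \<in> U \<Longrightarrow> (deriv ^^ k) g r = poly p r / poly q r" using main by blast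
    have "((\<lambda>r. poly p r / poly q r) has_real_derivative poly (pderiv p * q - p * pderiv q) r / poly (q * q) r) (at r)"
      using pq(1)[OF r] by (auto intro!: derivative_eq_intros)
    then have "((deriv ^^ k) g has_real_derivative poly (pderiv p * q - p * pderiv q) r / poly (q * q) r) (at r)"
      by (rule has_field_derivative_transform_within_open[OF _ U r]) (simp add: pq(2))
    then show "(deriv ^^ k) g differentiable (at r)" by (auto simp: real_differentiable_def)
  qed
qed

lemma smooth_fun_on_second:
  assumes h: "\<And>r. r \<in> U \<Longrightarrow> h differentiable (at r)" "\<And>r. r \<in> U \<Longrightarrow> deriv h differentiable (at r)"
    and h2: "smooth_fun_on (deriv (deriv h)) U"
  shows "smooth_fun_on h U"
  unfolding smooth_fun_on_def
proof (intro allI ballI)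
  fix k r assume r: "r \<in> U"
  consider "k = 0" | "k = 1" | j where "k = Suc (Suc j)" by (metis One_nat_def not0_implies_Suc)
  then show "(deriv ^^ k) h differentiable (at r)"
  proof cases
    case 3
    then have "(deriv ^^ k) h = (deriv ^^ j) (deriv (deriv h))" by (simp add: funpow_swap1)
    then show ?thesis using h2 r by (simp add: smooth_fun_on_def)
  qed (use h r in auto)
qed

lemma poly_abs_le:
  fixes p :: "real poly"
  assumes "degree p \<le> n" "0 < a"
  obtains C where "0 < C" "\<And>r. a \<le> r \<Longrightarrow> \<bar>poly p r\<bar> \<le> C * r ^ n"
proof
  define C where "C = 1 + (\<Sum>i\<le>degree p. \<bar>coeff p i\<bar> / a ^ (n - i))"
  show "0 < C" unfolding C_def using assms(2) by (intro add_pos_nonneg sum_nonneg) auto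
  fix r assume r: "a \<le> r"
  have "\<bar>poly p r\<bar> \<le> (\<Sum>i\<le>degree p. \<bar>coeff p i * r ^ i\<bar>)"
    unfolding poly_altdef by (rule sum_abs)
  also have "\<dots> \<le> (\<Sum>i\<le>degree p. \<bar>coeff p i\<bar> / a ^ (n - i) * r ^ n)"
  proof (rule sum_mono)
    fix i assume i: "i \<in> {..degree p}"
    have "a ^ (n - i) * r ^ i \<le> r ^ (n - i) * r ^ i"
      using r assms(2) by (intro mult_right_mono power_mono) auto
    also have "\<dots> = r ^ n" using i assms(1) by (simp flip: power_add)
    finally have "r ^ i \<le> r ^ n / a ^ (n - i)" using assms(2) by (simp add: field_simps)
    then have "\<bar>coeff p i\<bar> * r ^ i \<le> \<bar>coeff p i\<bar> * (r ^ n / a ^ (n - i))" by (intro mult_left_mono) auto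
    then show "\<bar>coeff p i * r ^ i\<bar> \<le> \<bar>coeff p i\<bar> / a ^ (n - i) * r ^ n"
      using r assms(2) by (simp add: abs_mult)
  qed
  also have "\<dots> \<le> C * r ^ n" unfolding C_def using r assms(2) by (simp add: sum_distrib_right distrib_right)
  finally show "\<bar>poly p r\<bar> \<le> C * r ^ n" .
qed

lemma lead_coeff_pos_if_pos:
  fixes p :: "real poly"
  assumes "\<And>r. r0 < r \<Longrightarrow> 0 < poly p r"
  shows "0 < lead_coeff p"
proof (rule ccontr)
  assume "\<not> 0 < lead_coeff p"
  moreover have "p \<noteq> 0" using assms[of "r0 + 1"] by auto
  ultimately have "0 < lead_coeff (- p)" by (simp add: less_le)
  then obtain n where "\<forall>x\<ge>n. lead_coeff (- p) \<le> poly (- p) x" using poly_pinfty_gt_lc by blast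
  then have "lead_coeff (- p) \<le> poly (- p) (max n (r0 + 1))" by (metis max.cobounded1)
  moreover have "0 < poly p (max n (r0 + 1))" by (rule assms) auto
  ultimately show False using \<open>0 < lead_coeff (- p)\<close> by simp
qed

text \<open>Half of the leading term bounds \<open>p\<close> from below for large \<open>r\<close>;
  on the compact remainder \<open>p / r^n\<close> has a positive minimum.\<close>

lemma poly_ge_power:
  fixes p :: "real poly"
  assumes pos: "\<And>r. r0 \<le> r \<Longrightarrow> 0 < poly p r" and r0: "0 < r0"
  obtains c where "0 < c" "\<And>r. r0 \<le> r \<Longrightarrow> c * r ^ degree p \<le> poly p r"
proof -
  define n where "n = degree p"
  have lc: "0 < lead_coeff p" by (rule lead_coeff_pos_if_pos[of r0]) (use pos in auto)
  define p' where "p' = p - monom (lead_coeff p / 2) n"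
  have c: "coeff p' n = lead_coeff p / 2" by (simp add: p'_def n_def)
  have "degree p' \<le> n" unfolding p'_def n_def by (intro degree_diff_le) (auto simp: degree_monom_le)
  moreover have "n \<le> degree p'" using c lc by (intro le_degree) auto
  ultimately have "degree p' = n" by simp
  then have "0 < lead_coeff p'" using c lc by simp
  then obtain R where R: "\<And>x. x \<ge> R \<Longrightarrow> lead_coeff p' \<le> poly p' x" using poly_pinfty_gt_lc by blast
  have big: "lead_coeff p / 2 * r ^ n \<le> poly p r" if "r \<ge> R" for r
    using R[OF that] \<open>0 < lead_coeff p'\<close> by (simp add: p'_def poly_monom)
  define R' where "R' = max r0 R"
  have "continuous_on {r0..R'} (\<lambda>r. poly p r / r ^ n)"
    using r0 by (intro continuous_intros) auto
  then obtain x where x: "x \<in> {r0..R'}" "\<And>y. y \<in> {r0..R'} \<Longrightarrow> poly p x / x ^ n \<le> poly p y / y ^ n"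
    using continuous_attains_inf[of "{r0..R'}" "\<lambda>r. poly p r / r ^ n"] by (auto simp: R'_def)
  define c where "c = min (lead_coeff p / 2) (poly p x / x ^ n)"
  have "0 < c" unfolding c_def using lc pos[of x] x(1) r0 by auto
  moreover have "c * r ^ n \<le> poly p r" if r: "r0 \<le> r" for r
  proof (cases "r \<le> R'")
    case True
    then have "c \<le> poly p r / r ^ n" using x(2)[of r] r by (auto simp: c_def)
    then show ?thesis using r r0 by (simp add: field_simps)
  next
    case False
    then have "lead_coeff p / 2 * r ^ n \<le> poly p r" using big[of r] by (auto simp: R'_def)
    moreover have "c \<le> lead_coeff p / 2" unfolding c_def by (rule min.cobounded1)
    then have "c * r ^ n \<le> lead_coeff p / 2 * r ^ n" using r r0 by (intro mult_right_mono) auto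
    ultimately show ?thesis by linarith
  qed
  ultimately show thesis using that unfolding n_def by blast
qed

section \<open>The metric determined by an admissible polynomial\<close>

locale U2_poly =
  fixes m :: nat and a :: real and q :: "real poly" and h :: "real \<Rightarrow> real" and P :: "real poly" and D :: "real set"
  assumes m1: "1 \<le> m" and a0: "0 < a" and adm: "admissible m a q"
    and P_def: "P = Ppoly q" and D_def: "D = max_domain a P"
    and det: "determined_by q D h"
begin

lemma poly_P: "poly P r = r\<^sup>2 - poly q r"
  by (simp add: P_def Ppoly_def poly_monom)

lemma P_a: "poly P a = 0"
  using adm by (simp add: poly_P admissible_def)

lemma P'_a: "poly (pderiv P) a = m * a"
  using adm by (simp add: P_def Ppoly_def admissible_def pderiv_diff pderiv_monom poly_monom algebra_simps)

text \<open>The simple zero of \<open>P\<close> at \<open>a\<close> is split off. As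
  \<open>P1 a = m a > 0\<close>, statements about \<open>P\<close> near the degenerate endpoint
  become statements about a positive continuous function.\<close>

definition P1 :: "real poly" where "P1 = P div [:-a, 1:]"

lemma P_eq: "P = [:-a, 1:] * P1"
proof -
  have "[:-a, 1:] dvd P" using P_a by (simp only: poly_eq_0_iff_dvd)
  then show ?thesis by (simp only: P1_def dvd_mult_div_cancel)
qed

lemma poly_P_eq: "poly P r = (r - a) * poly P1 r"
  by (subst P_eq) (simp add: algebra_simps)

lemma P1_a: "poly P1 a = m * a"
proof -
  have "poly (pderiv P) a = poly P1 a"
    by (subst P_eq) (simp add: pderiv_mult pderiv_pCons del: mult_pCons_left)
  then show ?thesis using P'_a by simp
qed

lemma P1_near: assumes "0 < poly P1 r" obtains e where "0 < e" "\<And>s. dist s r < e \<Longrightarrow> 0 < poly P1 s"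
proof -
  have "(poly P1 \<longlongrightarrow> poly P1 r) (nhds r)" using poly_isCont by (simp add: isCont_def tendsto_nhds_iff)
  then have "\<forall>\<^sub>F s in nhds r. 0 < poly P1 s" using assms by (rule order_tendstoD)
  then show thesis using that unfolding eventually_nhds_metric by blast
qed

lemma near_a: obtains e where "0 < e" "\<And>r. a \<le> r \<Longrightarrow> r \<le> a + e \<Longrightarrow> 0 < poly P1 r"
proof -
  have "0 < poly P1 a" using P1_a m1 a0 by simp
  then obtain e where "0 < e" "\<And>r. dist r a < e \<Longrightarrow> 0 < poly P1 r" using P1_near by blast
  then show thesis by (intro that[of "e / 2"]) (auto simp: dist_real_def)
qed

lemma D_iff: "r \<in> D \<longleftrightarrow> a \<le> r \<and> (\<forall>s. a \<le> s \<and> s \<le> r \<longrightarrow> 0 < poly P1 s)"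
proof -
  have "0 < poly P1 a" using P1_a m1 a0 by simp
  then have "(\<forall>s\<in>{a<..r}. 0 < poly P s) \<longleftrightarrow> (\<forall>s. a \<le> s \<and> s \<le> r \<longrightarrow> 0 < poly P1 s)"
    by (auto simp: poly_P_eq zero_less_mult_iff less_eq_real_def)
  then show ?thesis by (auto simp: D_def max_domain_def)
qed

lemma a_in_D: "a \<in> D" using P1_a m1 a0 by (auto simp: D_iff)

lemma int_D_eq: "interior D = D - {a}"
proof
  show "interior D \<subseteq> D - {a}"
  proof
    fix r assume r: "r \<in> interior D"
    then obtain e where e: "0 < e" "ball r e \<subseteq> D" by (auto simp: mem_interior)
    then have "r - e / 2 \<in> D" by (auto simp: dist_real_def)
    then show "r \<in> D - {a}" using r interior_subset[of D] e(1) by (auto simp: D_iff)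
  qed
  show "D - {a} \<subseteq> interior D"
  proof
    fix r assume r: "r \<in> D - {a}"
    then have ar: "a < r" and Pr: "0 < poly P1 r" by (auto simp: D_iff)
    obtain e where e: "0 < e" "\<And>s. dist s r < e \<Longrightarrow> 0 < poly P1 s" using P1_near[OF Pr] by blast
    have "{a<..<r + e} \<subseteq> D"
    proof
      fix s assume s: "s \<in> {a<..<r + e}"
      have "0 < poly P1 t" if "a \<le> t" "t \<le> s" for t
        using r that s e(2)[of t] by (cases "t \<le> r") (auto simp: D_iff dist_real_def)
      then show "s \<in> D" using s by (auto simp: D_iff)
    qed
    then show "r \<in> interior D" using ar e(1) by (intro interiorI[of "{a<..<r + e}"]) auto
  qed
qed

lemma D_P: assumes "r \<in> interior D" shows "a < r" "0 < poly P r" "0 < r"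
  using assms a0 by (auto simp: int_D_eq D_iff poly_P_eq)

definition F :: "real \<Rightarrow> real" where "F r = poly q r / (r * poly P r)"
definition f :: "real \<Rightarrow> real" where "f r = poly q r / r ^ 3"

lemma w_eq: assumes "0 < r" shows "1 - r * f r = poly P r / r\<^sup>2"
  using assms by (simp add: f_def poly_P field_simps power2_eq_square power3_eq_cube)

lemma F_deriv: assumes "r \<in> interior D"
  shows "h differentiable (at r)" "(deriv h has_real_derivative F r) (at r)"
  using det assms by (auto simp: determined_by_def F_def poly_P)

text \<open>\<open>F (r - a) = q / (r P1)\<close> has no singularity on the compact interval from
  \<open>a\<close> to \<open>\<rho>\<close>.\<close>

lemma F_bounds: assumes \<rho>: "\<rho> \<in> D"
  shows "\<exists>C. \<forall>r. a < r \<and> r \<le> \<rho> \<longrightarrow> \<bar>F r\<bar> * (r - a) \<le> C \<and> \<bar>f r\<bar> \<le> C"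
proof -
  have P1: "0 < poly P1 r" if "r \<in> {a..\<rho>}" for r using \<rho> that by (auto simp: D_iff)
  have "continuous_on {a..\<rho>} (\<lambda>r. poly q r / (r * poly P1 r))" "continuous_on {a..\<rho>} f"
    unfolding f_def using P1 a0 by (intro continuous_intros; force)+
  then have "bounded ((\<lambda>r. poly q r / (r * poly P1 r)) ` {a..\<rho>})" "bounded (f ` {a..\<rho>})"
    by (auto intro!: compact_imp_bounded compact_continuous_image)
  then obtain A B where AB': "\<forall>x\<in>(\<lambda>r. poly q r / (r * poly P1 r)) ` {a..\<rho>}. \<bar>x\<bar> \<le> A" "\<forall>x\<in>f ` {a..\<rho>}. \<bar>x\<bar> \<le> B"
    unfolding bounded_real by blast
  then have AB: "\<bar>poly q r / (r * poly P1 r)\<bar> \<le> A" "\<bar>f r\<bar> \<le> B" if "r \<in> {a..\<rho>}" for r using that by blast+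
  have "\<bar>F r\<bar> * (r - a) \<le> max A B \<and> \<bar>f r\<bar> \<le> max A B" if r: "a < r" "r \<le> \<rho>" for r
  proof -
    have "\<bar>F r\<bar> * (r - a) = \<bar>poly q r / (r * poly P1 r)\<bar>"
      using r a0 by (simp add: F_def poly_P_eq abs_mult)
    then show ?thesis using AB[of r] r by auto
  qed
  then show ?thesis by blast
qed

sublocale U2_domain D h F f m a
proof
  show "open (interior D)" by simp
  show "0 < r" if "r \<in> interior D" for r using D_P(3)[OF that] .
  show "h differentiable (at r)" "(deriv h has_real_derivative F r) (at r)" if "r \<in> interior D" for r
    using F_deriv[OF that] .
  show "0 < 1 - r * f r" if "r \<in> interior D" for r
    unfolding w_eq[OF D_P(3)[OF that]] using D_P[OF that] by simp
  show "F r = f r / (1 - r * f r)" if "r \<in> interior D" for r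
    unfolding w_eq[OF D_P(3)[OF that]] using D_P[OF that] by (simp add: F_def f_def power2_eq_square power3_eq_cube)
  show "continuous_on (interior D) f" unfolding f_def using D_P by (intro continuous_intros) force
  show "interior D = D - {a}" by (rule int_D_eq)
  show "\<exists>\<rho>\<in>D. a < \<rho>"
  proof -
    obtain e where "0 < e" "\<And>r. a \<le> r \<Longrightarrow> r \<le> a + e \<Longrightarrow> 0 < poly P1 r" using near_a by blast
    then show ?thesis by (intro bexI[of _ "a + e"]) (auto simp: D_iff)
  qed
qed (use m1 a0 a_in_D F_bounds in \<open>auto simp: D_iff\<close>)

sublocale curvature_profile "interior D" h F f
  "\<lambda>r. poly (pderiv q) r / r ^ 3 - 3 * poly q r / r ^ 4"
  "\<lambda>r. poly (pderiv (pderiv q)) r / r ^ 3 - 6 * poly (pderiv q) r / r ^ 4 + 12 * poly q r / r ^ 5"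
proof
  fix r assume "r \<in> interior D"
  then have r: "0 < r" using D_P by simp
  show "(f has_real_derivative poly (pderiv q) r / r ^ 3 - 3 * poly q r / r ^ 4) (at r)"
    unfolding f_def[abs_def] using r by (auto intro!: derivative_eq_intros simp: field_simps eval_nat_numeral)
  show "((\<lambda>r. poly (pderiv q) r / r ^ 3 - 3 * poly q r / r ^ 4) has_real_derivative
      poly (pderiv (pderiv q)) r / r ^ 3 - 6 * poly (pderiv q) r / r ^ 4 + 12 * poly q r / r ^ 5) (at r)"
    using r by (auto intro!: derivative_eq_intros simp: field_simps eval_nat_numeral)
qed

lemma scalar_q:
  assumes "mom p \<in> MI"
  shows "scalar_curvature (U2_metric h) p = 2 * poly (pderiv (pderiv q)) (rad (mom p)) / rad (mom p)"
proof -
  have "0 < rad (mom p)" using assms a0 by (auto simp: MI_iff)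
  then show ?thesis unfolding scalar_curvature_eq[OF MI_pos_over[OF assms]]
    by (simp add: f_def field_simps eval_nat_numeral)
qed

lemma smooth_h: "smooth_fun_on h (interior D)"
proof (rule smooth_fun_on_second)
  show "smooth_fun_on (deriv (deriv h)) (interior D)"
  proof (rule smooth_rational)
    show "deriv (deriv h) r = poly q r / poly ([:0, 1:] * P) r" if "r \<in> interior D" for r
      using DERIV_imp_deriv[OF F_deriv(2)[OF that]] by (simp add: F_def)
    show "poly ([:0, 1:] * P) r \<noteq> 0" if "r \<in> interior D" for r using D_P[OF that] by simp
  qed simp
qed (use F_deriv in \<open>auto simp: real_differentiable_def\<close>)

lemma kaehler: "U2_kaehler m a D h"
  unfolding U2_kaehler_def
proof (intro conjI ballI)
  show "smooth_fun_on h (interior D)" by (rule smooth_h)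
  show "pos_def (hess (upot h) x)" if "x \<in> MI" for x by (rule pos_def_hess[OF MI_pos_over[OF that]])
  have qa: "poly q a = a\<^sup>2" using adm by (simp add: admissible_def)
  \<comment> \<open>The numerator of \<open>F - 1 / (m (r - a))\<close> over the common denominator.
    The values of \<open>q\<close> and \<open>P1\<close> at \<open>a\<close> give
    \<open>N a = 0\<close>, which cancels the pole.\<close>
  define N where "N = smult (real m) q - [:0, 1:] * P1"
  have "poly N a = 0" by (simp add: N_def qa P1_a power2_eq_square)
  then obtain N' where N': "N = [:-a, 1:] * N'" unfolding poly_eq_0_iff_dvd by (auto elim: dvdE)
  have N: "real m * poly q r - r * poly P1 r = (r - a) * poly N' r" for r
    using arg_cong[OF N', of "\<lambda>p. poly p r"] by (simp add: N_def algebra_simps)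
  let ?U = "{r. 0 < r \<and> 0 < poly P1 r}"
  show "smooth_up_to (\<lambda>r. deriv (deriv h) r - 1 / (real m * (r - a))) D"
    unfolding smooth_up_to_def
  proof (intro exI conjI ballI)
    show "open ?U" by (intro open_Collect_conj open_Collect_less continuous_intros)
    then show "smooth_fun_on (\<lambda>r. poly N' r / poly (smult (real m) ([:0, 1:] * P1)) r) ?U"
      using m1 by (intro smooth_rational[where p = N' and q = "smult (real m) ([:0, 1:] * P1)"]) auto
    show "D \<subseteq> ?U" using a0 by (auto simp: D_iff)
    fix r assume r: "r \<in> interior D"
    then have p: "a < r" "0 < poly P1 r" "0 < r" using D_P[OF r] by (auto simp: int_D_eq D_iff)
    have "deriv (deriv h) r - 1 / (real m * (r - a)) = F r - 1 / (real m * (r - a))"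
      using DERIV_imp_deriv[OF F_deriv(2)[OF r]] by simp
    also have "\<dots> = (real m * poly q r - r * poly P1 r) / (real m * r * (r - a) * poly P1 r)"
    proof -
      have "x / (r * (e * y)) - 1 / (real m * e) = (real m * x - r * y) / (real m * r * e * y)"
        if "e \<noteq> 0" "y \<noteq> 0" for e x y using that p(3) m1 by (simp add: field_simps)
      then show ?thesis using p by (simp add: F_def poly_P_eq)
    qed
    also have "\<dots> = poly N' r / poly (smult (real m) ([:0, 1:] * P1)) r"
      unfolding N using p m1 by simp
    finally show "deriv (deriv h) r - 1 / (real m * (r - a)) = poly N' r / poly (smult (real m) ([:0, 1:] * P1)) r" .
  qed
qed

end

section \<open>Balls compared with regions bounded by levels of \<open>r\<close>\<close>

context U2_domain
begin

lemma ball_upper: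
  assumes L: "lip K (\<lambda>p. u (rad (mom p)) :: real)" and p0: "mom p0 \<in> Pol" and p: "mom p \<in> MI"
    and b: "pt p \<in> Metric_space.mball (space_over m a D) dst (pt p0) R"
  shows "u (rad (mom p)) \<le> u (rad (mom p0)) + K * R"
proof -
  have d: "dst (pt p0) (pt p) < R" using b Metric_space.in_mball[OF Metric_space_dst] by blast
  have "\<bar>u (rad (mom p)) - u (rad (mom p0))\<bar> \<le> K * dst (pt p) (pt p0)"
    using lip_dst[OF L MI_Pol[OF p] p0] by simp
  also have "\<dots> \<le> K * R" using d L by (intro mult_left_mono) (auto simp: lip_def dst_commute)
  finally show ?thesis by simp
qed

text \<open>A path of bounded length leads from the base point to the level \<open>r0\<close> on the
  ray of \<open>p\<close>, and the radial path from there on to \<open>p\<close> costs at most the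
  increment of \<open>\<Psi>\<close>.\<close>

lemma dst_le_radial:
  assumes p0: "mom p0 \<in> Pol" and r0: "r0 \<in> D" "a < r0"
    and \<Psi>: "\<And>t. r0 \<le> t \<Longrightarrow> t \<in> D \<Longrightarrow> (\<Psi> has_real_derivative \<Psi>' t) (at t)"
    and b: "\<And>t. r0 \<le> t \<Longrightarrow> t \<in> D \<Longrightarrow> sqrt (1 / (2 * t * (1 - t * f t))) \<le> \<Psi>' t"
  obtains C where "\<And>p. mom p \<in> MI \<Longrightarrow> r0 \<le> rad (mom p) \<Longrightarrow> (\<And>j. 0 \<le> ang p $ j \<and> ang p $ j \<le> 2 * pi) \<Longrightarrow>
     dst (pt p0) (pt p) \<le> C + \<Psi> (rad (mom p))"
proof -
  obtain C where C: "\<And>p. mom p \<in> Pol \<Longrightarrow> rad (mom p) \<le> r0 \<Longrightarrow> (\<And>j. 0 \<le> ang p $ j \<and> ang p $ j \<le> 2 * pi) \<Longrightarrow> joined p0 p C"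
    using joined_base[OF p0 r0] by blast
  show thesis
  proof (rule that[of "C - \<Psi> r0"])
    fix p assume p: "mom p \<in> MI" "r0 \<le> rad (mom p)" "\<And>j. 0 \<le> ang p $ j \<and> ang p $ j \<le> 2 * pi"
    define s where "s = r0 / rad (mom p)"
    have rp: "0 < rad (mom p)" "rad (mom p) \<in> D" using p a_pos by (auto simp: MI_iff)
    define q :: coords where "q = (\<chi> i. case i of Inl j \<Rightarrow> s * p $ Inl j | Inr j \<Rightarrow> p $ Inr j)"
    have q: "mom q = s *\<^sub>R mom p" "ang q = ang p" by (auto simp: q_def mom_def ang_def vec_eq_iff)
    have rq: "rad (mom q) = r0" using rp by (simp add: q rad_scaleR s_def)
    have s: "0 < s" using rp r0 a_pos by (simp add: s_def)
    have Q: "mom q \<in> Pol" using rq r0 s p(1) unfolding mom_polygon_def by (auto simp: q MI_iff)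
    have "joined q p (\<Psi> (rad (mom p)) - \<Psi> r0)"
      by (rule joined_radial[where \<Psi>' = \<Psi>'])
         (use p q r0 rp \<Psi> b D_down[OF rp(2)] in \<open>auto simp: s_def\<close>)
    moreover have "joined p0 q C" by (rule C) (use Q rq p(3) q in auto)
    ultimately have "joined p0 p (C + (\<Psi> (rad (mom p)) - \<Psi> r0))" using joined_trans by blast
    then show "dst (pt p0) (pt p) \<le> C - \<Psi> r0 + \<Psi> (rad (mom p))" using dst_le by fastforce
  qed
qed

text \<open>A box with \<open>r\<close> between \<open>4 a\<close> and \<open>2 \<beta>\<close> lies
  in the ball. As \<open>2 a \<le> \<beta> / 2\<close>, its momenta still fill at least a quarter of
  the area \<open>\<beta>\<^sup>2\<close>.\<close>

lemma ball_volume_ge: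
  assumes p0: "mom p0 \<in> Pol" and D: "D = {a..}"
    and C: "\<And>p. mom p \<in> MI \<Longrightarrow> 4 * a \<le> rad (mom p) \<Longrightarrow> (\<And>j. 0 \<le> ang p $ j \<and> ang p $ j \<le> 2 * pi) \<Longrightarrow>
      dst (pt p0) (pt p) \<le> C + \<Psi> (rad (mom p))"
    and mono: "\<And>r s. 4 * a \<le> r \<Longrightarrow> r \<le> s \<Longrightarrow> \<Psi> r \<le> \<Psi> s"
    and \<beta>: "4 * a \<le> \<beta>" "C + \<Psi> (2 * \<beta>) < R"
  shows "ennreal (\<beta>\<^sup>2 * (pi\<^sup>2 / (4 * m))) \<le> ball_volume m a D h (pt p0) R"
proof -
  have "ennreal ((\<beta> - 2 * a)\<^sup>2 * (pi / m) * pi) \<le> ball_volume m a D h (pt p0) R"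
    unfolding ball_volume_def
  proof (rule volume_ge)
    fix p assume p: "mom p \<in> MI" "2 * (2 * a) \<le> rad (mom p)" "rad (mom p) \<le> 2 * \<beta>" "\<And>j. 0 \<le> ang p $ j \<and> ang p $ j \<le> 2 * pi"
    have "dst (pt p0) (pt p) \<le> C + \<Psi> (rad (mom p))" by (rule C) (use p in auto)
    also have "\<dots> \<le> C + \<Psi> (2 * \<beta>)" using mono[of "rad (mom p)" "2 * \<beta>"] p by simp
    finally have "dst (pt p0) (pt p) < R" using \<beta> by simp
    moreover have "pt p0 \<in> space_over m a D" "pt p \<in> space_over m a D"
      using p0 MI_Pol[OF p(1)] by (auto simp: space_over_def)
    ultimately show "pt p \<in> Metric_space.mball (space_over m a D) dst (pt p0) R"
      by (simp add: Metric_space.in_mball[OF Metric_space_dst])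
  qed (use a_pos \<beta> D in auto)
  moreover have "\<beta>\<^sup>2 * (pi\<^sup>2 / (4 * m)) \<le> (\<beta> - 2 * a)\<^sup>2 * (pi / m) * pi"
  proof -
    have "(\<beta> / 2)\<^sup>2 \<le> (\<beta> - 2 * a)\<^sup>2" using \<beta> a_pos by (intro power_mono) auto
    then have "(\<beta> / 2)\<^sup>2 * (pi\<^sup>2 / m) \<le> (\<beta> - 2 * a)\<^sup>2 * (pi\<^sup>2 / m)" by (intro mult_right_mono) auto
    then show ?thesis by (simp add: power2_eq_square)
  qed
  ultimately show ?thesis by (meson ennreal_leI order_trans)
qed

end

context U2_poly
begin

lemma w_P: assumes "r \<in> interior D" shows "2 * r * (1 - r * f r) = 2 * poly P r / r"
  using w_eq[OF D_P(3)[OF assms]] D_P(3)[OF assms] by (simp add: power2_eq_square)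

text \<open>\<open>P1\<close> is positive at \<open>a\<close>, and the intermediate value theorem
  keeps it so up to its first zero.\<close>

lemma P1_pos_if_no_zero:
  assumes nz: "\<And>s. a < s \<Longrightarrow> s \<le> r \<Longrightarrow> poly P s \<noteq> 0" and r: "a \<le> r"
  shows "r \<in> D"
proof -
  have a: "0 < poly P1 a" using P1_a m1 a0 by simp
  have nz1: "poly P1 s \<noteq> 0" if "a \<le> s" "s \<le> r" for s
    using nz[of s] that a by (cases "s = a") (auto simp: poly_P_eq)
  have "0 < poly P1 s" if s: "a \<le> s" "s \<le> r" for s
  proof (rule ccontr)
    assume "\<not> 0 < poly P1 s"
    then have "poly P1 s < 0" using nz1[OF s] by simp
    then have "\<exists>x>a. x < s \<and> poly P1 x = 0" using a s by (intro poly_IVT_neg) (cases "s = a", auto)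
    then show False using nz1 s by force
  qed
  then show ?thesis using r by (auto simp: D_iff)
qed

lemma D_whole: assumes "\<And>r. a < r \<Longrightarrow> poly P r \<noteq> 0" shows "D = {a..}"
  using P1_pos_if_no_zero assms by (auto simp: D_iff)

lemma D_until: assumes "a < b" "poly P b = 0" "\<And>r. a < r \<Longrightarrow> r < b \<Longrightarrow> poly P r \<noteq> 0" shows "D = {a..<b}"
proof -
  have "poly P1 b = 0" using assms by (simp add: poly_P_eq)
  then have "\<not> b \<le> r" if "r \<in> D" for r using that assms(1) by (auto simp: D_iff) (metis less_imp_le order_refl less_irrefl)
  moreover have "r \<in> D" if "a \<le> r" "r < b" for r by (rule P1_pos_if_no_zero) (use assms(3) that in auto)
  ultimately show ?thesis using D_ge by (fastforce simp: not_le)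
qed

section \<open>The case without zeros of \<open>P\<close> beyond \<open>a\<close>\<close>

context
  assumes whole: "D = {a..}"
begin

lemma P_pos: "a < r \<Longrightarrow> 0 < poly P r"
  using D_P(2)[of r] by (auto simp: int_D_eq whole)

lemma int_whole: "interior D = {a<..}"
  by (auto simp: int_D_eq whole)

text \<open>The bound has to start beyond \<open>a\<close>, where \<open>P\<close> vanishes;
  \<open>4 a\<close> is the inner radius used in \<open>ball_volume_ge\<close>.\<close>

lemma P_ge: obtains c where "0 < c" "\<And>t. 4 * a \<le> t \<Longrightarrow> c * t ^ degree P \<le> poly P t"
proof (rule poly_ge_power)
  show "0 < poly P r" if "4 * a \<le> r" for r using that a0 by (intro P_pos) auto
qed (use a0 in auto)

lemma radial_speed_le:
  assumes c: "0 < c" "c * t ^ k \<le> poly P t" and t: "a < t"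
  shows "sqrt (1 / (2 * t * (1 - t * f t))) \<le> sqrt (t / (2 * (c * t ^ k)))"
proof -
  have tI: "t \<in> interior D" using t by (simp add: int_whole)
  have "1 / (2 * t * (1 - t * f t)) = t / (2 * poly P t)" unfolding w_P[OF tI] by simp
  also have "\<dots> \<le> t / (2 * (c * t ^ k))"
    using c t a0 P_pos[OF t] by (intro divide_left_mono) auto
  finally show ?thesis by (rule real_sqrt_le_mono)
qed

text \<open>In degree 4 the radial length element is at most a multiple of
  \<open>1 / (t * sqrt t)\<close>, so infinity lies at finite distance: points moving out along one
  ray form a Cauchy sequence. It has no limit, since a cutoff separates any given point from all
  points with large \<open>r\<close>.\<close>

lemma incomplete:
  assumes deg: "degree P = 4"
  shows "\<not> complete_metric m a D h"
proof
  assume "complete_metric m a D h"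
  then have mc: "Metric_space.mcomplete (space_over m a D) dst" by (simp add: complete_metric_def)
  interpret M: Metric_space "space_over m a D" dst by (rule Metric_space_dst)
  obtain c where c: "0 < c" "\<And>t. 4 * a \<le> t \<Longrightarrow> c * t ^ 4 \<le> poly P t" using P_ge unfolding deg by blast
  define L where "L = 1 / sqrt (2 * c)"
  have L: "0 < L" using c by (simp add: L_def)
  have speed: "sqrt (1 / (2 * t * (1 - t * f t))) \<le> L / (t * sqrt t)" if t: "4 * a \<le> t" for t
  proof -
    have t0: "a < t" "0 < t" using t a0 by auto
    have "sqrt (1 / (2 * t * (1 - t * f t))) \<le> sqrt (t / (2 * (c * t ^ 4)))"
      by (rule radial_speed_le[OF c(1) c(2)[OF t] t0(1)])
    also have "t / (2 * (c * t ^ 4)) = 1 / (2 * c * (t ^ 2 * t))" using t0 by (simp add: eval_nat_numeral)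
    also have "sqrt \<dots> = L / (t * sqrt t)" using t0 by (simp add: L_def real_sqrt_divide real_sqrt_mult)
    finally show ?thesis .
  qed
  \<comment> \<open>The primitive of \<open>L / (t * sqrt t)\<close> that vanishes at
    infinity.\<close>
  define \<Psi> where "\<Psi> = (\<lambda>t. - (2 * L) / sqrt t)"
  have d\<Psi>: "(\<Psi> has_real_derivative L / (t * sqrt t)) (at t)" if "4 * a \<le> t" for t
  proof -
    have t0: "0 < t" using that a0 by auto
    show ?thesis unfolding \<Psi>_def using t0
      by (auto intro!: derivative_eq_intros simp: divide_simps) 
  qed
  define r where "r = (\<lambda>n::nat. 4 * a + real n)"
  define p :: "nat \<Rightarrow> coords" where "p = (\<lambda>n. \<chi> i. case i of Inl j \<Rightarrow> r n / 2 | Inr j \<Rightarrow> 0)"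
  have mp: "mom (p n) = (\<chi> i. r n / 2)" "ang (p n) = 0" "rad (mom (p n)) = r n" for n
    by (auto simp: p_def mom_def ang_def vec_eq_iff rad_def)
  have rn: "0 < r n" "4 * a \<le> r n" "a < r n" for n using a0 by (auto simp: r_def)
  have pMI: "mom (p n) \<in> MI" for n unfolding MI_iff mp(3) using rn[of n] by (simp add: mp(1) whole)
  have le: "dst (pt (p i)) (pt (p j)) \<le> 2 * L / sqrt (r i)" if "i \<le> j" for i j
  proof -
    have ij: "r i \<le> r j" using that by (simp add: r_def)
    have "joined (p i) (p j) (\<Psi> (rad (mom (p j))) - \<Psi> (r i))"
    proof (rule joined_radial[where \<Psi>' = "\<lambda>t. L / (t * sqrt t)"])
      show "mom (p i) = (r i / rad (mom (p j))) *\<^sub>R mom (p j)" unfolding mp(3) using rn[of j] by (simp add: mp(1) vec_eq_iff)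
      show "(\<Psi> has_real_derivative L / (t * sqrt t)) (at t)" "sqrt (1 / (2 * t * (1 - t * f t))) \<le> L / (t * sqrt t)"
        if "r i \<le> t" for t
        using order_trans[OF rn(2) that] by (rule d\<Psi>, rule speed)
    qed (use pMI rn ij in \<open>auto simp: mp(2,3)\<close>)
    then have "dst (pt (p i)) (pt (p j)) \<le> \<Psi> (r j) - \<Psi> (r i)" unfolding mp(3) by (rule dst_le)
    also have "\<dots> \<le> 2 * L / sqrt (r i)" using L rn[of j] by (simp add: \<Psi>_def)
    finally show ?thesis .
  qed
  have "M.MCauchy (\<lambda>n. pt (p n))"
    unfolding M.MCauchy_def
  proof (intro conjI allI impI)
    show "range (\<lambda>n. pt (p n)) \<subseteq> space_over m a D" using pMI MI_Pol by (auto simp: space_over_def)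
    fix \<epsilon> :: real assume e: "0 < \<epsilon>"
    obtain N :: nat where N: "(2 * L / \<epsilon>)\<^sup>2 < real N" using reals_Archimedean2 by blast
    have small: "2 * L / sqrt (r n) < \<epsilon>" if "N \<le> n" for n
    proof -
      have "(2 * L / \<epsilon>)\<^sup>2 < r n" using N that a0 by (simp add: r_def)
      then have "sqrt ((2 * L / \<epsilon>)\<^sup>2) < sqrt (r n)" by (rule real_sqrt_less_mono)
      then have "2 * L / \<epsilon> < sqrt (r n)" using L e by simp
      then show ?thesis using e rn[of n] by (simp add: field_simps)
    qed
    show "\<exists>N. \<forall>n n'. N \<le> n \<longrightarrow> N \<le> n' \<longrightarrow> dst (pt (p n)) (pt (p n')) < \<epsilon>"
    proof (intro exI[of _ N] allI impI)
      fix n n' assume n: "N \<le> n" "N \<le> n'"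
      show "dst (pt (p n)) (pt (p n')) < \<epsilon>"
      proof (cases "n \<le> n'")
        case True then show ?thesis using le[OF True] small[OF n(1)] by simp
      next
        case False then have "n' \<le> n" by simp
        then show ?thesis using le[of n' n] small[OF n(2)] by (simp add: dst_commute)
      qed
    qed
  qed
  then obtain A where A: "limitin M.mtopology (\<lambda>n. pt (p n)) A sequentially"
    using mc unfolding M.mcomplete_def by blast
  then have "A \<in> space_over m a D" by (simp add: M.limit_metric_sequentially)
  then obtain l where l: "A = pt l" "mom l \<in> Pol" by (rule space_overE)
  \<comment> \<open>With this radius the cutoff is 1 at the supposed limit and 0 far out, so the far
    points stay at distance at least \<open>1 / K\<close>.\<close>
  define \<rho> where "\<rho> = rad (mom l) + 1"
  have \<rho>: "\<rho> \<in> D" using PolD[OF l(2)] by (simp add: whole \<rho>_def)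
  obtain K where K: "lip K (\<lambda>p. complex_of_real (cutoff \<rho> (rad (mom p))))" by (rule lip_rad[OF \<rho>])
  have K0: "0 < K" using K by (simp add: lip_def)
  obtain N where N: "\<And>n. n \<ge> N \<Longrightarrow> dst (pt (p n)) A < 1 / K"
    using A K0 unfolding M.limit_metric_sequentially by (metis divide_pos_pos zero_less_one)
  obtain n :: nat where n: "\<rho> < real n" using reals_Archimedean2 by blast
  let ?n = "max n N"
  have "\<rho> \<le> r ?n" using n a0 by (simp add: r_def)
  then have "cutoff \<rho> (rad (mom (p ?n))) = 0" unfolding mp(3) by (simp add: cutoff_def)
  moreover have "cutoff \<rho> (rad (mom l)) = 1" by (simp add: cutoff_def \<rho>_def)
  ultimately have "1 \<le> K * dst (pt (p ?n)) (pt l)"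
    using lip_dst[OF K MI_Pol[OF pMI] l(2), of ?n] by simp
  also have "\<dots> < K * (1 / K)" using N[of ?n] K0 l by (intro mult_strict_left_mono) auto
  finally show False using K0 by simp
qed

text \<open>The squared gradient of \<open>ln r\<close> is \<open>2 P / r^3\<close>, bounded when
  the degree is at most 3.\<close>

lemma lip_ln:
  assumes deg: "degree P \<le> 3"
  obtains K where "lip K (\<lambda>p. ln (rad (mom p)))"
proof -
  obtain C where C: "0 < C" "\<And>r. a \<le> r \<Longrightarrow> \<bar>poly P r\<bar> \<le> C * r ^ 3" using poly_abs_le[OF deg a0] by blast
  have "lip (sqrt (2 * C)) (\<lambda>p. ln (rad (mom p)))"
  proof (rule lip_radial[where u' = "\<lambda>r. 1 / r"])
    show "continuous_on D ln" using a0 by (intro continuous_intros) (auto simp: whole)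
    fix r assume r: "r \<in> interior D"
    then have r0: "a < r" "0 < r" using a0 by (auto simp: int_whole)
    show "(ln has_real_derivative 1 / r) (at r)" using r0 by (auto intro!: derivative_eq_intros)
    have "(1 / r)\<^sup>2 * (2 * r * (1 - r * f r)) = 2 * (poly P r / r ^ 3)"
      unfolding w_P[OF r] using r0 by (simp add: eval_nat_numeral)
    also have "\<dots> \<le> 2 * C" using C(2)[of r] r0 by (simp add: field_simps)
    finally show "(1 / r)\<^sup>2 * (2 * r * (1 - r * f r)) \<le> (sqrt (2 * C))\<^sup>2" using C by simp
  qed (use C in simp)
  then show thesis by (rule that)
qed

lemma complete:
  assumes deg: "degree P \<le> 3"
  shows "complete_metric m a D h"
proof -
  obtain K where K: "lip K (\<lambda>p. ln (rad (mom p)))" using lip_ln[OF deg] by blast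
  show ?thesis unfolding complete_metric_def
  proof (rule mcomplete_criterion[where u = ln and K = K])
    show "closed (D \<inter> {..\<rho>})" for \<rho> by (simp add: whole closed_Int)
    show "\<bar>ln (rad (mom p)) - ln (rad (mom q))\<bar> \<le> K * dst (pt p) (pt q)" if "mom p \<in> Pol" "mom q \<in> Pol" for p q
      using lip_dst[OF K that] by simp
    show "0 \<le> K" using K by (simp add: lip_def)
    fix B :: real
    have "r \<le> max a (exp B)" if "r \<in> D" "ln r \<le> B" for r
    proof -
      have "0 < r" using that a0 by (auto simp: whole)
      then have "r \<le> exp B" using that(2) by (metis exp_le_cancel_iff exp_ln)
      then show ?thesis by simp
    qed
    then show "\<exists>\<rho>\<in>D. \<forall>r\<in>D. ln r \<le> B \<longrightarrow> r \<le> \<rho>" by (intro bexI[of _ "max a (exp B)"]) (auto simp: whole)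
  qed simp
qed

text \<open>In degree 2 the distance is bounded above and below by \<open>sqrt r\<close> up to
  constants, so a ball of radius \<open>R\<close> reaches to \<open>r\<close> of order
  \<open>R\<^sup>2\<close>, and the volume below a level \<open>r\<close> is of order
  \<open>r\<^sup>2\<close>.\<close>

lemma quartic:
  assumes deg: "degree P = 2"
  shows "quartic_volume_growth m a D h"
  unfolding quartic_volume_growth_def
proof
  fix A assume "A \<in> space_over m a D"
  then obtain p0 where p0: "A = pt p0" "mom p0 \<in> Pol" by (rule space_overE)
  obtain C where C: "0 < C" "\<And>r. a \<le> r \<Longrightarrow> \<bar>poly P r\<bar> \<le> C * r ^ 2" using poly_abs_le[of P 2 a] deg a0 by auto
  define K where "K = sqrt (C / 2)"
  have K0: "0 < K" using C by (simp add: K_def)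
  have K: "lip K (\<lambda>p. sqrt (rad (mom p)))"
  proof (rule lip_radial[where u' = "\<lambda>r. 1 / (2 * sqrt r)", OF K0])
    show "continuous_on D sqrt" by (intro continuous_intros)
    fix r assume r: "r \<in> interior D"
    then have r0: "a < r" "0 < r" using a0 by (auto simp: int_whole)
    show "(sqrt has_real_derivative 1 / (2 * sqrt r)) (at r)" using r0 by (auto intro!: derivative_eq_intros simp: field_simps)
    have "(1 / (2 * sqrt r))\<^sup>2 * (2 * r * (1 - r * f r)) = (poly P r / r ^ 2) / 2"
      unfolding w_P[OF r] using r0 by (simp add: power2_eq_square)
    also have "\<dots> \<le> C / 2" using C(2)[of r] r0 by (simp add: field_simps)
    finally show "(1 / (2 * sqrt r))\<^sup>2 * (2 * r * (1 - r * f r)) \<le> K\<^sup>2" using C by (simp add: K_def)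
  qed
  define s where "s = sqrt (rad (mom p0))"
  have s0: "0 \<le> s" using PolD[OF p0(2)] a0 by (simp add: s_def)
  have up: "ball_volume m a D h A R \<le> ennreal ((s + K) ^ 4 * (2 * pi) * (2 * pi) * R ^ 4)" if R: "1 \<le> R" for R
  proof -
    have "ball_volume m a D h A R \<le> ennreal (((s + K * R)\<^sup>2)\<^sup>2 * (2 * pi) * (2 * pi))"
      unfolding ball_volume_def p0(1)
    proof (rule volume_le)
      fix p assume p: "mom p \<in> MI" "pt p \<in> Metric_space.mball (space_over m a D) dst (pt p0) R"
      have "sqrt (rad (mom p)) \<le> s + K * R" unfolding s_def by (rule ball_upper[OF K p0(2) p])
      moreover have "0 \<le> rad (mom p)" using p a0 by (auto simp: MI_iff)
      ultimately show "rad (mom p) \<le> (s + K * R)\<^sup>2" by (metis real_sqrt_le_iff real_sqrt_pow2 power_mono real_sqrt_ge_zero)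
    qed simp
    also have "((s + K * R)\<^sup>2)\<^sup>2 * (2 * pi) * (2 * pi) \<le> (s + K) ^ 4 * (2 * pi) * (2 * pi) * R ^ 4"
    proof -
      have "s * 1 \<le> s * R" using R s0 by (intro mult_left_mono) auto
      then have "s + K * R \<le> (s + K) * R" by (simp add: algebra_simps)
      then have "(s + K * R) ^ 4 \<le> ((s + K) * R) ^ 4" using s0 K0 R by (intro power_mono) auto
      then show ?thesis by (simp add: power_mult_distrib flip: power_mult)
    qed
    finally show ?thesis by (simp add: ennreal_leI)
  qed
  obtain c where c: "0 < c" "\<And>t. 4 * a \<le> t \<Longrightarrow> c * t ^ 2 \<le> poly P t" using P_ge unfolding deg by blast
  define L where "L = 2 / sqrt (2 * c)"
  have L: "0 < L" using c by (simp add: L_def)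
  obtain B where B: "\<And>p. mom p \<in> MI \<Longrightarrow> 4 * a \<le> rad (mom p) \<Longrightarrow> (\<And>j. 0 \<le> ang p $ j \<and> ang p $ j \<le> 2 * pi) \<Longrightarrow>
     dst (pt p0) (pt p) \<le> B + L * sqrt (rad (mom p))"
  proof (rule dst_le_radial[OF p0(2), of "4 * a" "\<lambda>t. L * sqrt t" "\<lambda>t. L / (2 * sqrt t)"])
    fix t assume t: "4 * a \<le> t"
    then have t0: "a < t" "0 < t" using a0 by auto
    show "((\<lambda>t. L * sqrt t) has_real_derivative L / (2 * sqrt t)) (at t)"
      using t0 by (auto intro!: derivative_eq_intros simp: field_simps)
    have "sqrt (1 / (2 * t * (1 - t * f t))) \<le> sqrt (t / (2 * (c * t ^ 2)))"
      by (rule radial_speed_le[OF c(1) c(2)[OF t] t0(1)])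
    also have "t / (2 * (c * t ^ 2)) = 1 / (2 * c * t)" using t0 by (simp add: power2_eq_square)
    also have "sqrt \<dots> = L / (2 * sqrt t)" using t0 by (simp add: L_def real_sqrt_divide real_sqrt_mult)
    finally show "sqrt (1 / (2 * t * (1 - t * f t))) \<le> L / (2 * sqrt t)" .
  qed (use a0 in \<open>auto simp: whole\<close>)
  have low: "ennreal ((1 / (8 * L\<^sup>2))\<^sup>2 * (pi\<^sup>2 / (4 * m)) * R ^ 4) \<le> ball_volume m a D h A R"
    if R: "R \<ge> 2 * B + 1" "R \<ge> 1" "R \<ge> 32 * a * L\<^sup>2" for R
  proof -
    \<comment> \<open>Chosen so that \<open>L * sqrt (2 * \<beta>) = R / 2\<close>; the other half
      of \<open>R\<close> absorbs \<open>B\<close>.\<close>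
    define \<beta> where "\<beta> = R\<^sup>2 / (8 * L\<^sup>2)"
    have "R * 1 \<le> R * R" using R(2) by (intro mult_left_mono) auto
    then have b: "4 * a \<le> \<beta>" using R(3) L by (simp add: \<beta>_def field_simps power2_eq_square)
    have "sqrt (2 * \<beta>) = R / (2 * L)"
    proof (rule real_sqrt_unique)
      show "(R / (2 * L))\<^sup>2 = 2 * \<beta>" by (simp add: \<beta>_def power_divide power_mult_distrib)
    qed (use R L in simp)
    then have "L * sqrt (2 * \<beta>) = R / 2" using L by simp
    then have lt: "B + L * sqrt (2 * \<beta>) < R" using R(1) by simp
    have "ennreal (\<beta>\<^sup>2 * (pi\<^sup>2 / (4 * m))) \<le> ball_volume m a D h A R"
      unfolding p0(1) by (rule ball_volume_ge[OF p0(2) whole B _ b lt]) (use L in auto)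
    moreover have "\<beta>\<^sup>2 * (pi\<^sup>2 / (4 * m)) = (1 / (8 * L\<^sup>2))\<^sup>2 * (pi\<^sup>2 / (4 * m)) * R ^ 4"
      by (simp add: \<beta>_def power_divide flip: power_mult)
    ultimately show ?thesis by metis
  qed
  have "\<forall>\<^sub>F R in at_top. ennreal ((1 / (8 * L\<^sup>2))\<^sup>2 * (pi\<^sup>2 / (4 * m)) * R ^ 4) \<le> ball_volume m a D h A R \<and>
      ball_volume m a D h A R \<le> ennreal ((s + K) ^ 4 * (2 * pi) * (2 * pi) * R ^ 4)"
    using eventually_ge_at_top[of "2 * B + 1"] eventually_ge_at_top[of 1] eventually_ge_at_top[of "32 * a * L\<^sup>2"]
    by eventually_elim (use up low in blast)
  moreover have "0 < (1 / (8 * L\<^sup>2))\<^sup>2 * (pi\<^sup>2 / (4 * m))" "0 < (s + K) ^ 4 * (2 * pi) * (2 * pi)"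
    using L m1 s0 K0 by auto
  ultimately show "\<exists>C\<^sub>1>0. \<exists>C\<^sub>2>0. \<forall>\<^sub>F R in at_top. ennreal (C\<^sub>1 * R ^ 4) \<le> ball_volume m a D h A R \<and>
      ball_volume m a D h A R \<le> ennreal (C\<^sub>2 * R ^ 4)" by blast
qed

text \<open>In degree 3 the distance is logarithmic in \<open>r\<close>, so \<open>r\<close> is
  exponential in \<open>R\<close>, and so is the volume, which is of order
  \<open>r\<^sup>2\<close>.\<close>

lemma exponential:
  assumes deg: "degree P = 3"
  shows "exponential_volume_growth m a D h"
  unfolding exponential_volume_growth_def
proof
  fix A assume "A \<in> space_over m a D"
  then obtain p0 where p0: "A = pt p0" "mom p0 \<in> Pol" by (rule space_overE)
  obtain K where K: "lip K (\<lambda>p. ln (rad (mom p)))" using lip_ln deg by auto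
  have K0: "0 < K" using K by (simp add: lip_def)
  define r0 where "r0 = rad (mom p0)"
  have r0: "0 < r0" using PolD[OF p0(2)] a0 by (simp add: r0_def)
  have up: "ball_volume m a D h A R \<le> ennreal (r0\<^sup>2 * (2 * pi) * (2 * pi) * exp (2 * K * R))" for R
  proof -
    have "ball_volume m a D h A R \<le> ennreal ((r0 * exp (K * R))\<^sup>2 * (2 * pi) * (2 * pi))"
      unfolding ball_volume_def p0(1)
    proof (rule volume_le)
      fix p assume p: "mom p \<in> MI" "pt p \<in> Metric_space.mball (space_over m a D) dst (pt p0) R"
      have "ln (rad (mom p)) \<le> ln r0 + K * R" unfolding r0_def by (rule ball_upper[OF K p0(2) p])
      moreover have "0 < rad (mom p)" using p a0 by (auto simp: MI_iff)
      ultimately have "rad (mom p) \<le> exp (ln r0 + K * R)" by (metis exp_le_cancel_iff exp_ln)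
      then show "rad (mom p) \<le> r0 * exp (K * R)" using r0 by (simp add: exp_add)
    qed (use r0 in simp)
    also have "(r0 * exp (K * R))\<^sup>2 * (2 * pi) * (2 * pi) = r0\<^sup>2 * (2 * pi) * (2 * pi) * exp (2 * K * R)"
      by (simp add: power_mult_distrib power2_eq_square flip: exp_add)
    finally show ?thesis .
  qed
  obtain c where c: "0 < c" "\<And>t. 4 * a \<le> t \<Longrightarrow> c * t ^ 3 \<le> poly P t" using P_ge unfolding deg by blast
  define L where "L = 1 / sqrt (2 * c)"
  have L: "0 < L" using c by (simp add: L_def)
  obtain B where B: "\<And>p. mom p \<in> MI \<Longrightarrow> 4 * a \<le> rad (mom p) \<Longrightarrow> (\<And>j. 0 \<le> ang p $ j \<and> ang p $ j \<le> 2 * pi) \<Longrightarrow>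
     dst (pt p0) (pt p) \<le> B + L * ln (rad (mom p))"
  proof (rule dst_le_radial[OF p0(2), of "4 * a" "\<lambda>t. L * ln t" "\<lambda>t. L / t"])
    fix t assume t: "4 * a \<le> t"
    then have t0: "a < t" "0 < t" using a0 by auto
    show "((\<lambda>t. L * ln t) has_real_derivative L / t) (at t)"
      using t0 by (auto intro!: derivative_eq_intros)
    have "sqrt (1 / (2 * t * (1 - t * f t))) \<le> sqrt (t / (2 * (c * t ^ 3)))"
      by (rule radial_speed_le[OF c(1) c(2)[OF t] t0(1)])
    also have "t / (2 * (c * t ^ 3)) = 1 / (2 * c * t\<^sup>2)" using t0 by (simp add: eval_nat_numeral)
    also have "sqrt \<dots> = L / t" using t0 by (simp add: L_def real_sqrt_divide real_sqrt_mult)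
    finally show "sqrt (1 / (2 * t * (1 - t * f t))) \<le> L / t" .
  qed (use a0 in \<open>auto simp: whole\<close>)
  have low: "ennreal (pi\<^sup>2 / (16 * m) * exp (1 / L * R)) \<le> ball_volume m a D h A R"
    if R: "R \<ge> 2 * B + 1" "R \<ge> 2 * L * ln (8 * a)" for R
  proof -
    \<comment> \<open>Chosen so that \<open>L * ln (2 * \<beta>) = R / 2\<close>.\<close>
    define \<beta> where "\<beta> = exp (R / (2 * L)) / 2"
    have "ln (8 * a) \<le> R / (2 * L)" using R(2) L by (simp add: field_simps)
    then have "8 * a \<le> exp (R / (2 * L))" using a0 by (metis exp_le_cancel_iff exp_ln mult_pos_pos zero_less_numeral)
    then have b: "4 * a \<le> \<beta>" by (simp add: \<beta>_def)
    have "L * ln (2 * \<beta>) = R / 2" using L by (simp add: \<beta>_def)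
    then have lt: "B + L * ln (2 * \<beta>) < R" using R(1) by simp
    have "ennreal (\<beta>\<^sup>2 * (pi\<^sup>2 / (4 * m))) \<le> ball_volume m a D h A R"
      unfolding p0(1) by (rule ball_volume_ge[OF p0(2) whole B _ b lt]) (use L a0 in auto)
    moreover have "\<beta>\<^sup>2 * (pi\<^sup>2 / (4 * m)) = pi\<^sup>2 / (16 * m) * exp (1 / L * R)"
    proof -
      have e: "\<beta>\<^sup>2 = exp (1 / L * R) / 4" using L by (simp add: \<beta>_def power2_eq_square field_simps flip: exp_add)
      show ?thesis unfolding e by simp
    qed
    ultimately show ?thesis by metis
  qed
  have "\<forall>\<^sub>F R in at_top. ennreal (pi\<^sup>2 / (16 * m) * exp (1 / L * R)) \<le> ball_volume m a D h A R \<and>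
      ball_volume m a D h A R \<le> ennreal (r0\<^sup>2 * (2 * pi) * (2 * pi) * exp (2 * K * R))"
    using eventually_ge_at_top[of "2 * B + 1"] eventually_ge_at_top[of "2 * L * ln (8 * a)"]
    by eventually_elim (use up low in blast)
  moreover have "0 < pi\<^sup>2 / (16 * m)" "0 < 1 / L" "0 < r0\<^sup>2 * (2 * pi) * (2 * pi)" "0 < 2 * K"
    using L m1 r0 K0 by auto
  ultimately show "\<exists>C\<^sub>1>0. \<exists>c\<^sub>1>0. \<exists>C\<^sub>2>0. \<exists>c\<^sub>2>0. \<forall>\<^sub>F R in at_top.
        ennreal (C\<^sub>1 * exp (c\<^sub>1 * R)) \<le> ball_volume m a D h A R \<and>
        ball_volume m a D h A R \<le> ennreal (C\<^sub>2 * exp (c\<^sub>2 * R))" by blast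
qed

end

end

section \<open>The case of a first zero \<open>b\<close> of \<open>P\<close>\<close>

context U2_poly
begin

context
  fixes b :: real
  assumes ab: "a < b" and Pb: "poly P b = 0" and D_b: "D = {a..<b}"
begin

lemma int_b: "interior D = {a<..<b}"
  by (auto simp: int_D_eq D_b)

text \<open>At a multiple zero \<open>P / (b - r)\<^sup>2\<close> is bounded, so
  \<open>- ln (b - r)\<close> is Lipschitz. It tends to infinity at \<open>b\<close>, which provides
  the properness that completeness needs.\<close>

lemma complete_end_double_zero:
  assumes ord: "1 < order b P"
  shows "complete_end m a b h"
proof -
  have "[:-b, 1:] ^ 2 dvd P" unfolding order_divides using ord by simp
  then obtain P2 where P2: "P = [:-b, 1:] ^ 2 * P2" by (rule dvdE)
  have PP: "poly P r = (b - r)\<^sup>2 * poly P2 r" for r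
    unfolding P2 by (simp add: power2_eq_square algebra_simps)
  have "bounded (poly P2 ` {a..b})"
    by (intro compact_imp_bounded compact_continuous_image continuous_intros) auto
  then obtain B where B: "\<And>r. r \<in> {a..b} \<Longrightarrow> \<bar>poly P2 r\<bar> \<le> B" unfolding bounded_real by blast
  \<comment> \<open>The squared gradient is \<open>2 * P2 / r\<close> with \<open>r > a\<close>; the
    summand 1 keeps \<open>K\<close> positive.\<close>
  define K where "K = sqrt (2 * (\<bar>B\<bar> + 1) / a)"
  have K0: "0 < K" using a0 by (simp add: K_def)
  have K: "lip K (\<lambda>p. - ln (b - rad (mom p)))"
  proof (rule lip_radial[where u' = "\<lambda>r. 1 / (b - r)", OF K0])
    show "continuous_on D (\<lambda>r. - ln (b - r))" by (intro continuous_intros) (auto simp: D_b)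
    fix r assume r: "r \<in> interior D"
    then have r0: "a < r" "r < b" "0 < r" using a0 by (auto simp: int_b)
    show "((\<lambda>r. - ln (b - r)) has_real_derivative 1 / (b - r)) (at r)"
      using r0 by (auto intro!: derivative_eq_intros)
    have "(1 / (b - r))\<^sup>2 * (2 * r * (1 - r * f r)) = 2 * poly P2 r / r"
      unfolding w_P[OF r] PP using r0 by (simp add: power_divide)
    also have "\<dots> \<le> 2 * (\<bar>B\<bar> + 1) / a"
      using B[of r] r0 a0 by (intro frac_le) auto
    finally show "(1 / (b - r))\<^sup>2 * (2 * r * (1 - r * f r)) \<le> K\<^sup>2" using a0 by (simp add: K_def)
  qed
  show ?thesis unfolding complete_end_def D_b[symmetric]
  proof
    fix c assume c: "c \<in> {a<..<b}"
    show "Metric_space.mcomplete (space_over m a {c..<b}) dst"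
    proof (rule mcomplete_criterion[where u = "\<lambda>r. - ln (b - r)" and K = K])
      show "{c..<b} \<subseteq> D" using c by (auto simp: D_b)
      show "closed ({c..<b} \<inter> {..\<rho>})" if "\<rho> \<in> D" for \<rho>
      proof -
        have "{c..<b} \<inter> {..\<rho>} = {c..\<rho>}" using that by (auto simp: D_b)
        then show ?thesis by simp
      qed
      show "\<bar>- ln (b - rad (mom p)) - - ln (b - rad (mom q))\<bar> \<le> K * dst (pt p) (pt q)" if "mom p \<in> Pol" "mom q \<in> Pol" for p q
        using lip_dst[OF K that] by simp
      show "0 \<le> K" using K0 by simp
      fix B :: real
      have "r \<le> max a (b - exp (- B))" if "r \<in> {c..<b}" "- ln (b - r) \<le> B" for r
      proof -
        have "- B \<le> ln (b - r)" using that by simp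
        then have "exp (- B) \<le> b - r" using that(1) by (metis atLeastLessThan_iff diff_gt_0_iff_gt exp_le_cancel_iff exp_ln)
        then show ?thesis by simp
      qed
      then show "\<exists>\<rho>\<in>D. \<forall>r\<in>{c..<b}. - ln (b - r) \<le> B \<longrightarrow> r \<le> \<rho>"
        by (intro bexI[of _ "max a (b - exp (- B))"]) (use ab in \<open>auto simp: D_b\<close>)
    qed
  qed
qed

text \<open>The momenta are bounded and the density is 1.\<close>

lemma finite_volume: "volume_of m a D h S < \<infinity>"
proof -
  have "volume_of m a D h S \<le> ennreal (b\<^sup>2 * (2 * pi) * (2 * pi))"
  proof (rule volume_le)
    fix p assume "mom p \<in> MI"
    then have "rad (mom p) \<in> D" by (simp add: MI_iff)
    then show "rad (mom p) \<le> b" by (simp add: D_b)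
  qed (use ab a0 in simp)
  then show ?thesis by (rule le_less_trans) simp
qed

text \<open>With \<open>P = (r - a) (r - b) P4\<close>, the function \<open>h''\<close> has simple
  poles at both ends. The coefficient at \<open>a\<close> is right by admissibility; that at
  \<open>b\<close> determines \<open>p\<close> as the reciprocal of
  \<open>- P' b / (m b)\<close>.\<close>

lemma cone_metric_simple_zero:
  assumes ord: "order b P = 1"
  shows "cone_metric_Hirzebruch m a b h (2 * pi * (- poly (pderiv P) b / (real m * b)))"
proof -
  have b0: "0 < b" using ab a0 by simp
  have P0: "P \<noteq> 0" using P'_a m1 a0 by auto
  have "poly P1 b = 0" using Pb ab by (simp add: poly_P_eq)
  then have "[:-b, 1:] dvd P1" by (simp only: poly_eq_0_iff_dvd)
  then obtain P4 where P4: "P1 = [:-b, 1:] * P4" by (rule dvdE)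
  have p1: "poly P1 r = (r - b) * poly P4 r" for r unfolding P4 by (simp add: algebra_simps)
  have p4b: "poly P4 b \<noteq> 0"
  proof
    assume "poly P4 b = 0"
    then have "[:-b, 1:] dvd P4" by (simp only: poly_eq_0_iff_dvd)
    then obtain S where S: "P4 = [:-b, 1:] * S" by (rule dvdE)
    have "P = [:-a, 1:] * ([:-b, 1:] * ([:-b, 1:] * S))" by (rule trans[OF P_eq]) (simp only: P4 S)
    also have "\<dots> = [:-b, 1:] ^ 2 * ([:-a, 1:] * S)" by (simp only: power2_eq_square ac_simps)
    finally have "[:-b, 1:] ^ 2 dvd P" by (rule dvdI)
    then show False unfolding order_divides using ord P0 by simp
  qed
  have p4: "poly P4 r < 0" if "a \<le> r" "r < b" for r
  proof -
    have "r \<in> D" using that by (simp add: D_b)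
    then have "0 < poly P1 r" using that by (auto simp: D_iff)
    then show ?thesis using that by (simp add: p1 zero_less_mult_iff)
  qed
  have p4b': "poly P4 b < 0"
  proof (rule ccontr)
    assume "\<not> poly P4 b < 0"
    then have "0 < poly P4 b" using p4b by simp
    then have "\<exists>x>a. x < b \<and> poly P4 x = 0" using p4[of a] ab by (intro poly_IVT_pos) auto
    then obtain x where "a < x" "x < b" "poly P4 x = 0" by blast
    then show False using p4[of x] by simp
  qed
  have P'b: "poly (pderiv P) b = (b - a) * poly P4 b"
  proof -
    have "P = [:-b, 1:] * ([:-a, 1:] * P4)" by (rule trans[OF P_eq]) (simp only: P4 mult.left_commute)
    then have "poly (pderiv P) b = poly ([:-a, 1:] * P4) b"
      by (simp add: pderiv_mult pderiv_pCons del: mult_pCons_left)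
    then show ?thesis by (simp add: algebra_simps)
  qed
  define P'b where "P'b = poly (pderiv P) b"
  have neg: "P'b < 0" unfolding P'b_def P'b using p4b' ab by (simp add: mult_pos_neg)
  define p where "p = real m * b / (- P'b)"
  have p0: "0 < p" unfolding p_def using m1 b0 neg by (intro divide_pos_pos mult_pos_pos) auto
  have pP: "p * P'b = - (real m * b)" using neg by (simp add: p_def)
  have qa: "poly q a = a\<^sup>2" using adm by (simp add: admissible_def)
  have qb: "poly q b = b\<^sup>2" using Pb by (simp add: poly_P)
  \<comment> \<open>The numerator of \<open>h''\<close> minus its prescribed poles. It vanishes at
    \<open>a\<close> by admissibility and at \<open>b\<close> by the choice of \<open>p\<close>, so
    both poles cancel and \<open>N'\<close> remains.\<close>
  define N where "N = smult (real m) q - [:0, 1:] * P4 * ([:-b, 1:] - smult p [:-a, 1:])"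
  have pN: "poly N r = real m * poly q r - r * poly P4 r * ((r - b) - p * (r - a))" for r
    by (simp add: N_def algebra_simps)
  have "poly N a = 0"
  proof -
    have "(a - b) * poly P4 a = real m * a" using P1_a p1 by simp
    moreover have "poly N a = real m * a\<^sup>2 - a * ((a - b) * poly P4 a)" by (simp add: pN qa algebra_simps)
    ultimately show ?thesis by (simp add: power2_eq_square)
  qed
  moreover have "poly N b = 0"
  proof -
    have "poly N b = real m * b\<^sup>2 + b * (p * ((b - a) * poly P4 b))" by (simp add: pN qb algebra_simps)
    also have "\<dots> = 0" using pP unfolding P'b_def P'b by (simp add: power2_eq_square)
    finally show ?thesis .
  qed
  ultimately obtain N' where N': "\<And>r. poly N r = (r - a) * ((r - b) * poly N' r)"
  proof -
    have "[:-a, 1:] dvd N" using \<open>poly N a = 0\<close> by (simp only: poly_eq_0_iff_dvd)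
    then obtain M where M: "N = [:-a, 1:] * M" by (rule dvdE)
    have "poly M b = 0" using \<open>poly N b = 0\<close> ab by (simp add: M)
    then have "[:-b, 1:] dvd M" by (simp only: poly_eq_0_iff_dvd)
    then obtain M' where M': "M = [:-b, 1:] * M'" by (rule dvdE)
    show thesis by (rule that[of M']) (unfold M M', simp add: algebra_simps)
  qed
  let ?U = "{r. 0 < r \<and> poly P4 r < 0}"
  show ?thesis unfolding cone_metric_Hirzebruch_def
  proof (intro exI[of _ p] conjI ballI)
    show "0 < p" by (rule p0)
    show "2 * pi * (- poly (pderiv P) b / (real m * b)) = 2 * pi / p"
      using neg b0 m1 by (simp add: p_def P'b_def)
    show "smooth_fun_on h {a<..<b}" using smooth_h by (simp add: int_b)
    have mi: "mom_int {a..b} = MI" by (simp add: mom_int_def int_b)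
    show "pos_def (hess (upot h) x)" if "x \<in> mom_int {a..b}" for x
      using that pos_def_hess[OF MI_pos_over] unfolding mi by blast
    show "smooth_up_to (\<lambda>r. deriv (deriv h) r - (1 / (r - a) + p / (b - r)) / real m) {a..b}"
      unfolding smooth_up_to_def
    proof (intro exI conjI ballI)
      show "open ?U" by (intro open_Collect_conj open_Collect_less continuous_intros)
      then show "smooth_fun_on (\<lambda>r. poly N' r / poly (smult (real m) ([:0, 1:] * P4)) r) ?U"
        using m1 by (intro smooth_rational[where p = N' and q = "smult (real m) ([:0, 1:] * P4)"]) auto
      show "{a..b} \<subseteq> ?U" using a0 p4 p4b' by (auto simp: le_less)
      fix r assume "r \<in> interior {a..b}"
      then have r: "a < r" "r < b" "r \<in> interior D" "0 < r" using a0 by (auto simp: int_b)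
      have p4r: "poly P4 r \<noteq> 0" using p4[of r] r by simp
      have "deriv (deriv h) r = poly q r / (r * ((r - a) * ((r - b) * poly P4 r)))"
        using DERIV_imp_deriv[OF F_deriv(2)[OF r(3)]] by (simp add: F_def poly_P_eq p1)
      moreover have gen: "x / (r * (e * (d * y))) - (1 / e + p / (- d)) / real m
          = (real m * x - r * y * (d - p * e)) / (real m * r * y * (e * d))" if "e \<noteq> 0" "d \<noteq> 0" "y \<noteq> 0" for x e d y
        using that r(4) m1 by (simp add: field_simps)
      ultimately have "deriv (deriv h) r - (1 / (r - a) + p / (b - r)) / real m =
         poly N r / (real m * r * poly P4 r * ((r - a) * (r - b)))"
        using gen[of "r - a" "r - b" "poly P4 r" "poly q r"] r p4r unfolding pN by simp
      also have "\<dots> = poly N' r / poly (smult (real m) ([:0, 1:] * P4)) r"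
        unfolding N' using r m1 p4r by simp
      finally show "deriv (deriv h) r - (1 / (r - a) + p / (b - r)) / real m =
        poly N' r / poly (smult (real m) ([:0, 1:] * P4)) r" .
    qed
  qed
qed

end

end

text \<open>Two points on one level line of \<open>r\<close> give the same value, which forces
  \<open>c $ 1 = c $ 2\<close>.\<close>

lemma rad_function_affine:
  fixes c :: "real^2"
  assumes I: "open I" "\<And>r. r \<in> I \<Longrightarrow> 0 < r"
    and eq: "\<And>x. x \<in> pos_over I \<Longrightarrow> G (rad x) = c \<bullet> x + k" and r: "r \<in> I"
  shows "G r = c $ 1 * r + k"
proof -
  define x :: "real \<Rightarrow> real^2" where "x = (\<lambda>t. \<chi> i. if i = 1 then t else r - t)"
  have x: "x t \<in> pos_over I" "rad (x t) = r" "c \<bullet> x t = c $ 1 * t + c $ 2 * (r - t)" if "0 < t" "t < r" for t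
    using that r by (auto simp: x_def pos_over_def rad_def inner_vec_def sum_2)
  have r0: "0 < r" using I r by simp
  have 1: "G r = c $ 1 * (r / 4) + c $ 2 * (r - r / 4) + k" using eq[OF x(1)[of "r / 4"]] x(2,3)[of "r / 4"] r0 by simp
  have 2: "G r = c $ 1 * (r / 2) + c $ 2 * (r - r / 2) + k" using eq[OF x(1)[of "r / 2"]] x(2,3)[of "r / 2"] r0 by simp
  have "c $ 1 * r = c $ 2 * r" using 1 2 by (simp add: field_simps)
  then have "c $ 1 = c $ 2" using r0 by simp
  then show ?thesis using 2 by (simp add: field_simps)
qed

lemma exists_least_root:
  fixes p :: "real poly"
  assumes "p \<noteq> 0"
  shows "(\<forall>r>a. poly p r \<noteq> 0) \<or> (\<exists>b>a. poly p b = 0 \<and> (\<forall>r\<in>{a<..<b}. poly p r \<noteq> 0))"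
proof (cases "\<exists>r>a. poly p r = 0")
  case True
  let ?S = "{r. poly p r = 0} \<inter> {a<..}"
  have S: "finite ?S" "?S \<noteq> {}" using poly_roots_finite[OF assms] True by auto
  have "Min ?S \<in> ?S" by (rule Min_in[OF S])
  moreover have "poly p r \<noteq> 0" if "r \<in> {a<..<Min ?S}" for r
    using that Min_le[OF S(1), of r] by force
  ultimately show ?thesis by blast
qed auto

section \<open>Extremal metrics\<close>

text \<open>In terms of \<open>f = F / (1 + r F)\<close> the extremal equation reads
  \<open>(r^3 f)'' = r (c_1 r + k) / 2\<close>. Two integrations give \<open>q = r^3 f\<close>; the
  constants of integration are \<open>q\<^sub>1\<close> and \<open>q\<^sub>0\<close>, and no
  quadratic term arises.\<close>

lemma extremal_profile:
  fixes I :: "real set"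
  assumes I: "open I" "convex I" "I \<noteq> {}" "\<And>r. r \<in> I \<Longrightarrow> 0 < r"
    and sm: "smooth_fun_on h I"
    and pd: "\<And>x. x \<in> pos_over I \<Longrightarrow> pos_def (hess (upot h) x)"
    and sc: "\<And>p. mom p \<in> pos_over I \<Longrightarrow> scalar_curvature (U2_metric h) p = c \<bullet> mom p + k"
  obtains q\<^sub>0 q\<^sub>1 q\<^sub>3 q\<^sub>4 where
    "\<And>r. r \<in> I \<Longrightarrow> 0 < 1 + r * deriv (deriv h) r"
    "\<And>r. r \<in> I \<Longrightarrow> poly (qpoly q\<^sub>0 q\<^sub>1 q\<^sub>3 q\<^sub>4) r = r ^ 3 * deriv (deriv h) r / (1 + r * deriv (deriv h) r)"
proof -
  define H where "H = (\<lambda>k. (deriv ^^ k) h)"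
  have H: "(H k has_real_derivative H (Suc k) r) (at r)" if "r \<in> I" for k r
    using sm that unfolding smooth_fun_on_def H_def by (simp add: DERIV_deriv_iff_real_differentiable)
  have H012: "H 0 = h" "H (Suc 0) = deriv h" "H (Suc (Suc 0)) = deriv (deriv h)" by (simp_all add: H_def)
  define F where "F = deriv (deriv h)"
  define F1 where "F1 = deriv F"
  define F2 where "F2 = deriv F1"
  have F: "(F has_real_derivative F1 r) (at r)" "(F1 has_real_derivative F2 r) (at r)" if "r \<in> I" for r
    using H[OF that, of 2] H[OF that, of 3] by (simp_all add: H_def F_def F1_def F2_def eval_nat_numeral)
  have hd: "h differentiable (at r)" "(deriv h has_real_derivative F r) (at r)" if "r \<in> I" for r
    using H[OF that, of 0] H[OF that, of "Suc 0"] unfolding H012 F_def by (auto simp: real_differentiable_def)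
  have pos: "0 < 1 + r * F r" if r: "r \<in> I" for r
  proof -
    define x :: "real^2" where "x = (\<chi> i. r / 2)"
    have r0: "0 < r" using I r by simp
    have x: "x \<in> pos_over I" "rad x = r" using r r0 by (auto simp: x_def pos_over_def rad_def)
    \<comment> \<open>Positivity of the Hessian on the vector \<open>(1, 1)\<close> gives the sign
      of \<open>1 + r F\<close>; hence \<open>f\<close> is well defined and
      \<open>1 - r f = 1 / (1 + r F)\<close> is positive.\<close>
    have "0 < (\<chi> i. 1) \<bullet> (hess (upot h) x *v (\<chi> i. 1))"
      using pd[OF x(1)] unfolding pos_def_def by (auto simp: vec_eq_iff)
    also have "\<dots> = 2 * (1 + r * F r) / r"
      using r0 x(2) by (simp add: inner_vec_def matrix_vector_mult_def sum_2 hess_upot[OF I(1) hd x(1)])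
        (simp add: x_def field_simps)
    finally show ?thesis using r0 by (simp add: zero_less_divide_iff zero_less_mult_iff)
  qed
  define f where "f = (\<lambda>r. F r / (1 + r * F r))"
  define f1 where "f1 = (\<lambda>r. (F1 r - (F r)\<^sup>2) / (1 + r * F r)\<^sup>2)"
  define f2 where "f2 = (\<lambda>r. ((F2 r - 2 * F r * F1 r) * (1 + r * F r) - 2 * (F1 r - (F r)\<^sup>2) * (F r + r * F1 r)) / (1 + r * F r) ^ 3)"
  have w: "1 - r * f r = 1 / (1 + r * F r)" if "r \<in> I" for r
    using pos[OF that] by (simp add: f_def field_simps)
  have f1: "(f has_real_derivative f1 r) (at r)" if "r \<in> I" for r
    unfolding f_def f1_def using pos[OF that]
    by (auto intro!: derivative_eq_intros F that) (simp add: field_simps power2_eq_square)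
  have f2: "(f1 has_real_derivative f2 r) (at r)" if r: "r \<in> I" for r
  proof -
    have cancel: "(N' * u\<^sup>2 - N * (2 * u * u')) / (u\<^sup>2 * u\<^sup>2) = (N' * u - 2 * N * u') / u ^ 3" if "u \<noteq> 0" for N N' u u' :: real
      using that by (simp add: field_simps eval_nat_numeral)
    have "((\<lambda>r. F1 r - (F r)\<^sup>2) has_real_derivative F2 r - 2 * F r * F1 r) (at r)"
      by (auto intro!: derivative_eq_intros F r)
    moreover have "((\<lambda>r. (1 + r * F r)\<^sup>2) has_real_derivative 2 * (1 + r * F r) * (F r + r * F1 r)) (at r)"
      by (auto intro!: derivative_eq_intros F r simp: algebra_simps)
    ultimately have "(f1 has_real_derivative ((F2 r - 2 * F r * F1 r) * (1 + r * F r)\<^sup>2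
        - (F1 r - (F r)\<^sup>2) * (2 * (1 + r * F r) * (F r + r * F1 r))) / ((1 + r * F r)\<^sup>2 * (1 + r * F r)\<^sup>2)) (at r)"
      unfolding f1_def by (rule DERIV_divide) (use pos[OF r] in simp)
    then show ?thesis unfolding f2_def by (subst (asm) cancel) (use pos[OF r] in auto)
  qed
  interpret curvature_profile I h F f f1 f2
  proof
    show "continuous_on I f" using f1 by (meson DERIV_isCont continuous_at_imp_continuous_on)
    show "0 < 1 - r * f r" if "r \<in> I" for r using w[OF that] pos[OF that] by simp
    show "F r = f r / (1 - r * f r)" if "r \<in> I" for r
      unfolding w[OF that] using pos[OF that] by (simp add: f_def)
  qed (use I hd f1 f2 in auto)
  define G where "G = (\<lambda>r. 2 * (r\<^sup>2 * f2 r + 6 * r * f1 r + 6 * f r))"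
  have G_affine: "G r = c $ 1 * r + k" if "r \<in> I" for r
  proof (rule rad_function_affine[OF I(1,4) _ that])
    fix x assume x: "x \<in> pos_over I"
    define p :: coords where "p = (\<chi> i. case i of Inl j \<Rightarrow> x $ j | Inr j \<Rightarrow> 0)"
    have "mom p = x" by (simp add: p_def mom_def vec_eq_iff)
    then show "G (rad x) = c \<bullet> x + k" using sc[of p] scalar_curvature_eq[of p] x by (simp add: G_def)
  qed
  have G: "r\<^sup>2 * f2 r + 6 * r * f1 r + 6 * f r = (c $ 1 * r + k) / 2" if "r \<in> I" for r
  proof -
    have "x = y / 2" if "2 * x = y" for x y :: real using that by simp
    then show ?thesis using G_affine[OF that] unfolding G_def by blast
  qed
  \<comment> \<open>\<open>Q1\<close> is \<open>(r^3 f)'\<close>, and \<open>r\<close> times the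
    equation \<open>G\<close> gives its derivative.\<close>
  define Q1 where "Q1 = (\<lambda>r. 3 * r\<^sup>2 * f r + r ^ 3 * f1 r)"
  have "\<exists>A. \<forall>r\<in>I. Q1 r - (c $ 1 * r ^ 3 / 6 + k * r\<^sup>2 / 4) = A"
  proof (rule has_field_derivative_zero_constant[OF I(2)])
    fix r assume r: "r \<in> I"
    have "((\<lambda>r. Q1 r - (c $ 1 * r ^ 3 / 6 + k * r\<^sup>2 / 4)) has_real_derivative
       r * (r\<^sup>2 * f2 r + 6 * r * f1 r + 6 * f r) - (c $ 1 * r\<^sup>2 / 2 + k * r / 2)) (at r)"
      unfolding Q1_def by (auto intro!: derivative_eq_intros f1 f2 r simp: algebra_simps eval_nat_numeral)
    also have "r * (r\<^sup>2 * f2 r + 6 * r * f1 r + 6 * f r) - (c $ 1 * r\<^sup>2 / 2 + k * r / 2) = 0"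
      unfolding G[OF r] by (simp add: field_simps power2_eq_square)
    finally show "((\<lambda>r. Q1 r - (c $ 1 * r ^ 3 / 6 + k * r\<^sup>2 / 4)) has_real_derivative 0) (at r within I)"
      by (rule DERIV_subset) simp
  qed
  then obtain A where A: "\<And>r. r \<in> I \<Longrightarrow> Q1 r = c $ 1 * r ^ 3 / 6 + k * r\<^sup>2 / 4 + A" by (auto simp: algebra_simps)
  have "\<exists>B. \<forall>r\<in>I. r ^ 3 * f r - (c $ 1 * r ^ 4 / 24 + k * r ^ 3 / 12 + A * r) = B"
  proof (rule has_field_derivative_zero_constant[OF I(2)])
    fix r assume r: "r \<in> I"
    have "((\<lambda>r. r ^ 3 * f r - (c $ 1 * r ^ 4 / 24 + k * r ^ 3 / 12 + A * r)) has_real_derivative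
       Q1 r - (c $ 1 * r ^ 3 / 6 + k * r\<^sup>2 / 4 + A)) (at r)"
      unfolding Q1_def by (auto intro!: derivative_eq_intros f1 r simp: algebra_simps eval_nat_numeral)
    then show "((\<lambda>r. r ^ 3 * f r - (c $ 1 * r ^ 4 / 24 + k * r ^ 3 / 12 + A * r)) has_real_derivative 0) (at r within I)"
      unfolding A[OF r] by (auto intro: DERIV_subset)
  qed
  then obtain B where B: "\<And>r. r \<in> I \<Longrightarrow> r ^ 3 * f r = c $ 1 * r ^ 4 / 24 + k * r ^ 3 / 12 + A * r + B" by (auto simp: algebra_simps)
  show thesis
  \<comment> \<open>The factors \<open>1 / 2\<close> and 1 match the denominators 6 and 24 in
    \<open>qpoly\<close> with the coefficients 12 and 24 just found.\<close>
  proof (rule that[of B A "k / 2" "c $ 1"])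
    fix r assume r: "r \<in> I"
    show "0 < 1 + r * deriv (deriv h) r" using pos[OF r] by (simp add: F_def)
    have "poly (qpoly B A (k / 2) (c $ 1)) r = r ^ 3 * f r"
      unfolding B[OF r] by (simp add: qpoly_def algebra_simps eval_nat_numeral)
    then show "poly (qpoly B A (k / 2) (c $ 1)) r = r ^ 3 * deriv (deriv h) r / (1 + r * deriv (deriv h) r)"
      by (simp add: f_def F_def)
  qed
qed

text \<open>\<open>E = (r - a) F\<close> tends to \<open>1 / m\<close> at \<open>a\<close>. Both
  \<open>q = r^3 E / ((r - a) + r E)\<close> and the quotient
  \<open>P / (r - a) = r^2 / ((r - a) + r E)\<close> have limits there, \<open>a\<^sup>2\<close> and
  \<open>m a\<close>, which are the two conditions.\<close>

lemma admissible_from_singularity: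
  fixes F S :: "real \<Rightarrow> real"
  assumes m: "1 \<le> m" and a: "0 < a" and S: "isCont S a"
    and ev: "\<forall>\<^sub>F r in at_right a. F r = 1 / (m * (r - a)) + S r \<and> 0 < 1 + r * F r \<and>
       poly q r = r ^ 3 * F r / (1 + r * F r)"
  shows "admissible m a q"
proof -
  define E where "E = (\<lambda>r. (1 / real m + (r - a) * S r))"
  have S': "(S \<longlongrightarrow> S a) (at_right a)" using S by (simp add: isCont_def filterlim_at_split)
  have E: "(E \<longlongrightarrow> 1 / m) (at_right a)"
  proof -
    have "(E \<longlongrightarrow> 1 / m + (a - a) * S a) (at_right a)" unfolding E_def by (intro tendsto_intros S')
    then show ?thesis by simp
  qed
  have ev2: "\<forall>\<^sub>F r in at_right a. poly q r = r ^ 3 * E r / ((r - a) + r * E r) \<and>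
      (r\<^sup>2 - poly q r) / (r - a) = r\<^sup>2 / ((r - a) + r * E r)"
    using ev eventually_at_right_less[of a]
  proof eventually_elim
    case (elim r)
    then have e: "0 < r - a" "0 < r" using a by auto
    have EF: "E r = (r - a) * F r" using elim e m by (simp add: E_def field_simps)
    have d: "(r - a) + r * E r = (r - a) * (1 + r * F r)" by (simp add: EF algebra_simps)
    have u: "0 < 1 + r * F r" and q: "poly q r = r ^ 3 * F r / (1 + r * F r)" using elim by auto
    have "poly q r = r ^ 3 * E r / ((r - a) + r * E r)"
      unfolding d unfolding EF q using e by (simp add: mult.left_commute)
    moreover have "r\<^sup>2 - poly q r = r\<^sup>2 / (1 + r * F r)"
      unfolding q using u by (simp add: field_simps eval_nat_numeral)
    ultimately show ?case unfolding d using e by simp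
  qed
  have den: "((\<lambda>r. (r - a) + r * E r) \<longlongrightarrow> (a - a) + a * (1 / m)) (at_right a)" by (intro tendsto_intros E)
  have nz: "(a - a) + a * (1 / real m) \<noteq> 0" using m a by simp
  have qc: "(poly q \<longlongrightarrow> poly q a) (at_right a)"
    using poly_isCont[of a q] by (simp add: isCont_def filterlim_at_split)
  have "((\<lambda>r. r ^ 3 * E r / ((r - a) + r * E r)) \<longlongrightarrow> a ^ 3 * (1 / m) / ((a - a) + a * (1 / m))) (at_right a)"
    by (intro tendsto_intros E den nz)
  then have "(poly q \<longlongrightarrow> a ^ 3 * (1 / m) / ((a - a) + a * (1 / m))) (at_right a)"
    by (rule Lim_transform_eventually) (use ev2 in \<open>auto elim: eventually_mono\<close>)
  then have "poly q a = a ^ 3 * (1 / m) / ((a - a) + a * (1 / m))" using qc by (intro tendsto_unique[OF _ qc]) auto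
  also have "\<dots> = a\<^sup>2" using m a by (simp add: eval_nat_numeral)
  finally have q1: "poly q a = a\<^sup>2" .
  have "((\<lambda>r. r\<^sup>2 - poly q r) has_real_derivative 2 * a - poly (pderiv q) a) (at a)"
    by (auto intro!: derivative_eq_intros)
  then have "((\<lambda>r. (r\<^sup>2 - poly q r) / (r - a)) \<longlongrightarrow> 2 * a - poly (pderiv q) a) (at_right a)"
    by (simp add: has_field_derivative_iff q1 filterlim_at_split)
  moreover have "((\<lambda>r. (r\<^sup>2 - poly q r) / (r - a)) \<longlongrightarrow> a\<^sup>2 / ((a - a) + a * (1 / m))) (at_right a)"
  proof -
    have "((\<lambda>r. r\<^sup>2 / ((r - a) + r * E r)) \<longlongrightarrow> a\<^sup>2 / ((a - a) + a * (1 / m))) (at_right a)"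
      by (intro tendsto_intros den nz)
    then show ?thesis by (rule Lim_transform_eventually) (use ev2 in \<open>auto elim: eventually_mono\<close>)
  qed
  ultimately have "2 * a - poly (pderiv q) a = a\<^sup>2 / ((a - a) + a * (1 / m))"
    by (intro tendsto_unique[of "at_right a"]) auto
  then show ?thesis using q1 m a by (simp add: admissible_def power2_eq_square algebra_simps)
qed

text \<open>Each hypothesis on the metric yields one conclusion: extremality the polynomial,
  positivity of the Hessian \<open>P > 0\<close>, and smoothness over the zero section
  admissibility.\<close>

lemma extremal_converse:
  fixes m :: nat and c :: ereal
  assumes m: "1 \<le> m" and a: "0 < a" and c: "ereal a < c" and D: "D = {r. a \<le> r \<and> ereal r < c}"
    and K: "U2_kaehler m a D h" and E: "extremal D h"
  shows "\<exists>q\<^sub>0 q\<^sub>1 q\<^sub>3 q\<^sub>4. admissible m a (qpoly q\<^sub>0 q\<^sub>1 q\<^sub>3 q\<^sub>4) \<and> D \<subseteq> max_domain a (Ppoly (qpoly q\<^sub>0 q\<^sub>1 q\<^sub>3 q\<^sub>4)) \<and>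
     determined_by (qpoly q\<^sub>0 q\<^sub>1 q\<^sub>3 q\<^sub>4) D h"
proof -
  define I where "I = {r. a < r \<and> ereal r < c}"
  have Io: "open I"
  proof -
    have "I = {a<..} \<inter> ereal -` {..<c}" by (auto simp: I_def)
    moreover have "open (ereal -` {..<c})" by (rule open_vimage) (auto intro: continuous_on_ereal)
    ultimately show ?thesis by auto
  qed
  have intD: "interior D = I"
  proof (rule interior_unique)
    show "I \<subseteq> D" by (auto simp: I_def D)
    show "T \<subseteq> I" if T: "T \<subseteq> D" "open T" for T
    proof
      fix r assume r: "r \<in> T"
      then obtain e where e: "0 < e" "ball r e \<subseteq> T" using T(2) open_contains_ball by blast
      have "r - e / 2 \<in> ball r e" using e(1) by (simp add: dist_real_def)
      then have "r - e / 2 \<in> D" using e(2) T(1) by blast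
      then show "r \<in> I" using r T(1) e(1) by (auto simp: D I_def)
    qed
  qed (rule Io)
  have down: "s \<in> I" if "r \<in> I" "a < s" "s \<le> r" for r s
    using that le_less_trans[of "ereal s" "ereal r" c] by (auto simp: I_def)
  have Ic: "convex I"
    unfolding is_interval_convex_1[symmetric] is_interval_1
    by (auto intro: down simp: I_def) (metis down I_def dual_order.strict_trans1 less_eq_real_def mem_Collect_eq)
  obtain r1 where r1: "a < r1" "ereal r1 < c" using ereal_dense2[OF c] by auto
  have Ine: "I \<noteq> {}" using r1 by (auto simp: I_def)
  have I0: "0 < r" if "r \<in> I" for r using that a by (auto simp: I_def)
  obtain v k where sc: "\<And>p. mom p \<in> mom_int D \<Longrightarrow> scalar_curvature (U2_metric h) p = v \<bullet> mom p + k"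
    using E unfolding extremal_def by blast
  have sm: "smooth_fun_on h I" and pd: "\<And>x. x \<in> pos_over I \<Longrightarrow> pos_def (hess (upot h) x)"
    and su: "smooth_up_to (\<lambda>r. deriv (deriv h) r - 1 / (real m * (r - a))) D"
    using K by (auto simp: U2_kaehler_def intD mom_int_eq_pos_over)
  obtain q\<^sub>0 q\<^sub>1 q\<^sub>3 q\<^sub>4 where q: "\<And>r. r \<in> I \<Longrightarrow> 0 < 1 + r * deriv (deriv h) r"
    "\<And>r. r \<in> I \<Longrightarrow> poly (qpoly q\<^sub>0 q\<^sub>1 q\<^sub>3 q\<^sub>4) r = r ^ 3 * deriv (deriv h) r / (1 + r * deriv (deriv h) r)"
    using extremal_profile[OF Io Ic Ine I0 sm pd, of v k] sc unfolding mom_int_eq_pos_over intD by blast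
  let ?q = "qpoly q\<^sub>0 q\<^sub>1 q\<^sub>3 q\<^sub>4"
  obtain U S where S: "open U" "D \<subseteq> U" "smooth_fun_on S U"
    "\<And>r. r \<in> I \<Longrightarrow> deriv (deriv h) r - 1 / (real m * (r - a)) = S r"
    using su unfolding smooth_up_to_def intD by blast
  have P: "r\<^sup>2 - poly ?q r = r\<^sup>2 / (1 + r * deriv (deriv h) r)" if "r \<in> I" for r
    unfolding q(2)[OF that] using q(1)[OF that] by (simp add: field_simps eval_nat_numeral)
  have "admissible m a ?q"
  proof (rule admissible_from_singularity[OF m a])
    have "a \<in> U" using S(2) c by (auto simp: D)
    then have "(deriv ^^ 0) S differentiable (at a)" using S(3) unfolding smooth_fun_on_def by blast
    then show "isCont S a" by (simp add: differentiable_imp_continuous_within)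
    have "\<forall>\<^sub>F r in at_right a. r \<in> I"
      unfolding eventually_at_right_field using r1 down[of r1] by (intro exI[of _ r1]) (auto simp: I_def)
    then show "\<forall>\<^sub>F r in at_right a. deriv (deriv h) r = 1 / (m * (r - a)) + S r \<and> 0 < 1 + r * deriv (deriv h) r \<and>
       poly ?q r = r ^ 3 * deriv (deriv h) r / (1 + r * deriv (deriv h) r)"
      by eventually_elim (use q S(4) in \<open>force simp: algebra_simps\<close>)
  qed
  moreover have "D \<subseteq> max_domain a (Ppoly ?q)"
  proof
    fix r assume r: "r \<in> D"
    have "0 < poly (Ppoly ?q) s" if s: "s \<in> {a<..r}" for s
    proof -
      have sI: "s \<in> I" using s r le_less_trans[of "ereal s" "ereal r" c] by (auto simp: D I_def)
      show ?thesis using P[OF sI] q(1)[OF sI] I0[OF sI] by (simp add: Ppoly_def poly_monom)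
    qed
    then show "r \<in> max_domain a (Ppoly ?q)" using r by (auto simp: max_domain_def D)
  qed
  moreover have "determined_by ?q D h"
    unfolding determined_by_def intD
  proof (intro ballI conjI)
    fix r assume r: "r \<in> I"
    have d: "(deriv ^^ k) h differentiable (at r)" for k using sm r by (auto simp: smooth_fun_on_def)
    show "h differentiable (at r)" using d[of 0] by simp
    have "(deriv h has_real_derivative deriv (deriv h) r) (at r)"
      using d[of 1] by (simp add: DERIV_deriv_iff_real_differentiable)
    also have "deriv (deriv h) r = poly ?q r / (r * (r\<^sup>2 - poly ?q r))"
      unfolding P[OF r] unfolding q(2)[OF r] using q(1)[OF r] I0[OF r] by (simp add: eval_nat_numeral)
    finally show "(deriv h has_real_derivative poly ?q r / (r * (r\<^sup>2 - poly ?q r))) (at r)" .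
  qed
  ultimately show ?thesis by blast
qed

text \<open>\<open>q\<close> has no quadratic term, so \<open>P\<close> is never the zero polynomial
  and has only finitely many roots.\<close>

lemma coeff_Ppoly_qpoly_2: "coeff (Ppoly (qpoly q\<^sub>0 q\<^sub>1 q\<^sub>3 q\<^sub>4)) 2 = 1"
  by (simp add: Ppoly_def qpoly_def eval_nat_numeral)

lemma degree_Ppoly_qpoly: "degree (Ppoly (qpoly q\<^sub>0 q\<^sub>1 q\<^sub>3 q\<^sub>4)) \<le> 4"
  unfolding Ppoly_def by (rule degree_diff_le) (auto simp: qpoly_def degree_monom_eq)

lemma determined_metric_cases:
  fixes m :: nat and a :: real
  assumes m: "1 \<le> m" and a: "0 < a" and q: "q = qpoly q\<^sub>0 q\<^sub>1 q\<^sub>3 q\<^sub>4" and P: "P = Ppoly q" and D: "D = max_domain a P"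
    and adm: "admissible m a q" and det: "determined_by q D h"
  shows "U2_kaehler m a D h \<and> extremal D h \<and>
          Metric_space (space_over m a D) (riem_dist m a D h) \<and>
          ((\<forall>r::real. r > a \<longrightarrow> poly P r \<noteq> 0) \<longrightarrow>
             D = {a..} \<and>
             (degree P > 3 \<longrightarrow> \<not> complete_metric m a D h) \<and>
             (degree P \<le> 3 \<longrightarrow> complete_metric m a D h \<and>
                (degree P = 2 \<longrightarrow> quartic_volume_growth m a D h) \<and>
                (degree P = 3 \<longrightarrow> exponential_volume_growth m a D h))) \<and>
          (\<forall>b::real. b > a \<longrightarrow> poly P b = 0 \<and> (\<forall>r\<in>{a<..<b}. poly P r \<noteq> 0) \<longrightarrow>
             D = {a..<b} \<and>
             (order b P = 1 \<longrightarrow>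
                cone_metric_Hirzebruch m a b h (2 * pi * (- poly (pderiv P) b / (real m * b)))) \<and>
             (order b P > 1 \<longrightarrow>
                complete_end m a b h \<and> volume_of m a D h (space_over m a D) < \<infinity>))"
proof -
  interpret U2_poly m a q h P D by unfold_locales (use assms in auto)
  have ext: "extremal D h"
    unfolding extremal_def
  proof (intro exI allI impI)
    fix p assume p: "mom p \<in> MI"
    have "0 < rad (mom p)" using p a by (auto simp: MI_iff)
    \<comment> \<open>For \<open>q\<close> of this form \<open>q''\<close> is divisible by
      \<open>r\<close>, and \<open>2 q'' / r = 2 q\<^sub>3 + q\<^sub>4 r\<close>.\<close>
    then have "scalar_curvature (U2_metric h) p = q\<^sub>4 * rad (mom p) + 2 * q\<^sub>3"
      unfolding scalar_q[OF p] q by (simp add: qpoly_def pderiv_pCons field_simps)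
    then show "scalar_curvature (U2_metric h) p = (\<chi> i. q\<^sub>4) \<bullet> mom p + 2 * q\<^sub>3"
      by (simp add: inner_vec_def sum_2 rad_def algebra_simps)
  qed
  have "degree P \<le> 4" unfolding P q by (rule degree_Ppoly_qpoly)
  show ?thesis
  proof (intro conjI impI allI)
    show "U2_kaehler m a D h" by (rule kaehler)
    show "extremal D h" by (rule ext)
    show "Metric_space (space_over m a D) dst" by (rule Metric_space_dst)
  next
    assume "\<forall>r>a. poly P r \<noteq> 0"
    then show whole: "D = {a..}" using D_whole by blast
    \<comment> \<open>A degree above 3 can only be 4.\<close>
    show "\<not> complete_metric m a D h" if "3 < degree P"
      using incomplete[OF whole] that \<open>degree P \<le> 4\<close> by simp
    show "complete_metric m a D h" if "degree P \<le> 3" using complete[OF whole that] .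
    show "quartic_volume_growth m a D h" if "degree P = 2" using quartic[OF whole that] .
    show "exponential_volume_growth m a D h" if "degree P = 3" using exponential[OF whole that] .
  next
    fix b assume b: "a < b" "poly P b = 0 \<and> (\<forall>r\<in>{a<..<b}. poly P r \<noteq> 0)"
    then show Db: "D = {a..<b}" using D_until[of b] by auto
    show "cone_metric_Hirzebruch m a b h (2 * pi * (- poly (pderiv P) b / (real m * b)))" if "order b P = 1"
      using cone_metric_simple_zero[OF b(1) b(2)[THEN conjunct1] Db that] .
    show "complete_end m a b h" if "1 < order b P"
      using complete_end_double_zero[OF b(1) b(2)[THEN conjunct1] Db that] .
    show "volume_of m a D h (space_over m a D) < \<infinity>"
      using finite_volume[OF b(1) b(2)[THEN conjunct1] Db] .
  qed
qed

theorem theorem4p1: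
  fixes m :: nat and a :: real
  assumes "1 \<le> m" and "0 < a"
  shows
   "(\<forall>q\<^sub>0 q\<^sub>1 q\<^sub>3 q\<^sub>4 h.
       let q = qpoly q\<^sub>0 q\<^sub>1 q\<^sub>3 q\<^sub>4; P = Ppoly q; D = max_domain a P
       in admissible m a q \<and> determined_by q D h \<longrightarrow>
          U2_kaehler m a D h \<and> extremal D h \<and>
          Metric_space (space_over m a D) (riem_dist m a D h) \<and>
          ((\<forall>r::real. r > a \<longrightarrow> poly P r \<noteq> 0) \<longrightarrow>
             D = {a..} \<and>
             (degree P > 3 \<longrightarrow> \<not> complete_metric m a D h) \<and>
             (degree P \<le> 3 \<longrightarrow> complete_metric m a D h \<and>
                (degree P = 2 \<longrightarrow> quartic_volume_growth m a D h) \<and>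
                (degree P = 3 \<longrightarrow> exponential_volume_growth m a D h))) \<and>
          (\<forall>b::real. b > a \<longrightarrow> poly P b = 0 \<and> (\<forall>r\<in>{a<..<b}. poly P r \<noteq> 0) \<longrightarrow>
             D = {a..<b} \<and>
             (order b P = 1 \<longrightarrow>
                cone_metric_Hirzebruch m a b h (2 * pi * (- poly (pderiv P) b / (real m * b)))) \<and>
             (order b P > 1 \<longrightarrow>
                complete_end m a b h \<and> volume_of m a D h (space_over m a D) < \<infinity>)))
    \<and>
    (\<forall>(c::ereal) h. c > ereal a \<longrightarrow>
       (let D = {r. a \<le> r \<and> ereal r < c}
        in U2_kaehler m a D h \<and> extremal D h \<longrightarrow>
           (\<exists>q\<^sub>0 q\<^sub>1 q\<^sub>3 q\<^sub>4.
              let q = qpoly q\<^sub>0 q\<^sub>1 q\<^sub>3 q\<^sub>4; P = Ppoly q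
              in admissible m a q \<and> D \<subseteq> max_domain a P \<and> determined_by q D h \<and>
                 ((\<forall>r::real. r > a \<longrightarrow> poly P r \<noteq> 0) \<or>
                  (\<exists>b::real. b > a \<and> poly P b = 0 \<and> (\<forall>r\<in>{a<..<b}. poly P r \<noteq> 0))))))"
proof (rule conjI, goal_cases)
  case 1
  show ?case unfolding Let_def using determined_metric_cases[OF assms refl refl refl] by blast
next
  case 2
  show ?case unfolding Let_def
  proof (intro allI impI, elim conjE)
    fix c h
    let ?D = "{r. a \<le> r \<and> ereal r < c}"
    assume c: "c > ereal a" "U2_kaehler m a ?D h" "extremal ?D h"
    obtain q\<^sub>0 q\<^sub>1 q\<^sub>3 q\<^sub>4 where q: "admissible m a (qpoly q\<^sub>0 q\<^sub>1 q\<^sub>3 q\<^sub>4)"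
      "?D \<subseteq> max_domain a (Ppoly (qpoly q\<^sub>0 q\<^sub>1 q\<^sub>3 q\<^sub>4))" "determined_by (qpoly q\<^sub>0 q\<^sub>1 q\<^sub>3 q\<^sub>4) ?D h"
      using extremal_converse[OF assms c(1) refl c(2,3)] by blast
    have "Ppoly (qpoly q\<^sub>0 q\<^sub>1 q\<^sub>3 q\<^sub>4) \<noteq> 0" using coeff_Ppoly_qpoly_2[of q\<^sub>0 q\<^sub>1 q\<^sub>3 q\<^sub>4] by auto
    note conjI[OF q(1) conjI[OF q(2) conjI[OF q(3) exists_least_root[OF this, of a]]]]
    then show "\<exists>q\<^sub>0 q\<^sub>1 q\<^sub>3 q\<^sub>4. admissible m a (qpoly q\<^sub>0 q\<^sub>1 q\<^sub>3 q\<^sub>4) \<and>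
        ?D \<subseteq> max_domain a (Ppoly (qpoly q\<^sub>0 q\<^sub>1 q\<^sub>3 q\<^sub>4)) \<and> determined_by (qpoly q\<^sub>0 q\<^sub>1 q\<^sub>3 q\<^sub>4) ?D h \<and>
        ((\<forall>r>a. poly (Ppoly (qpoly q\<^sub>0 q\<^sub>1 q\<^sub>3 q\<^sub>4)) r \<noteq> 0) \<or>
         (\<exists>b>a. poly (Ppoly (qpoly q\<^sub>0 q\<^sub>1 q\<^sub>3 q\<^sub>4)) b = 0 \<and> (\<forall>r\<in>{a<..<b}. poly (Ppoly (qpoly q\<^sub>0 q\<^sub>1 q\<^sub>3 q\<^sub>4)) r \<noteq> 0)))"
      by blast
  qed
qed

end
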